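(* Let $\mathcal{M}$ be a cofibrantly generated monoidal model category (with generating cofibrations $I$ and generating trivial cofibrations $J$) satisfying the commutative monoid axiom and the monoid axiom, and such that the domains of the maps in $I$ (resp. $J$) are small relative to $(I\otimes\mathcal{M})$-cell (resp. $(J\otimes\mathcal{M})$-cell). Give each category $\mathrm{CAlg}(R)$ of commutative $R$-algebras ($R$ a commutative monoid in $\mathcal{M}$) the model structure in which a map is a weak equivalence or fibration if and only if it is so in $\mathcal{M}$. Then: (1) The passage from $R$ to $\mathrm{CAlg}(R)$ is functorial: given a homomorphism of commutative monoids $f:R\to T$, restriction and extension of scalars ($N\mapsto T\otimes_R N$) provide a Quillen adjunction between $\mathrm{CAlg}(R)$ and $\mathrm{CAlg}(T)$. (2) Suppose that cofibrant objects are flat in $\mathrm{CAlg}(R)$, i.e. for any cofibrant commutative $R$-algebra $N$, the functor $N\otimes_R-$ preserves weak equivalences of commutative $R$-algebras. Let $f:R\to T$ be a weak equivalence of commutative monoids. Then $f$ induces (via extension and restriction of scalars) a Quillen equivalence $\mathrm{CAlg}(R)\simeq\mathrm{CAlg}(T)$.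
   Context: A monoidal model category is a model category $\mathcal{M}$ with a closed symmetric monoidal structure $(\otimes,S)$ such that: (unit axiom) for every cofibrant $X$ and cofibrant replacement $QS\to S$, the map $QS\otimes X\to S\otimes X\cong X$ is a weak equivalence; (pushout product axiom) for cofibrations $f:X_0\to X_1$, $g:Y_0\to Y_1$, the map $f\,\square\, g: X_0\otimes Y_1\coprod_{X_0\otimes Y_0}X_1\otimes Y_0\to X_1\otimes Y_1$ is a cofibration, trivial if $f$ or $g$ is trivial. For a map $h:K\to L$, $h^{\square n}:Q_n\to L^{\otimes n}$ is the iterated pushout product: $Q_n$ is the colimit of the punctured $n$-cube whose vertices are the words $C_1\otimes\cdots\otimes C_n$ with $C_i\in\{K,L\}$, not all equal to $L$. The group $\Sigma_n$ acts by permuting factors, and $h^{\square n}/\Sigma_n:Q_n/\Sigma_n\to L^{\otimes n}/\Sigma_n$ is the induced map on coinvariants. Commutative monoid axiom: if $h$ is a trivial cofibration then $h^{\square n}/\Sigma_n$ is a trivial cofibration for all $n>0$. For a class of maps $\mathcal{C}$, $\mathcal{C}\otimes\mathcal{M}$ is the class of maps $f\otimes \mathrm{id}_X$ with $f\in\mathcal{C}$, $X\in\mathcal{M}$, and $\mathcal{C}$-cell is the class of transfinite compositions of pushouts of maps in $\mathcal{C}$. Monoid axiom: every map in (Trivial cofibrations $\otimes\,\mathcal{M}$)-cell is a weak equivalence. A commutative $R$-algebra is a commutative monoid in $\mathcal{M}$ equipped with a map of commutative monoids from $R$. Under the stated hypotheses the described model structure on $\mathrm{CAlg}(R)$ exists.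 *)

theory Defs
  imports "HOL-Library.Equipollence" "HOL-Combinatorics.Permutations"
begin

section \<open>Categories, functors, adjunctions\<close>

record ('o, 'm) cat =
  Obj :: "'o set"
  Arr :: "'m set"
  Dom :: "'m \<Rightarrow> 'o"
  Cod :: "'m \<Rightarrow> 'o"
  Id :: "'o \<Rightarrow> 'm"
  Comp :: "'m \<Rightarrow> 'm \<Rightarrow> 'm" (infixl "\<cdot>\<index>" 70)

definition hom :: "('o, 'm, 'z) cat_scheme \<Rightarrow> 'o \<Rightarrow> 'o \<Rightarrow> 'm set" where
  "hom C A B = {f \<in> Arr C. Dom C f = A \<and> Cod C f = B}"

locale category =
  fixes C :: "('o, 'm, 'z) cat_scheme" (structure)
  assumes dom_obj: "f \<in> Arr C \<Longrightarrow> Dom C f \<in> Obj C"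
    and cod_obj: "f \<in> Arr C \<Longrightarrow> Cod C f \<in> Obj C"
    and id_hom: "A \<in> Obj C \<Longrightarrow> Id C A \<in> hom C A A"
    and comp_hom: "f \<in> hom C A B \<Longrightarrow> g \<in> hom C B D \<Longrightarrow> g \<cdot> f \<in> hom C A D"
    and comp_id_right: "f \<in> hom C A B \<Longrightarrow> f \<cdot> Id C A = f"
    and comp_id_left: "f \<in> hom C A B \<Longrightarrow> Id C B \<cdot> f = f"
    and comp_assoc: "f \<in> hom C A B \<Longrightarrow> g \<in> hom C B D \<Longrightarrow> h \<in> hom C D E
      \<Longrightarrow> h \<cdot> g \<cdot> f = h \<cdot> (g \<cdot> f)"

definition inverse_in :: "('o, 'm, 'z) cat_scheme \<Rightarrow> 'm \<Rightarrow> 'm \<Rightarrow> bool" where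
  "inverse_in C f g \<longleftrightarrow> f \<in> Arr C \<and> g \<in> hom C (Cod C f) (Dom C f) \<and>
     g \<cdot>\<^bsub>C\<^esub> f = Id C (Dom C f) \<and> f \<cdot>\<^bsub>C\<^esub> g = Id C (Cod C f)"

definition is_iso :: "('o, 'm, 'z) cat_scheme \<Rightarrow> 'm \<Rightarrow> bool" where
  "is_iso C f \<longleftrightarrow> (\<exists>g. inverse_in C f g)"

definition inv_arr :: "('o, 'm, 'z) cat_scheme \<Rightarrow> 'm \<Rightarrow> 'm" where
  "inv_arr C f = (THE g. inverse_in C f g)"

record ('o1, 'm1, 'o2, 'm2) ftor =
  fobj :: "'o1 \<Rightarrow> 'o2"
  farr :: "'m1 \<Rightarrow> 'm2"

definition is_functor ::
  "('o1, 'm1, 'y) cat_scheme \<Rightarrow> ('o2, 'm2, 'z) cat_scheme \<Rightarrow> ('o1, 'm1, 'o2, 'm2) ftor \<Rightarrow> bool" where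
  "is_functor C D F \<longleftrightarrow> category C \<and> category D \<and>
     (\<forall>A\<in>Obj C. fobj F A \<in> Obj D \<and> farr F (Id C A) = Id D (fobj F A)) \<and>
     (\<forall>f\<in>Arr C. farr F f \<in> hom D (fobj F (Dom C f)) (fobj F (Cod C f))) \<and>
     (\<forall>f\<in>Arr C. \<forall>g\<in>Arr C. Dom C g = Cod C f \<longrightarrow>
        farr F (g \<cdot>\<^bsub>C\<^esub> f) = farr F g \<cdot>\<^bsub>D\<^esub> farr F f)"

definition id_ftor :: "('o, 'm, 'o, 'm) ftor" where
  "id_ftor = \<lparr>fobj = (\<lambda>A. A), farr = (\<lambda>f. f)\<rparr>"

definition comp_ftor ::
  "('o2, 'm2, 'o3, 'm3) ftor \<Rightarrow> ('o1, 'm1, 'o2, 'm2) ftor \<Rightarrow> ('o1, 'm1, 'o3, 'm3) ftor" where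
  "comp_ftor G F = \<lparr>fobj = fobj G \<circ> fobj F, farr = farr G \<circ> farr F\<rparr>"

definition ftor_eq_on ::
  "('o1, 'm1, 'y) cat_scheme \<Rightarrow> ('o1, 'm1, 'o2, 'm2) ftor \<Rightarrow> ('o1, 'm1, 'o2, 'm2) ftor \<Rightarrow> bool" where
  "ftor_eq_on C F G \<longleftrightarrow>
     (\<forall>A\<in>Obj C. fobj F A = fobj G A) \<and> (\<forall>f\<in>Arr C. farr F f = farr G f)"

definition naturally_isomorphic ::
  "('o1, 'm1, 'y) cat_scheme \<Rightarrow> ('o2, 'm2, 'z) cat_scheme \<Rightarrow>
    ('o1, 'm1, 'o2, 'm2) ftor \<Rightarrow> ('o1, 'm1, 'o2, 'm2) ftor \<Rightarrow> bool" where
  "naturally_isomorphic C D F G \<longleftrightarrow> (\<exists>\<eta>.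
     (\<forall>A\<in>Obj C. \<eta> A \<in> hom D (fobj F A) (fobj G A) \<and> is_iso D (\<eta> A)) \<and>
     (\<forall>f\<in>Arr C. \<eta> (Cod C f) \<cdot>\<^bsub>D\<^esub> farr F f = farr G f \<cdot>\<^bsub>D\<^esub> \<eta> (Dom C f)))"

text \<open>\<open>adjunction C D F G \<phi>\<close>: \<open>F : C \<rightarrow> D\<close> is left adjoint to \<open>G\<close> through the natural bijections
  \<open>\<phi> A B : hom D (F A) B \<rightarrow> hom C A (G B)\<close>.\<close>

definition adjunction ::
  "('o1, 'm1, 'y) cat_scheme \<Rightarrow> ('o2, 'm2, 'z) cat_scheme \<Rightarrow>
    ('o1, 'm1, 'o2, 'm2) ftor \<Rightarrow> ('o2, 'm2, 'o1, 'm1) ftor \<Rightarrow> ('o1 \<Rightarrow> 'o2 \<Rightarrow> 'm2 \<Rightarrow> 'm1) \<Rightarrow> bool" where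
  "adjunction C D F G \<phi> \<longleftrightarrow> is_functor C D F \<and> is_functor D C G \<and>
     (\<forall>A\<in>Obj C. \<forall>B\<in>Obj D. bij_betw (\<phi> A B) (hom D (fobj F A) B) (hom C A (fobj G B))) \<and>
     (\<forall>a\<in>Arr C. \<forall>b\<in>Arr D. \<forall>g\<in>hom D (fobj F (Cod C a)) (Dom D b).
        \<phi> (Dom C a) (Cod D b) (b \<cdot>\<^bsub>D\<^esub> g \<cdot>\<^bsub>D\<^esub> farr F a) =
        farr G b \<cdot>\<^bsub>C\<^esub> \<phi> (Cod C a) (Dom D b) g \<cdot>\<^bsub>C\<^esub> a)"


section \<open>Limits and colimits\<close>

definition cocone ::
  "('o, 'm, 'z) cat_scheme \<Rightarrow> ('i, 'j, 'y) cat_scheme \<Rightarrow> ('i, 'j, 'o, 'm) ftor \<Rightarrow> 'o \<Rightarrow> ('i \<Rightarrow> 'm) \<Rightarrow> bool" where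
  "cocone C J D X l \<longleftrightarrow> X \<in> Obj C \<and> (\<forall>i\<in>Obj J. l i \<in> hom C (fobj D i) X) \<and>
     (\<forall>a\<in>Arr J. l (Cod J a) \<cdot>\<^bsub>C\<^esub> farr D a = l (Dom J a))"

definition colimit ::
  "('o, 'm, 'z) cat_scheme \<Rightarrow> ('i, 'j, 'y) cat_scheme \<Rightarrow> ('i, 'j, 'o, 'm) ftor \<Rightarrow> 'o \<Rightarrow> ('i \<Rightarrow> 'm) \<Rightarrow> bool" where
  "colimit C J D X l \<longleftrightarrow> cocone C J D X l \<and>
     (\<forall>Y k. cocone C J D Y k \<longrightarrow> (\<exists>!u. u \<in> hom C X Y \<and> (\<forall>i\<in>Obj J. u \<cdot>\<^bsub>C\<^esub> l i = k i)))"

definition cone ::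
  "('o, 'm, 'z) cat_scheme \<Rightarrow> ('i, 'j, 'y) cat_scheme \<Rightarrow> ('i, 'j, 'o, 'm) ftor \<Rightarrow> 'o \<Rightarrow> ('i \<Rightarrow> 'm) \<Rightarrow> bool" where
  "cone C J D X l \<longleftrightarrow> X \<in> Obj C \<and> (\<forall>i\<in>Obj J. l i \<in> hom C X (fobj D i)) \<and>
     (\<forall>a\<in>Arr J. farr D a \<cdot>\<^bsub>C\<^esub> l (Dom J a) = l (Cod J a))"

definition limit ::
  "('o, 'm, 'z) cat_scheme \<Rightarrow> ('i, 'j, 'y) cat_scheme \<Rightarrow> ('i, 'j, 'o, 'm) ftor \<Rightarrow> 'o \<Rightarrow> ('i \<Rightarrow> 'm) \<Rightarrow> bool" where
  "limit C J D X l \<longleftrightarrow> cone C J D X l \<and>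
     (\<forall>Y k. cone C J D Y k \<longrightarrow> (\<exists>!u. u \<in> hom C Y X \<and> (\<forall>i\<in>Obj J. l i \<cdot>\<^bsub>C\<^esub> u = k i)))"

definition initial :: "('o, 'm, 'z) cat_scheme \<Rightarrow> 'o \<Rightarrow> bool" where
  "initial C Z \<longleftrightarrow> Z \<in> Obj C \<and> (\<forall>X\<in>Obj C. \<exists>!f. f \<in> hom C Z X)"

definition terminal :: "('o, 'm, 'z) cat_scheme \<Rightarrow> 'o \<Rightarrow> bool" where
  "terminal C Z \<longleftrightarrow> Z \<in> Obj C \<and> (\<forall>X\<in>Obj C. \<exists>!f. f \<in> hom C X Z)"

definition coequalizer :: "('o, 'm, 'z) cat_scheme \<Rightarrow> 'm \<Rightarrow> 'm \<Rightarrow> 'm \<Rightarrow> bool" where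
  "coequalizer C u v p \<longleftrightarrow>
     u \<in> Arr C \<and> v \<in> hom C (Dom C u) (Cod C u) \<and> p \<in> Arr C \<and> Dom C p = Cod C u \<and>
     p \<cdot>\<^bsub>C\<^esub> u = p \<cdot>\<^bsub>C\<^esub> v \<and>
     (\<forall>q\<in>Arr C. Dom C q = Cod C u \<and> q \<cdot>\<^bsub>C\<^esub> u = q \<cdot>\<^bsub>C\<^esub> v \<longrightarrow>
        (\<exists>!k. k \<in> hom C (Cod C p) (Cod C q) \<and> k \<cdot>\<^bsub>C\<^esub> p = q))"

text \<open>\<open>pushout C f g h k\<close>: the square \<open>h \<cdot> f = k \<cdot> g\<close> is a pushout of the span \<open>f, g\<close>; so \<open>k\<close> is the
  pushout of \<open>f\<close> along \<open>g\<close>.\<close>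

definition pushout :: "('o, 'm, 'z) cat_scheme \<Rightarrow> 'm \<Rightarrow> 'm \<Rightarrow> 'm \<Rightarrow> 'm \<Rightarrow> bool" where
  "pushout C f g h k \<longleftrightarrow> {f, g, h, k} \<subseteq> Arr C \<and> Dom C f = Dom C g \<and>
     Dom C h = Cod C f \<and> Dom C k = Cod C g \<and> Cod C h = Cod C k \<and>
     h \<cdot>\<^bsub>C\<^esub> f = k \<cdot>\<^bsub>C\<^esub> g \<and>
     (\<forall>x\<in>Arr C. \<forall>y\<in>Arr C. Dom C x = Cod C f \<and> Dom C y = Cod C g \<and> Cod C x = Cod C y \<and>
        x \<cdot>\<^bsub>C\<^esub> f = y \<cdot>\<^bsub>C\<^esub> g \<longrightarrow>
        (\<exists>!u. u \<in> hom C (Cod C h) (Cod C x) \<and> u \<cdot>\<^bsub>C\<^esub> h = x \<and> u \<cdot>\<^bsub>C\<^esub> k = y))"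

text \<open>Coinvariants of a set \<open>G\<close> of endomorphisms of \<open>X\<close>.\<close>

definition coinvariants :: "('o, 'm, 'z) cat_scheme \<Rightarrow> 'o \<Rightarrow> 'm set \<Rightarrow> 'm \<Rightarrow> bool" where
  "coinvariants C X G q \<longleftrightarrow> q \<in> Arr C \<and> Dom C q = X \<and> (\<forall>g\<in>G. q \<cdot>\<^bsub>C\<^esub> g = q) \<and>
     (\<forall>x\<in>Arr C. Dom C x = X \<and> (\<forall>g\<in>G. x \<cdot>\<^bsub>C\<^esub> g = x) \<longrightarrow>
        (\<exists>!u. u \<in> hom C (Cod C q) (Cod C x) \<and> u \<cdot>\<^bsub>C\<^esub> q = x))"

text \<open>HOL has no universe of small sets. A set is called small relative to a type \<open>'u\<close> if its
  cardinality is strictly below that of \<open>'u\<close>; if the cardinality of \<open>'u\<close> is inaccessible, these are,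
  up to bijection, the elements of a Grothendieck universe. Every small category is isomorphic to
  one whose objects and arrows are elements of \<open>'u\<close>, and every small ordinal is the type of a
  well-order on a small subset of \<open>'u\<close>. Limits, colimits, ordinals and generating sets below are all
  small relative to the same \<open>'u\<close>.\<close>

definition small :: "'u itself \<Rightarrow> 'a set \<Rightarrow> bool" where
  "small U A \<longleftrightarrow> A \<prec> (UNIV :: 'u set)"

definition complete_cat :: "'u itself \<Rightarrow> ('o, 'm, 'z) cat_scheme \<Rightarrow> bool" where
  "complete_cat U C \<longleftrightarrow> (\<forall>(J :: ('u, 'u) cat) D.
     small U (Obj J) \<and> small U (Arr J) \<and> is_functor J C D \<longrightarrow> (\<exists>X l. limit C J D X l))"

definition cocomplete_cat :: "'u itself \<Rightarrow> ('o, 'm, 'z) cat_scheme \<Rightarrow> bool" where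
  "cocomplete_cat U C \<longleftrightarrow> (\<forall>(J :: ('u, 'u) cat) D.
     small U (Obj J) \<and> small U (Arr J) \<and> is_functor J C D \<longrightarrow> (\<exists>X l. colimit C J D X l))"

definition poset_cat :: "'i rel \<Rightarrow> ('i, 'i \<times> 'i) cat" where
  "poset_cat r = \<lparr>Obj = Field r, Arr = r, Dom = fst, Cod = snd,
     Id = (\<lambda>a. (a, a)), Comp = (\<lambda>g f. (fst f, snd g))\<rparr>"


section \<open>Transfinite compositions and smallness\<close>

text \<open>A small ordinal is a well-order \<open>r\<close> on a subset of \<open>'u\<close>, with \<open>(a, b) \<in> r\<close> meaning \<open>a \<le> b\<close>.\<close>

definition small_ordinal :: "'u itself \<Rightarrow> 'u rel \<Rightarrow> bool" where
  "small_ordinal U r \<longleftrightarrow> Well_order r \<and> small U (Field r)"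

definition is_succ :: "'i rel \<Rightarrow> 'i \<Rightarrow> 'i \<Rightarrow> bool" where
  "is_succ r a b \<longleftrightarrow> a \<in> underS r b \<and> (\<forall>c\<in>underS r b. (c, a) \<in> r)"

definition is_limit_elem :: "'i rel \<Rightarrow> 'i \<Rightarrow> bool" where
  "is_limit_elem r c \<longleftrightarrow> c \<in> Field r \<and> underS r c \<noteq> {} \<and> (\<nexists>a. is_succ r a c)"

text \<open>Sequences indexed by \<open>r\<close> that are colimit preserving (at limit elements) and whose successor
  steps lie in \<open>S\<close>.\<close>

definition is_sequence ::
  "('o, 'm, 'z) cat_scheme \<Rightarrow> 'm set \<Rightarrow> 'i rel \<Rightarrow> ('i, 'i \<times> 'i, 'o, 'm) ftor \<Rightarrow> bool" where
  "is_sequence C S r X \<longleftrightarrow> is_functor (poset_cat r) C X \<and>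
     (\<forall>c. is_limit_elem r c \<longrightarrow>
        colimit C (poset_cat (Restr r (underS r c))) X (fobj X c) (\<lambda>a. farr X (a, c))) \<and>
     (\<forall>a b. is_succ r a b \<longrightarrow> farr X (a, b) \<in> S)"

definition transfinite_compositions ::
  "'u itself \<Rightarrow> ('o, 'm, 'z) cat_scheme \<Rightarrow> 'm set \<Rightarrow> 'm set" where
  "transfinite_compositions U C S = {f. \<exists>(r :: 'u rel) X Y l z. small_ordinal U r \<and>
     is_sequence C S r X \<and> colimit C (poset_cat r) X Y l \<and>
     z \<in> Field r \<and> underS r z = {} \<and> f = l z}"

definition pushouts_of :: "('o, 'm, 'z) cat_scheme \<Rightarrow> 'm set \<Rightarrow> 'm set" where
  "pushouts_of C S = {k. \<exists>f\<in>S. \<exists>g h. pushout C f g h k}"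

definition cell :: "'u itself \<Rightarrow> ('o, 'm, 'z) cat_scheme \<Rightarrow> 'm set \<Rightarrow> 'm set" where
  "cell U C S = transfinite_compositions U C (pushouts_of C S)"

text \<open>\<open>r\<close> is a limit ordinal in which every subset of cardinality at most that of \<open>K\<close> has supremum
  below \<open>r\<close>.\<close>

definition filtered_ordinal :: "'k set \<Rightarrow> 'i rel \<Rightarrow> bool" where
  "filtered_ordinal K r \<longleftrightarrow> Field r \<noteq> {} \<and> (\<forall>a\<in>Field r. \<exists>b\<in>Field r. a \<in> underS r b) \<and>
     (\<forall>A\<subseteq>Field r. A \<lesssim> K \<longrightarrow> (\<exists>b\<in>Field r. A \<subseteq> underS r b))"

text \<open>\<open>A\<close> is small relative to \<open>S\<close>: for some small cardinal, represented by a small set \<open>K\<close>, and every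
  \<open>K\<close>-filtered sequence \<open>X\<close> with steps in \<open>S\<close>, the canonical map from the (directed) colimit of the
  sets \<open>hom C A (X a)\<close> to \<open>hom C A (colim X)\<close> is surjective and injective.\<close>

definition small_relative_to ::
  "'u itself \<Rightarrow> ('o, 'm, 'z) cat_scheme \<Rightarrow> 'm set \<Rightarrow> 'o \<Rightarrow> bool" where
  "small_relative_to U C S A \<longleftrightarrow> (\<exists>K :: 'u set. small U K \<and>
     (\<forall>(r :: 'u rel) X Y l. small_ordinal U r \<and> filtered_ordinal K r \<and>
        is_sequence C S r X \<and> colimit C (poset_cat r) X Y l \<longrightarrow>
        (\<forall>f\<in>hom C A Y. \<exists>a\<in>Field r. \<exists>g\<in>hom C A (fobj X a). f = l a \<cdot>\<^bsub>C\<^esub> g) \<and>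
        (\<forall>a\<in>Field r. \<forall>g\<in>hom C A (fobj X a). \<forall>g'\<in>hom C A (fobj X a).
           l a \<cdot>\<^bsub>C\<^esub> g = l a \<cdot>\<^bsub>C\<^esub> g' \<longrightarrow>
           (\<exists>b. (a, b) \<in> r \<and> farr X (a, b) \<cdot>\<^bsub>C\<^esub> g = farr X (a, b) \<cdot>\<^bsub>C\<^esub> g'))))"


section \<open>Model categories\<close>

record 'm model_structure =
  weq :: "'m set"
  fib :: "'m set"
  cof :: "'m set"

abbreviation triv_fib :: "'m model_structure \<Rightarrow> 'm set" where
  "triv_fib W \<equiv> fib W \<inter> weq W"

abbreviation triv_cof :: "'m model_structure \<Rightarrow> 'm set" where
  "triv_cof W \<equiv> cof W \<inter> weq W"

definition has_lift :: "('o, 'm, 'z) cat_scheme \<Rightarrow> 'm \<Rightarrow> 'm \<Rightarrow> bool" where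
  "has_lift C i p \<longleftrightarrow>
     (\<forall>u\<in>hom C (Dom C i) (Dom C p). \<forall>v\<in>hom C (Cod C i) (Cod C p).
        p \<cdot>\<^bsub>C\<^esub> u = v \<cdot>\<^bsub>C\<^esub> i \<longrightarrow>
        (\<exists>d\<in>hom C (Cod C i) (Dom C p). d \<cdot>\<^bsub>C\<^esub> i = u \<and> p \<cdot>\<^bsub>C\<^esub> d = v))"

definition llp :: "('o, 'm, 'z) cat_scheme \<Rightarrow> 'm set \<Rightarrow> 'm set" where
  "llp C S = {i \<in> Arr C. \<forall>p\<in>S. has_lift C i p}"

definition rlp :: "('o, 'm, 'z) cat_scheme \<Rightarrow> 'm set \<Rightarrow> 'm set" where
  "rlp C S = {p \<in> Arr C. \<forall>i\<in>S. has_lift C i p}"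

definition retract_of :: "('o, 'm, 'z) cat_scheme \<Rightarrow> 'm \<Rightarrow> 'm \<Rightarrow> bool" where
  "retract_of C f g \<longleftrightarrow> f \<in> Arr C \<and> g \<in> Arr C \<and>
     (\<exists>i\<in>hom C (Dom C f) (Dom C g). \<exists>r\<in>hom C (Dom C g) (Dom C f).
      \<exists>j\<in>hom C (Cod C f) (Cod C g). \<exists>s\<in>hom C (Cod C g) (Cod C f).
        r \<cdot>\<^bsub>C\<^esub> i = Id C (Dom C f) \<and> s \<cdot>\<^bsub>C\<^esub> j = Id C (Cod C f) \<and>
        g \<cdot>\<^bsub>C\<^esub> i = j \<cdot>\<^bsub>C\<^esub> f \<and> f \<cdot>\<^bsub>C\<^esub> r = s \<cdot>\<^bsub>C\<^esub> g)"

locale model_category = category C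
  for C :: "('o, 'm, 'z) cat_scheme" (structure) +
  fixes U :: "'u itself" and W :: "'m model_structure"
  assumes has_limits: "complete_cat U C"
    and has_colimits: "cocomplete_cat U C"
    and weq_arr: "weq W \<subseteq> Arr C" and fib_arr: "fib W \<subseteq> Arr C" and cof_arr: "cof W \<subseteq> Arr C"
    and two_of_three: "f \<in> hom C A B \<Longrightarrow> g \<in> hom C B D \<Longrightarrow>
      (f \<in> weq W \<and> g \<in> weq W \<longrightarrow> g \<cdot> f \<in> weq W) \<and>
      (f \<in> weq W \<and> g \<cdot> f \<in> weq W \<longrightarrow> g \<in> weq W) \<and>
      (g \<in> weq W \<and> g \<cdot> f \<in> weq W \<longrightarrow> f \<in> weq W)"
    and retract_weq: "retract_of C f g \<Longrightarrow> g \<in> weq W \<Longrightarrow> f \<in> weq W"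
    and retract_fib: "retract_of C f g \<Longrightarrow> g \<in> fib W \<Longrightarrow> f \<in> fib W"
    and retract_cof: "retract_of C f g \<Longrightarrow> g \<in> cof W \<Longrightarrow> f \<in> cof W"
    and lift_triv_cof: "i \<in> triv_cof W \<Longrightarrow> p \<in> fib W \<Longrightarrow> has_lift C i p"
    and lift_triv_fib: "i \<in> cof W \<Longrightarrow> p \<in> triv_fib W \<Longrightarrow> has_lift C i p"
    and factor_triv_cof: "f \<in> Arr C \<Longrightarrow>
      \<exists>i\<in>triv_cof W. \<exists>p\<in>fib W. Cod C i = Dom C p \<and> f = p \<cdot> i"
    and factor_triv_fib: "f \<in> Arr C \<Longrightarrow>
      \<exists>i\<in>cof W. \<exists>p\<in>triv_fib W. Cod C i = Dom C p \<and> f = p \<cdot> i"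

definition cofibrant :: "('o, 'm, 'z) cat_scheme \<Rightarrow> 'm model_structure \<Rightarrow> 'o \<Rightarrow> bool" where
  "cofibrant C W X \<longleftrightarrow> (\<exists>Z. initial C Z \<and> (\<exists>i\<in>hom C Z X. i \<in> cof W))"

definition fibrant :: "('o, 'm, 'z) cat_scheme \<Rightarrow> 'm model_structure \<Rightarrow> 'o \<Rightarrow> bool" where
  "fibrant C W X \<longleftrightarrow> (\<exists>Z. terminal C Z \<and> (\<exists>p\<in>hom C X Z. p \<in> fib W))"

definition cofibrantly_generated ::
  "'u itself \<Rightarrow> ('o, 'm, 'z) cat_scheme \<Rightarrow> 'm model_structure \<Rightarrow> 'm set \<Rightarrow> 'm set \<Rightarrow> bool" where
  "cofibrantly_generated U C W I J \<longleftrightarrow> model_category C U W \<and>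
     I \<subseteq> Arr C \<and> J \<subseteq> Arr C \<and> small U I \<and> small U J \<and>
     (\<forall>i\<in>I. small_relative_to U C (cell U C I) (Dom C i)) \<and>
     (\<forall>j\<in>J. small_relative_to U C (cell U C J) (Dom C j)) \<and>
     fib W = rlp C J \<and> triv_fib W = rlp C I"

definition quillen_adjunction ::
  "'u itself \<Rightarrow> ('o1, 'm1, 'y) cat_scheme \<Rightarrow> 'm1 model_structure \<Rightarrow>
    ('o2, 'm2, 'z) cat_scheme \<Rightarrow> 'm2 model_structure \<Rightarrow>
    ('o1, 'm1, 'o2, 'm2) ftor \<Rightarrow> ('o2, 'm2, 'o1, 'm1) ftor \<Rightarrow> ('o1 \<Rightarrow> 'o2 \<Rightarrow> 'm2 \<Rightarrow> 'm1) \<Rightarrow> bool" where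
  "quillen_adjunction U C V D W F G \<phi> \<longleftrightarrow>
     model_category C U V \<and> model_category D U W \<and> adjunction C D F G \<phi> \<and>
     farr F ` cof V \<subseteq> cof W \<and> farr F ` triv_cof V \<subseteq> triv_cof W"

definition quillen_equivalence ::
  "'u itself \<Rightarrow> ('o1, 'm1, 'y) cat_scheme \<Rightarrow> 'm1 model_structure \<Rightarrow>
    ('o2, 'm2, 'z) cat_scheme \<Rightarrow> 'm2 model_structure \<Rightarrow>
    ('o1, 'm1, 'o2, 'm2) ftor \<Rightarrow> ('o2, 'm2, 'o1, 'm1) ftor \<Rightarrow> ('o1 \<Rightarrow> 'o2 \<Rightarrow> 'm2 \<Rightarrow> 'm1) \<Rightarrow> bool" where
  "quillen_equivalence U C V D W F G \<phi> \<longleftrightarrow> quillen_adjunction U C V D W F G \<phi> \<and>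
     (\<forall>X\<in>Obj C. \<forall>Y\<in>Obj D. cofibrant C V X \<and> fibrant D W Y \<longrightarrow>
        (\<forall>g\<in>hom D (fobj F X) Y. g \<in> weq W \<longleftrightarrow> \<phi> X Y g \<in> weq V))"


section \<open>Closed symmetric monoidal categories\<close>

text \<open>\<open>\<otimes>\<close> is the tensor product of objects, \<open>\<odot>\<close> that of arrows.\<close>

record ('o, 'm) smcat = "('o, 'm) cat" +
  tobj :: "'o \<Rightarrow> 'o \<Rightarrow> 'o" (infixr "\<otimes>\<index>" 75)
  tarr :: "'m \<Rightarrow> 'm \<Rightarrow> 'm" (infixr "\<odot>\<index>" 75)
  unit :: "'o"
  assoc :: "'o \<Rightarrow> 'o \<Rightarrow> 'o \<Rightarrow> 'm"
  lunit :: "'o \<Rightarrow> 'm"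
  runit :: "'o \<Rightarrow> 'm"
  braid :: "'o \<Rightarrow> 'o \<Rightarrow> 'm"

locale symmetric_monoidal_category = category M
  for M :: "('o, 'm, 'z) smcat_scheme" (structure) +
  assumes unit_obj: "unit M \<in> Obj M"
    and tensor_obj: "A \<in> Obj M \<Longrightarrow> B \<in> Obj M \<Longrightarrow> A \<otimes> B \<in> Obj M"
    and tensor_hom: "f \<in> hom M A A' \<Longrightarrow> g \<in> hom M B B' \<Longrightarrow> f \<odot> g \<in> hom M (A \<otimes> B) (A' \<otimes> B')"
    and tensor_id: "A \<in> Obj M \<Longrightarrow> B \<in> Obj M \<Longrightarrow> Id M A \<odot> Id M B = Id M (A \<otimes> B)"
    and tensor_comp: "f \<in> hom M A A' \<Longrightarrow> f' \<in> hom M A' A'' \<Longrightarrow> g \<in> hom M B B' \<Longrightarrow> g' \<in> hom M B' B''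
      \<Longrightarrow> (f' \<cdot> f) \<odot> (g' \<cdot> g) = (f' \<odot> g') \<cdot> (f \<odot> g)"
    and assoc_hom: "A \<in> Obj M \<Longrightarrow> B \<in> Obj M \<Longrightarrow> D \<in> Obj M
      \<Longrightarrow> assoc M A B D \<in> hom M ((A \<otimes> B) \<otimes> D) (A \<otimes> (B \<otimes> D))"
    and assoc_iso: "A \<in> Obj M \<Longrightarrow> B \<in> Obj M \<Longrightarrow> D \<in> Obj M \<Longrightarrow> is_iso M (assoc M A B D)"
    and assoc_nat: "f \<in> hom M A A' \<Longrightarrow> g \<in> hom M B B' \<Longrightarrow> h \<in> hom M D D'
      \<Longrightarrow> assoc M A' B' D' \<cdot> ((f \<odot> g) \<odot> h) = (f \<odot> (g \<odot> h)) \<cdot> assoc M A B D"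
    and lunit_hom: "A \<in> Obj M \<Longrightarrow> lunit M A \<in> hom M (unit M \<otimes> A) A"
    and lunit_iso: "A \<in> Obj M \<Longrightarrow> is_iso M (lunit M A)"
    and lunit_nat: "f \<in> hom M A A' \<Longrightarrow> lunit M A' \<cdot> (Id M (unit M) \<odot> f) = f \<cdot> lunit M A"
    and runit_hom: "A \<in> Obj M \<Longrightarrow> runit M A \<in> hom M (A \<otimes> unit M) A"
    and runit_iso: "A \<in> Obj M \<Longrightarrow> is_iso M (runit M A)"
    and runit_nat: "f \<in> hom M A A' \<Longrightarrow> runit M A' \<cdot> (f \<odot> Id M (unit M)) = f \<cdot> runit M A"
    and braid_hom: "A \<in> Obj M \<Longrightarrow> B \<in> Obj M \<Longrightarrow> braid M A B \<in> hom M (A \<otimes> B) (B \<otimes> A)"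
    and braid_nat: "f \<in> hom M A A' \<Longrightarrow> g \<in> hom M B B'
      \<Longrightarrow> braid M A' B' \<cdot> (f \<odot> g) = (g \<odot> f) \<cdot> braid M A B"
    and braid_sym: "A \<in> Obj M \<Longrightarrow> B \<in> Obj M \<Longrightarrow> braid M B A \<cdot> braid M A B = Id M (A \<otimes> B)"
    and pentagon: "A \<in> Obj M \<Longrightarrow> B \<in> Obj M \<Longrightarrow> D \<in> Obj M \<Longrightarrow> E \<in> Obj M
      \<Longrightarrow> assoc M A B (D \<otimes> E) \<cdot> assoc M (A \<otimes> B) D E =
          (Id M A \<odot> assoc M B D E) \<cdot> assoc M A (B \<otimes> D) E \<cdot> (assoc M A B D \<odot> Id M E)"
    and triangle: "A \<in> Obj M \<Longrightarrow> B \<in> Obj M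
      \<Longrightarrow> (Id M A \<odot> lunit M B) \<cdot> assoc M A (unit M) B = runit M A \<odot> Id M B"
    and hexagon: "A \<in> Obj M \<Longrightarrow> B \<in> Obj M \<Longrightarrow> D \<in> Obj M
      \<Longrightarrow> assoc M B D A \<cdot> braid M A (B \<otimes> D) \<cdot> assoc M A B D =
          (Id M B \<odot> braid M A D) \<cdot> assoc M B A D \<cdot> (braid M A B \<odot> Id M D)"

definition tensor_right :: "('o, 'm, 'z) smcat_scheme \<Rightarrow> 'o \<Rightarrow> ('o, 'm, 'o, 'm) ftor" where
  "tensor_right M X = \<lparr>fobj = (\<lambda>A. A \<otimes>\<^bsub>M\<^esub> X), farr = (\<lambda>f. f \<odot>\<^bsub>M\<^esub> Id M X)\<rparr>"

definition closed_smcat :: "('o, 'm, 'z) smcat_scheme \<Rightarrow> bool" where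
  "closed_smcat M \<longleftrightarrow> symmetric_monoidal_category M \<and>
     (\<forall>X\<in>Obj M. \<exists>G \<phi>. adjunction M M (tensor_right M X) G \<phi>)"


section \<open>Monoidal model categories\<close>

text \<open>A cofibrant replacement of the unit is a trivial fibration from a cofibrant object.\<close>

definition unit_axiom :: "('o, 'm, 'z) smcat_scheme \<Rightarrow> 'm model_structure \<Rightarrow> bool" where
  "unit_axiom M W \<longleftrightarrow> (\<forall>X\<in>Obj M. \<forall>Q\<in>Obj M. \<forall>q\<in>hom M Q (unit M).
     cofibrant M W X \<and> cofibrant M W Q \<and> q \<in> triv_fib W \<longrightarrow>
     lunit M X \<cdot>\<^bsub>M\<^esub> (q \<odot>\<^bsub>M\<^esub> Id M X) \<in> weq W)"

text \<open>\<open>u\<close> is the pushout product of \<open>f : X0 \<rightarrow> X1\<close> and \<open>g : Y0 \<rightarrow> Y1\<close>, formed with some pushout of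
  \<open>X1 \<otimes> Y0 \<leftarrow> X0 \<otimes> Y0 \<rightarrow> X0 \<otimes> Y1\<close>.\<close>

definition pushout_product :: "('o, 'm, 'z) smcat_scheme \<Rightarrow> 'm \<Rightarrow> 'm \<Rightarrow> 'm \<Rightarrow> bool" where
  "pushout_product M f g u \<longleftrightarrow> (\<exists>i j.
     pushout M (f \<odot>\<^bsub>M\<^esub> Id M (Dom M g)) (Id M (Dom M f) \<odot>\<^bsub>M\<^esub> g) i j \<and>
     u \<in> hom M (Cod M i) (Cod M f \<otimes>\<^bsub>M\<^esub> Cod M g) \<and>
     u \<cdot>\<^bsub>M\<^esub> i = Id M (Cod M f) \<odot>\<^bsub>M\<^esub> g \<and> u \<cdot>\<^bsub>M\<^esub> j = f \<odot>\<^bsub>M\<^esub> Id M (Cod M g))"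

definition pushout_product_axiom :: "('o, 'm, 'z) smcat_scheme \<Rightarrow> 'm model_structure \<Rightarrow> bool" where
  "pushout_product_axiom M W \<longleftrightarrow> (\<forall>f\<in>cof W. \<forall>g\<in>cof W. \<forall>u. pushout_product M f g u \<longrightarrow>
     u \<in> cof W \<and> (f \<in> weq W \<or> g \<in> weq W \<longrightarrow> u \<in> weq W))"

definition monoidal_model_category ::
  "'u itself \<Rightarrow> ('o, 'm, 'z) smcat_scheme \<Rightarrow> 'm model_structure \<Rightarrow> bool" where
  "monoidal_model_category U M W \<longleftrightarrow> model_category M U W \<and> closed_smcat M \<and>
     unit_axiom M W \<and> pushout_product_axiom M W"

definition tensor_all :: "('o, 'm, 'z) smcat_scheme \<Rightarrow> 'm set \<Rightarrow> 'm set" where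
  "tensor_all M S = {f \<odot>\<^bsub>M\<^esub> Id M X | f X. f \<in> S \<and> X \<in> Obj M}"

definition monoid_axiom ::
  "'u itself \<Rightarrow> ('o, 'm, 'z) smcat_scheme \<Rightarrow> 'm model_structure \<Rightarrow> bool" where
  "monoid_axiom U M W \<longleftrightarrow> cell U M (tensor_all M (triv_cof W)) \<subseteq> weq W"


section \<open>Iterated pushout products and the commutative monoid axiom\<close>

text \<open>Tensor words are bracketed to the right.\<close>

fun tensor_list :: "('o, 'm, 'z) smcat_scheme \<Rightarrow> 'o list \<Rightarrow> 'o" where
  "tensor_list M [] = unit M"
| "tensor_list M [A] = A"
| "tensor_list M (A # B # As) = A \<otimes>\<^bsub>M\<^esub> tensor_list M (B # As)"

fun tensor_arr_list :: "('o, 'm, 'z) smcat_scheme \<Rightarrow> 'm list \<Rightarrow> 'm" where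
  "tensor_arr_list M [] = Id M (unit M)"
| "tensor_arr_list M [f] = f"
| "tensor_arr_list M (f # g # fs) = f \<odot>\<^bsub>M\<^esub> tensor_arr_list M (g # fs)"

text \<open>\<open>swap_at M i As\<close> is the symmetry exchanging the factors \<open>i\<close> and \<open>Suc i\<close> of the word \<open>As\<close>; the
  last equation is a default for \<open>length As \<le> Suc i\<close>.\<close>

fun swap_at :: "('o, 'm, 'z) smcat_scheme \<Rightarrow> nat \<Rightarrow> 'o list \<Rightarrow> 'm" where
  "swap_at M 0 [A, B] = braid M A B"
| "swap_at M 0 (A # B # D # Ds) = (let R = tensor_list M (D # Ds) in
     assoc M B A R \<cdot>\<^bsub>M\<^esub> (braid M A B \<odot>\<^bsub>M\<^esub> Id M R) \<cdot>\<^bsub>M\<^esub> inv_arr M (assoc M A B R))"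
| "swap_at M (Suc i) (A # B # As) = Id M A \<odot>\<^bsub>M\<^esub> swap_at M i (B # As)"
| "swap_at M i As = Id M (tensor_list M As)"

text \<open>\<open>perm_iso M As p s\<close>: \<open>s\<close> is the symmetry isomorphism from the tensor of \<open>As\<close> to the tensor of
  \<open>permute_list p As\<close>, written as a composite of adjacent transpositions. By coherence \<open>s\<close> depends
  only on \<open>As\<close> and \<open>p\<close>.\<close>

inductive perm_iso :: "('o, 'm, 'z) smcat_scheme \<Rightarrow> 'o list \<Rightarrow> (nat \<Rightarrow> nat) \<Rightarrow> 'm \<Rightarrow> bool"
  for M As where
  refl: "perm_iso M As id (Id M (tensor_list M As))"
| step: "perm_iso M As p s \<Longrightarrow> Suc i < length As \<Longrightarrow>
     perm_iso M As (p \<circ> transpose i (Suc i)) (swap_at M i (permute_list p As) \<cdot>\<^bsub>M\<^esub> s)"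

text \<open>A vertex of the \<open>n\<close>-cube is a list of \<open>n\<close> booleans; \<open>False\<close> stands for the source \<open>K\<close> and \<open>True\<close>
  for the target \<open>L\<close> of \<open>h\<close>.\<close>

definition cube_word :: "('o, 'm, 'z) smcat_scheme \<Rightarrow> 'm \<Rightarrow> bool list \<Rightarrow> 'o list" where
  "cube_word M h b = map (\<lambda>x. if x then Cod M h else Dom M h) b"

definition cube_map :: "('o, 'm, 'z) smcat_scheme \<Rightarrow> 'm \<Rightarrow> bool list \<Rightarrow> bool list \<Rightarrow> 'm" where
  "cube_map M h b c = tensor_arr_list M
     (map2 (\<lambda>x y. if x = y then Id M (if x then Cod M h else Dom M h) else h) b c)"

definition cube_ftor :: "('o, 'm, 'z) smcat_scheme \<Rightarrow> 'm \<Rightarrow> (bool list, bool list \<times> bool list, 'o, 'm) ftor" where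
  "cube_ftor M h = \<lparr>fobj = (\<lambda>b. tensor_list M (cube_word M h b)), farr = (\<lambda>(b, c). cube_map M h b c)\<rparr>"

definition punctured_cube :: "nat \<Rightarrow> bool list rel" where
  "punctured_cube n = {(b, c). length b = n \<and> length c = n \<and> list_all2 (\<le>) b c \<and>
     b \<noteq> replicate n True \<and> c \<noteq> replicate n True}"

text \<open>\<open>k : Q \<rightarrow> L\<^sup>\<otimes>\<^sup>n\<close> is the iterated pushout product of \<open>h\<close>, where \<open>Q\<close> with legs \<open>l\<close> is a colimit of the
  punctured cube.\<close>

definition iterated_pushout_product ::
  "('o, 'm, 'z) smcat_scheme \<Rightarrow> 'm \<Rightarrow> nat \<Rightarrow> 'o \<Rightarrow> (bool list \<Rightarrow> 'm) \<Rightarrow> 'm \<Rightarrow> bool" where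
  "iterated_pushout_product M h n Q l k \<longleftrightarrow>
     colimit M (poset_cat (punctured_cube n)) (cube_ftor M h) Q l \<and>
     k \<in> hom M Q (tensor_list M (replicate n (Cod M h))) \<and>
     (\<forall>b\<in>Field (punctured_cube n). k \<cdot>\<^bsub>M\<^esub> l b = cube_map M h b (replicate n True))"

definition power_action :: "('o, 'm, 'z) smcat_scheme \<Rightarrow> nat \<Rightarrow> 'o \<Rightarrow> 'm set" where
  "power_action M n L = {s. \<exists>p. p permutes {..<n} \<and> perm_iso M (replicate n L) p s}"

definition cube_action ::
  "('o, 'm, 'z) smcat_scheme \<Rightarrow> 'm \<Rightarrow> nat \<Rightarrow> 'o \<Rightarrow> (bool list \<Rightarrow> 'm) \<Rightarrow> 'm set" where
  "cube_action M h n Q l = {t \<in> hom M Q Q. \<exists>p. p permutes {..<n} \<and>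
     (\<forall>b\<in>Field (punctured_cube n). \<forall>s. perm_iso M (cube_word M h b) p s \<longrightarrow>
        t \<cdot>\<^bsub>M\<^esub> l b = l (permute_list p b) \<cdot>\<^bsub>M\<^esub> s)}"

definition commutative_monoid_axiom :: "('o, 'm, 'z) smcat_scheme \<Rightarrow> 'm model_structure \<Rightarrow> bool" where
  "commutative_monoid_axiom M W \<longleftrightarrow> (\<forall>h\<in>triv_cof W. \<forall>n>0. \<forall>Q l k q q' w.
     iterated_pushout_product M h n Q l k \<and>
     coinvariants M Q (cube_action M h n Q l) q \<and>
     coinvariants M (tensor_list M (replicate n (Cod M h))) (power_action M n (Cod M h)) q' \<and>
     w \<in> hom M (Cod M q) (Cod M q') \<and> w \<cdot>\<^bsub>M\<^esub> q = q' \<cdot>\<^bsub>M\<^esub> k \<longrightarrow>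
     w \<in> triv_cof W)"


section \<open>Commutative monoids and commutative algebras\<close>

record ('o, 'm) mon =
  Car :: 'o
  mul :: 'm
  one :: 'm

definition comm_monoid_in :: "('o, 'm, 'z) smcat_scheme \<Rightarrow> ('o, 'm, 'y) mon_scheme \<Rightarrow> bool" where
  "comm_monoid_in M A \<longleftrightarrow> Car A \<in> Obj M \<and>
     mul A \<in> hom M (Car A \<otimes>\<^bsub>M\<^esub> Car A) (Car A) \<and> one A \<in> hom M (unit M) (Car A) \<and>
     mul A \<cdot>\<^bsub>M\<^esub> (mul A \<odot>\<^bsub>M\<^esub> Id M (Car A)) =
       mul A \<cdot>\<^bsub>M\<^esub> (Id M (Car A) \<odot>\<^bsub>M\<^esub> mul A) \<cdot>\<^bsub>M\<^esub> assoc M (Car A) (Car A) (Car A) \<and>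
     mul A \<cdot>\<^bsub>M\<^esub> (one A \<odot>\<^bsub>M\<^esub> Id M (Car A)) = lunit M (Car A) \<and>
     mul A \<cdot>\<^bsub>M\<^esub> (Id M (Car A) \<odot>\<^bsub>M\<^esub> one A) = runit M (Car A) \<and>
     mul A \<cdot>\<^bsub>M\<^esub> braid M (Car A) (Car A) = mul A"

definition monoid_hom ::
  "('o, 'm, 'z) smcat_scheme \<Rightarrow> ('o, 'm, 'x) mon_scheme \<Rightarrow> ('o, 'm, 'y) mon_scheme \<Rightarrow> 'm \<Rightarrow> bool" where
  "monoid_hom M A B f \<longleftrightarrow> f \<in> hom M (Car A) (Car B) \<and>
     f \<cdot>\<^bsub>M\<^esub> mul A = mul B \<cdot>\<^bsub>M\<^esub> (f \<odot>\<^bsub>M\<^esub> f) \<and> f \<cdot>\<^bsub>M\<^esub> one A = one B"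

text \<open>A commutative \<open>R\<close>-algebra is a commutative monoid with a structure map \<open>smap\<close> from \<open>R\<close>.\<close>

record ('o, 'm) alg = "('o, 'm) mon" +
  smap :: 'm

definition with_smap :: "('o, 'm, 'z) mon_scheme \<Rightarrow> 'm \<Rightarrow> ('o, 'm) alg" where
  "with_smap A f = \<lparr>Car = Car A, mul = mul A, one = one A, smap = f\<rparr>"

definition is_calg :: "('o, 'm, 'z) smcat_scheme \<Rightarrow> ('o, 'm) mon \<Rightarrow> ('o, 'm) alg \<Rightarrow> bool" where
  "is_calg M R A \<longleftrightarrow> comm_monoid_in M A \<and> monoid_hom M R A (smap A)"

type_synonym ('o, 'm) alg_arr = "('o, 'm) alg \<times> 'm \<times> ('o, 'm) alg"

definition CAlg ::
  "('o, 'm, 'z) smcat_scheme \<Rightarrow> ('o, 'm) mon \<Rightarrow> (('o, 'm) alg, ('o, 'm) alg_arr) cat" where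
  "CAlg M R = \<lparr>Obj = {A. is_calg M R A},
     Arr = {(A, f, B). is_calg M R A \<and> is_calg M R B \<and> monoid_hom M A B f \<and> f \<cdot>\<^bsub>M\<^esub> smap A = smap B},
     Dom = (\<lambda>(A, f, B). A), Cod = (\<lambda>(A, f, B). B), Id = (\<lambda>A. (A, Id M (Car A), A)),
     Comp = (\<lambda>(B', g, D) (A, f, B). (A, g \<cdot>\<^bsub>M\<^esub> f, D))\<rparr>"

text \<open>Weak equivalences and fibrations are created in \<open>M\<close>; in any model structure with these two
  classes, the cofibrations are the maps with the left lifting property against trivial
  fibrations.\<close>

definition calg_model ::
  "('o, 'm, 'z) smcat_scheme \<Rightarrow> 'm model_structure \<Rightarrow> ('o, 'm) mon \<Rightarrow> ('o, 'm) alg_arr model_structure" where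
  "calg_model M W R =
     \<lparr>weq = {(A, f, B) \<in> Arr (CAlg M R). f \<in> weq W},
      fib = {(A, f, B) \<in> Arr (CAlg M R). f \<in> fib W},
      cof = llp (CAlg M R) {(A, f, B) \<in> Arr (CAlg M R). f \<in> triv_fib W}\<rparr>"


section \<open>Relative tensor products; restriction and extension of scalars\<close>

text \<open>The actions of \<open>R\<close> on \<open>R\<close>-algebras \<open>A\<close> (from the right) and \<open>B\<close> (from the left) give two maps
  \<open>(A \<otimes> R) \<otimes> B \<rightarrow> A \<otimes> B\<close>; \<open>rtens_proj\<close> is a chosen coequalizer \<open>A \<otimes> B \<rightarrow> A \<otimes>\<^sub>R B\<close> of them.\<close>

definition ract :: "('o, 'm, 'z) smcat_scheme \<Rightarrow> ('o, 'm) alg \<Rightarrow> 'm" where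
  "ract M A = mul A \<cdot>\<^bsub>M\<^esub> (Id M (Car A) \<odot>\<^bsub>M\<^esub> smap A)"

definition lact :: "('o, 'm, 'z) smcat_scheme \<Rightarrow> ('o, 'm) alg \<Rightarrow> 'm" where
  "lact M A = mul A \<cdot>\<^bsub>M\<^esub> (smap A \<odot>\<^bsub>M\<^esub> Id M (Car A))"

definition rtens_proj ::
  "('o, 'm, 'z) smcat_scheme \<Rightarrow> ('o, 'm) mon \<Rightarrow> ('o, 'm) alg \<Rightarrow> ('o, 'm) alg \<Rightarrow> 'm" where
  "rtens_proj M R A B = (SOME p. coequalizer M
     (ract M A \<odot>\<^bsub>M\<^esub> Id M (Car B))
     ((Id M (Car A) \<odot>\<^bsub>M\<^esub> lact M B) \<cdot>\<^bsub>M\<^esub> assoc M (Car A) (Car R) (Car B)) p)"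

definition middle_swap ::
  "('o, 'm, 'z) smcat_scheme \<Rightarrow> 'o \<Rightarrow> 'o \<Rightarrow> 'o \<Rightarrow> 'o \<Rightarrow> 'm" where
  "middle_swap M A B D E =
     inv_arr M (assoc M A D (B \<otimes>\<^bsub>M\<^esub> E)) \<cdot>\<^bsub>M\<^esub>
     (Id M A \<odot>\<^bsub>M\<^esub> (assoc M D B E \<cdot>\<^bsub>M\<^esub> (braid M B D \<odot>\<^bsub>M\<^esub> Id M E) \<cdot>\<^bsub>M\<^esub> inv_arr M (assoc M B D E))) \<cdot>\<^bsub>M\<^esub>
     assoc M A B (D \<otimes>\<^bsub>M\<^esub> E)"

definition rtens ::
  "('o, 'm, 'z) smcat_scheme \<Rightarrow> ('o, 'm) mon \<Rightarrow> ('o, 'm) alg \<Rightarrow> ('o, 'm) alg \<Rightarrow> ('o, 'm) mon" where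
  "rtens M R A B = (let p = rtens_proj M R A B; P = Cod M p in
     \<lparr>Car = P,
      mul = (THE m. m \<in> hom M (P \<otimes>\<^bsub>M\<^esub> P) P \<and>
        m \<cdot>\<^bsub>M\<^esub> (p \<odot>\<^bsub>M\<^esub> p) =
        p \<cdot>\<^bsub>M\<^esub> (mul A \<odot>\<^bsub>M\<^esub> mul B) \<cdot>\<^bsub>M\<^esub> middle_swap M (Car A) (Car B) (Car A) (Car B)),
      one = p \<cdot>\<^bsub>M\<^esub> (one A \<odot>\<^bsub>M\<^esub> one B) \<cdot>\<^bsub>M\<^esub> inv_arr M (lunit M (unit M))\<rparr>)"

definition rtens_inl ::
  "('o, 'm, 'z) smcat_scheme \<Rightarrow> ('o, 'm) mon \<Rightarrow> ('o, 'm) alg \<Rightarrow> ('o, 'm) alg \<Rightarrow> 'm" where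
  "rtens_inl M R A B =
     rtens_proj M R A B \<cdot>\<^bsub>M\<^esub> (Id M (Car A) \<odot>\<^bsub>M\<^esub> one B) \<cdot>\<^bsub>M\<^esub> inv_arr M (runit M (Car A))"

definition rtens_inr ::
  "('o, 'm, 'z) smcat_scheme \<Rightarrow> ('o, 'm) mon \<Rightarrow> ('o, 'm) alg \<Rightarrow> ('o, 'm) alg \<Rightarrow> 'm" where
  "rtens_inr M R A B =
     rtens_proj M R A B \<cdot>\<^bsub>M\<^esub> (one A \<odot>\<^bsub>M\<^esub> Id M (Car B)) \<cdot>\<^bsub>M\<^esub> inv_arr M (lunit M (Car B))"

text \<open>\<open>A \<otimes>\<^sub>R g\<close> for a map \<open>g : B \<rightarrow> B'\<close> of \<open>R\<close>-algebras.\<close>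

definition rtens_arr ::
  "('o, 'm, 'z) smcat_scheme \<Rightarrow> ('o, 'm) mon \<Rightarrow> ('o, 'm) alg \<Rightarrow> ('o, 'm) alg_arr \<Rightarrow> 'm" where
  "rtens_arr M R A = (\<lambda>(B, g, B'). THE k.
     k \<in> hom M (Cod M (rtens_proj M R A B)) (Cod M (rtens_proj M R A B')) \<and>
     k \<cdot>\<^bsub>M\<^esub> rtens_proj M R A B = rtens_proj M R A B' \<cdot>\<^bsub>M\<^esub> (Id M (Car A) \<odot>\<^bsub>M\<^esub> g))"

text \<open>The endofunctor \<open>N \<otimes>\<^sub>R -\<close> of commutative \<open>R\<close>-algebras.\<close>

definition calg_tensor ::
  "('o, 'm, 'z) smcat_scheme \<Rightarrow> ('o, 'm) mon \<Rightarrow> ('o, 'm) alg \<Rightarrow>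
    (('o, 'm) alg, ('o, 'm) alg_arr, ('o, 'm) alg, ('o, 'm) alg_arr) ftor" where
  "calg_tensor M R N = (let F = (\<lambda>B. with_smap (rtens M R N B) (rtens_inl M R N B \<cdot>\<^bsub>M\<^esub> smap N)) in
     \<lparr>fobj = F, farr = (\<lambda>(B, g, B'). (F B, rtens_arr M R N (B, g, B'), F B'))\<rparr>)"

definition cofibrant_calgs_flat ::
  "('o, 'm, 'z) smcat_scheme \<Rightarrow> 'm model_structure \<Rightarrow> ('o, 'm) mon \<Rightarrow> bool" where
  "cofibrant_calgs_flat M W R \<longleftrightarrow>
     (\<forall>N\<in>Obj (CAlg M R). cofibrant (CAlg M R) (calg_model M W R) N \<longrightarrow>
        farr (calg_tensor M R N) ` weq (calg_model M W R) \<subseteq> weq (calg_model M W R))"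

definition restriction ::
  "('o, 'm, 'z) smcat_scheme \<Rightarrow> 'm \<Rightarrow>
    (('o, 'm) alg, ('o, 'm) alg_arr, ('o, 'm) alg, ('o, 'm) alg_arr) ftor" where
  "restriction M f = (let G = (\<lambda>B. with_smap B (smap B \<cdot>\<^bsub>M\<^esub> f)) in
     \<lparr>fobj = G, farr = (\<lambda>(B, g, B'). (G B, g, G B'))\<rparr>)"

text \<open>\<open>extension M R T f\<close> is \<open>N \<mapsto> T \<otimes>\<^sub>R N\<close>, where \<open>T\<close> is an \<open>R\<close>-algebra through \<open>f : R \<rightarrow> T\<close>.\<close>

definition extension ::
  "('o, 'm, 'z) smcat_scheme \<Rightarrow> ('o, 'm) mon \<Rightarrow> ('o, 'm) mon \<Rightarrow> 'm \<Rightarrow>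
    (('o, 'm) alg, ('o, 'm) alg_arr, ('o, 'm) alg, ('o, 'm) alg_arr) ftor" where
  "extension M R T f = (let T' = with_smap T f; F = (\<lambda>N. with_smap (rtens M R T' N) (rtens_inl M R T' N)) in
     \<lparr>fobj = F, farr = (\<lambda>(N, g, N'). (F N, rtens_arr M R T' (N, g, N'), F N'))\<rparr>)"

text \<open>The adjoint of \<open>g : T \<otimes>\<^sub>R N \<rightarrow> B\<close> is its composite with \<open>N \<rightarrow> T \<otimes>\<^sub>R N\<close>.\<close>

definition scalars_adjunct ::
  "('o, 'm, 'z) smcat_scheme \<Rightarrow> ('o, 'm) mon \<Rightarrow> ('o, 'm) mon \<Rightarrow> 'm \<Rightarrow>
    ('o, 'm) alg \<Rightarrow> ('o, 'm) alg \<Rightarrow> ('o, 'm) alg_arr \<Rightarrow> ('o, 'm) alg_arr" where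
  "scalars_adjunct M R T f N B = (\<lambda>(_, g, _).
     (N, g \<cdot>\<^bsub>M\<^esub> rtens_inr M R (with_smap T f) N, fobj (restriction M f) B))"

end

theory Submission
  imports Defs
begin

text \<open>The heart of the matter is that \<open>P = A \<otimes>\<^sub>R B\<close> is the pushout of commutative monoids. It carries
  commuting actions \<open>\<lambda>\<close> of \<open>A\<close> and \<open>\<rho>\<close> of \<open>B\<close> that agree on \<open>R\<close>, and for every \<open>Z\<close> the maps \<open>P \<otimes> Z \<rightarrow> N\<close>
  compatible with the two actions are determined by their restriction to \<open>Z\<close> along the unit of \<open>P\<close>.
  The multiplication of \<open>P\<close> is the compatible extension of the identity of \<open>P\<close>; the monoid laws and the
  universal property then follow by comparing compatible maps on the unit, so that no large
  coherence diagram has to be checked.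

  Extension of scalars is therefore left adjoint to restriction. Restriction preserves
  fibrations and weak equivalences, so the adjunction is a Quillen adjunction, and functoriality of
  extension follows from uniqueness of left adjoints. If \<open>N\<close> is cofibrant, flatness applied to
  \<open>f : R \<rightarrow> T\<close> makes \<open>N \<cong> N \<otimes>\<^sub>R R \<rightarrow> N \<otimes>\<^sub>R T\<close> a weak equivalence, and the Quillen equivalence is two out of
  three.\<close>

section \<open>Categories and adjunctions\<close>

text \<open>The obstacle is that associators, unitors and symmetries are explicit arrows, while the
  product on a relative tensor product is specified through \<open>middle_swap\<close>: a direct
  proof of associativity would compare two maps out of six tensor factors. Splitting the product
  into two one-sided actions replaces this by steps that move a single factor, each governed by a
  coherence identity in at most four objects. Closedness makes the descent possible: tensoring is a
  left adjoint, so \<open>p\<close> tensored with any object is again a coequalizer, and maps out of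
  \<open>P \<otimes> Z\<close> can be both defined and compared through \<open>p\<close>.

  Since \<open>rtens_proj\<close> is an arbitrary choice of coequalizer, extension of scalars
  respects composition only up to natural isomorphism, while restriction does so strictly. One
  mismatch has to be repaired on the way: extension places T in the left factor, whereas flatness of
  N concerns the functor with N in the left factor, hence the symmetry of the relative tensor
  product.\<close>

lemma in_hom_iff: "f \<in> hom C A B \<longleftrightarrow> f \<in> Arr C \<and> Dom C f = A \<and> Cod C f = B"
  by (auto simp: hom_def)

context category
begin

declare dom_obj [simp] cod_obj [simp]

lemma id_arr [simp]: "A \<in> Obj C \<Longrightarrow> Id C A \<in> Arr C"
  and dom_id [simp]: "A \<in> Obj C \<Longrightarrow> Dom C (Id C A) = A"
  and cod_id [simp]: "A \<in> Obj C \<Longrightarrow> Cod C (Id C A) = A"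
  using id_hom by (auto simp: in_hom_iff)

lemma comp_arr [simp]: "f \<in> Arr C \<Longrightarrow> g \<in> Arr C \<Longrightarrow> Dom C g = Cod C f \<Longrightarrow> g \<cdot> f \<in> Arr C"
  and dom_comp [simp]: "f \<in> Arr C \<Longrightarrow> g \<in> Arr C \<Longrightarrow> Dom C g = Cod C f \<Longrightarrow> Dom C (g \<cdot> f) = Dom C f"
  and cod_comp [simp]: "f \<in> Arr C \<Longrightarrow> g \<in> Arr C \<Longrightarrow> Dom C g = Cod C f \<Longrightarrow> Cod C (g \<cdot> f) = Cod C g"
  using comp_hom[of f "Dom C f" "Cod C f" g "Cod C g"] by (auto simp: in_hom_iff)

lemma comp_id_r [simp]: "f \<in> Arr C \<Longrightarrow> A = Dom C f \<Longrightarrow> f \<cdot> Id C A = f"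
  and comp_id_l [simp]: "f \<in> Arr C \<Longrightarrow> A = Cod C f \<Longrightarrow> Id C A \<cdot> f = f"
  using comp_id_right[of f A "Cod C f"] comp_id_left[of f "Dom C f" A] by (auto simp: in_hom_iff)

lemma comp_reassoc [simp]:
  "f \<in> Arr C \<Longrightarrow> g \<in> Arr C \<Longrightarrow> h \<in> Arr C \<Longrightarrow> Dom C g = Cod C f \<Longrightarrow> Dom C h = Cod C g
    \<Longrightarrow> h \<cdot> g \<cdot> f = h \<cdot> (g \<cdot> f)"
  using comp_assoc[of f "Dom C f" "Cod C f" g "Cod C g" h "Cod C h"] by (auto simp: in_hom_iff)

text \<open>The simplifier brackets composites to the right, so inside a longer composite an equation
  \<open>g \<cdot> f = k\<close> has to be applied together with a tail.\<close>

lemma comp_tail: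
  "g \<cdot> f = k \<Longrightarrow> f \<in> Arr C \<Longrightarrow> g \<in> Arr C \<Longrightarrow> Dom C g = Cod C f \<Longrightarrow> x \<in> Arr C \<Longrightarrow> Cod C x = Dom C f
    \<Longrightarrow> g \<cdot> (f \<cdot> x) = k \<cdot> x"
  by (metis comp_reassoc)

lemma inverse_in_unique:
  assumes "inverse_in C f g" "inverse_in C f g'"
  shows "g = g'"
proof -
  have g: "g \<in> Arr C" "g' \<in> Arr C" "f \<in> Arr C" "Dom C g = Cod C f" "Cod C g = Dom C f"
      "Dom C g' = Cod C f" "Cod C g' = Dom C f" "g \<cdot> f = Id C (Dom C f)" "f \<cdot> g' = Id C (Cod C f)"
    using assms by (auto simp: inverse_in_def in_hom_iff)
  then show ?thesis by (metis comp_reassoc comp_id_l comp_id_r)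
qed

lemma inv_arr_inverse: "is_iso C f \<Longrightarrow> inverse_in C f (inv_arr C f)"
  unfolding is_iso_def inv_arr_def using inverse_in_unique by (metis theI)

lemma is_isoI:
  "f \<in> Arr C \<Longrightarrow> g \<in> Arr C \<Longrightarrow> Dom C g = Cod C f \<Longrightarrow> Cod C g = Dom C f
    \<Longrightarrow> g \<cdot> f = Id C (Dom C f) \<Longrightarrow> f \<cdot> g = Id C (Cod C f) \<Longrightarrow> is_iso C f"
  unfolding is_iso_def inverse_in_def by (auto simp: in_hom_iff)

lemma
  assumes "is_iso C f"
  shows iso_arr: "f \<in> Arr C"
    and inv_arr_arr: "inv_arr C f \<in> Arr C"
    and dom_inv_arr: "Dom C (inv_arr C f) = Cod C f"
    and cod_inv_arr: "Cod C (inv_arr C f) = Dom C f"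
    and inv_arr_left: "inv_arr C f \<cdot> f = Id C (Dom C f)"
    and inv_arr_right: "f \<cdot> inv_arr C f = Id C (Cod C f)"
  using inv_arr_inverse[OF assms] by (auto simp: inverse_in_def in_hom_iff)

lemma is_iso_id: "A \<in> Obj C \<Longrightarrow> is_iso C (Id C A)"
  by (rule is_isoI[of _ "Id C A"]) auto

lemma is_iso_comp:
  assumes "is_iso C f" "is_iso C g" "Dom C g = Cod C f"
  shows "is_iso C (g \<cdot> f)"
proof (rule is_isoI[of _ "inv_arr C f \<cdot> inv_arr C g"])
  note * = assms iso_arr[OF assms(1)] iso_arr[OF assms(2)] inv_arr_arr[OF assms(1)] inv_arr_arr[OF assms(2)]
    dom_inv_arr[OF assms(1)] dom_inv_arr[OF assms(2)] cod_inv_arr[OF assms(1)] cod_inv_arr[OF assms(2)]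
  show "inv_arr C f \<cdot> inv_arr C g \<cdot> (g \<cdot> f) = Id C (Dom C (g \<cdot> f))"
    using * by (simp add: comp_tail[OF inv_arr_left[OF assms(2)]] inv_arr_left[OF assms(1)])
  show "g \<cdot> f \<cdot> (inv_arr C f \<cdot> inv_arr C g) = Id C (Cod C (g \<cdot> f))"
    using * by (simp add: comp_tail[OF inv_arr_right[OF assms(1)]] inv_arr_right[OF assms(2)])
qed (use assms in \<open>auto simp: iso_arr inv_arr_arr dom_inv_arr cod_inv_arr\<close>)

lemma iso_cancel_right:
  assumes "g \<cdot> f = h \<cdot> f" "is_iso C f" "g \<in> Arr C" "h \<in> Arr C" "Dom C g = Cod C f" "Dom C h = Cod C f"
  shows "g = h"
proof -
  have "g \<cdot> f \<cdot> inv_arr C f = h \<cdot> f \<cdot> inv_arr C f" using assms(1) by simp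
  with assms(2-) show ?thesis
    by (simp add: inv_arr_arr dom_inv_arr cod_inv_arr inv_arr_right iso_arr)
qed

lemma iso_cancel_left:
  assumes "f \<cdot> g = f \<cdot> h" "is_iso C f" "g \<in> Arr C" "h \<in> Arr C" "Cod C g = Dom C f" "Cod C h = Dom C f"
  shows "g = h"
proof -
  have "inv_arr C f \<cdot> (f \<cdot> g) = inv_arr C f \<cdot> (f \<cdot> h)" using assms(1) by simp
  with assms(2-) show ?thesis
    by (simp add: comp_tail[OF inv_arr_left] iso_arr inv_arr_arr dom_inv_arr)
qed

end


text \<open>The uniqueness half of the universal property in the form of a cancellation rule.
  Identities between maps out of a relative tensor product are tested through it.\<close>

lemma coequalizer_epi:
  assumes "coequalizer C u v p" "category C"
    and "k \<cdot>\<^bsub>C\<^esub> p = k' \<cdot>\<^bsub>C\<^esub> p" "k \<in> Arr C" "k' \<in> Arr C" "Dom C k = Cod C p" "Dom C k' = Cod C p"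
  shows "k = k'"
proof -
  interpret category C by fact
  have p: "u \<in> Arr C" "v \<in> Arr C" "Dom C v = Dom C u" "Cod C v = Cod C u" "p \<in> Arr C" "Dom C p = Cod C u"
    "p \<cdot>\<^bsub>C\<^esub> u = p \<cdot>\<^bsub>C\<^esub> v"
    and ex: "\<And>q. q\<in>Arr C \<Longrightarrow> Dom C q = Cod C u \<Longrightarrow> q \<cdot>\<^bsub>C\<^esub> u = q \<cdot>\<^bsub>C\<^esub> v \<Longrightarrow>
        (\<exists>!k. k \<in> hom C (Cod C p) (Cod C q) \<and> k \<cdot>\<^bsub>C\<^esub> p = q)"
    using assms(1) by (auto simp: coequalizer_def in_hom_iff)
  have "\<exists>!l. l \<in> hom C (Cod C p) (Cod C (k \<cdot>\<^bsub>C\<^esub> p)) \<and> l \<cdot>\<^bsub>C\<^esub> p = k \<cdot>\<^bsub>C\<^esub> p"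
    by (rule ex) (use p assms in auto)
  moreover have "k \<in> hom C (Cod C p) (Cod C (k \<cdot>\<^bsub>C\<^esub> p))" "k' \<in> hom C (Cod C p) (Cod C (k \<cdot>\<^bsub>C\<^esub> p))"
    using p assms cod_comp[of p k] cod_comp[of p k'] by (auto simp: in_hom_iff)
  ultimately show ?thesis using assms(3) by metis
qed

lemma coequalizer_factor:
  assumes "coequalizer C u v p" "q \<in> Arr C" "Dom C q = Cod C u" "q \<cdot>\<^bsub>C\<^esub> u = q \<cdot>\<^bsub>C\<^esub> v"
  obtains k where "k \<in> Arr C" "Dom C k = Cod C p" "Cod C k = Cod C q" "k \<cdot>\<^bsub>C\<^esub> p = q"
  using assms unfolding coequalizer_def in_hom_iff by metis

lemma is_functor_facts:
  assumes "is_functor C D F"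
  shows "category C" "category D"
    and "f \<in> Arr C \<Longrightarrow> farr F f \<in> Arr D" "f \<in> Arr C \<Longrightarrow> Dom D (farr F f) = fobj F (Dom C f)"
    and "f \<in> Arr C \<Longrightarrow> Cod D (farr F f) = fobj F (Cod C f)" "A \<in> Obj C \<Longrightarrow> fobj F A \<in> Obj D"
    and "f \<in> Arr C \<Longrightarrow> g \<in> Arr C \<Longrightarrow> Dom C g = Cod C f \<Longrightarrow> farr F (g \<cdot>\<^bsub>C\<^esub> f) = farr F g \<cdot>\<^bsub>D\<^esub> farr F f"
    and "A \<in> Obj C \<Longrightarrow> farr F (Id C A) = Id D (fobj F A)"
  using assms unfolding is_functor_def in_hom_iff by auto

section \<open>Adjunctions given by a natural hom bijection\<close>

locale adjoint_functors =
  fixes C :: "('o1, 'm1, 'y) cat_scheme" and D :: "('o2, 'm2, 'z) cat_scheme" and F G \<phi>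
  assumes adj: "adjunction C D F G \<phi>"
begin

lemma func: "is_functor C D F" "is_functor D C G"
  using adj unfolding adjunction_def by auto

sublocale C: category C
  using func is_functor_facts by blast

sublocale D: category D
  using func is_functor_facts by blast

lemmas F [simp] = is_functor_facts(3-6,8)[OF func(1)] and F_comp = is_functor_facts(7)[OF func(1)]
  and G [simp] = is_functor_facts(3-6,8)[OF func(2)]

lemma bij: "A \<in> Obj C \<Longrightarrow> B \<in> Obj D \<Longrightarrow> bij_betw (\<phi> A B) (hom D (fobj F A) B) (hom C A (fobj G B))"
  using adj unfolding adjunction_def by auto

lemma adjunct [simp]:
  assumes "A \<in> Obj C" "g \<in> Arr D" "Dom D g = fobj F A" "B = Cod D g"
  shows "\<phi> A B g \<in> Arr C" "Dom C (\<phi> A B g) = A" "Cod C (\<phi> A B g) = fobj G B"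
proof -
  have "g \<in> hom D (fobj F A) B" "B \<in> Obj D" using assms by (auto simp: in_hom_iff)
  then have "\<phi> A B g \<in> hom C A (fobj G B)"
    using bij[of A B] assms(1) by (auto dest: bij_betwE)
  then show "\<phi> A B g \<in> Arr C" "Dom C (\<phi> A B g) = A" "Cod C (\<phi> A B g) = fobj G B"
    by (auto simp: in_hom_iff)
qed

lemma adjunct_inj:
  assumes "\<phi> A B g = \<phi> A B g'" "A \<in> Obj C" "B \<in> Obj D" "g \<in> hom D (fobj F A) B" "g' \<in> hom D (fobj F A) B"
  shows "g = g'"
  using bij[OF assms(2,3)] assms(1,4,5) by (auto simp: bij_betw_def inj_on_def)

lemma adjunct_surj:
  assumes "A \<in> Obj C" "B \<in> Obj D" "h \<in> hom C A (fobj G B)"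
  obtains g where "g \<in> hom D (fobj F A) B" "\<phi> A B g = h"
  using bij[OF assms(1,2)] assms(3) by (metis bij_betw_imp_surj_on imageE)

lemma adjunct_nat:
  assumes "a \<in> Arr C" "b \<in> Arr D" "g \<in> hom D (fobj F (Cod C a)) (Dom D b)"
  shows "\<phi> (Dom C a) (Cod D b) (b \<cdot>\<^bsub>D\<^esub> g \<cdot>\<^bsub>D\<^esub> farr F a) =
    farr G b \<cdot>\<^bsub>C\<^esub> \<phi> (Cod C a) (Dom D b) g \<cdot>\<^bsub>C\<^esub> a"
  using adj assms unfolding adjunction_def by auto

text \<open>Naturality is given in both variables at once; taking \<open>b\<close> to be an identity
  leaves the half in the first variable, and \<open>adjunct_nat_right\<close> is the other
  half.\<close>

lemma adjunct_nat_left: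
  assumes "a \<in> Arr C" "g \<in> Arr D" "Dom D g = fobj F (Cod C a)" "A = Dom C a" "B = Cod D g"
  shows "\<phi> A B (g \<cdot>\<^bsub>D\<^esub> farr F a) = \<phi> (Cod C a) B g \<cdot>\<^bsub>C\<^esub> a"
  using adjunct_nat[of a "Id D B" g] assms by (auto simp: in_hom_iff)

lemma adjunct_nat_right:
  assumes "A \<in> Obj C" "b \<in> Arr D" "g \<in> Arr D" "Dom D g = fobj F A" "Cod D g = Dom D b" "B = Cod D b"
  shows "\<phi> A B (b \<cdot>\<^bsub>D\<^esub> g) = farr G b \<cdot>\<^bsub>C\<^esub> \<phi> A (Dom D b) g"
  using adjunct_nat[of "Id C A" b g] assms by (auto simp: in_hom_iff)

text \<open>By naturality in the first variable, a map out of \<open>fobj F (Cod C u)\<close>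
  equalises the images of \<open>u\<close> and \<open>v\<close> exactly when its adjunct equalises
  \<open>u\<close> and \<open>v\<close>. Factorisations through \<open>farr F p\<close> are
  therefore the adjuncts of factorisations through \<open>p\<close>.\<close>

lemma left_adjoint_preserves_coequalizer:
  assumes coeq: "coequalizer C u v p"
  shows "coequalizer D (farr F u) (farr F v) (farr F p)"
proof -
  have p: "u \<in> Arr C" "v \<in> Arr C" "Dom C v = Dom C u" "Cod C v = Cod C u" "p \<in> Arr C" "Dom C p = Cod C u"
    "p \<cdot>\<^bsub>C\<^esub> u = p \<cdot>\<^bsub>C\<^esub> v"
    using coeq by (auto simp: coequalizer_def in_hom_iff)
  have "\<exists>!k. k \<in> hom D (Cod D (farr F p)) (Cod D q) \<and> k \<cdot>\<^bsub>D\<^esub> farr F p = q"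
    if q: "q \<in> Arr D" "Dom D q = Cod D (farr F u)" "q \<cdot>\<^bsub>D\<^esub> farr F u = q \<cdot>\<^bsub>D\<^esub> farr F v" for q
  proof -
    let ?Y = "Cod D q"
    have "\<phi> (Cod C u) ?Y q \<cdot>\<^bsub>C\<^esub> u = \<phi> (Cod C u) ?Y q \<cdot>\<^bsub>C\<^esub> v"
      using q p adjunct_nat_left[of u q] adjunct_nat_left[of v q] by auto
    with coeq q p obtain l where l: "l \<in> Arr C" "Dom C l = Cod C p" "Cod C l = fobj G ?Y"
      "l \<cdot>\<^bsub>C\<^esub> p = \<phi> (Cod C u) ?Y q"
      using coequalizer_factor[OF coeq, of "\<phi> (Cod C u) ?Y q"] by auto
    obtain k where k: "k \<in> hom D (fobj F (Cod C p)) ?Y" "\<phi> (Cod C p) ?Y k = l"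
      using l p q by (auto simp: in_hom_iff intro: adjunct_surj[of "Cod C p" "?Y" l])
    have kp: "k \<cdot>\<^bsub>D\<^esub> farr F p = q"
      by (rule adjunct_inj[of "Cod C u" ?Y])
        (use adjunct_nat_left[of p k] k l q p in \<open>auto simp: in_hom_iff\<close>)
    show ?thesis
    proof (rule ex1I[of _ k])
      fix k' assume "k' \<in> hom D (Cod D (farr F p)) (Cod D q) \<and> k' \<cdot>\<^bsub>D\<^esub> farr F p = q"
      then have k': "k' \<in> hom D (fobj F (Cod C p)) ?Y" and k'p: "k' \<cdot>\<^bsub>D\<^esub> farr F p = q"
        using p by auto
      have "\<phi> (Cod C p) ?Y k' \<cdot>\<^bsub>C\<^esub> p = \<phi> (Cod C p) ?Y k \<cdot>\<^bsub>C\<^esub> p"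
        using adjunct_nat_left[of p k'] adjunct_nat_left[of p k] k(1) k' k'p kp p(5) q(1) by (simp add: in_hom_iff)
      then have "\<phi> (Cod C p) ?Y k' = \<phi> (Cod C p) ?Y k"
        by (rule coequalizer_epi[OF coeq C.category_axioms]) (use k(1) k' p(5) q(1) in \<open>auto simp: in_hom_iff\<close>)
      then show "k' = k" by (rule adjunct_inj) (use k(1) k' p(5) q(1) in \<open>auto simp: in_hom_iff\<close>)
    qed (use k kp p in \<open>auto simp: in_hom_iff\<close>)
  qed
  then show ?thesis
    unfolding coequalizer_def
    using p F_comp[of u p] F_comp[of v p] by (auto simp: in_hom_iff)
qed

end

text \<open>Together with \<open>adjunction_comp\<close> this supplies the left adjoints with which
  extension along an identity or a composite is compared.\<close>

lemma adjunction_id: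
  assumes "category C"
  shows "adjunction C C id_ftor id_ftor (\<lambda>A B g. g)"
proof -
  interpret category C by fact
  have "is_functor C C id_ftor"
    using assms by (auto simp: is_functor_def id_ftor_def in_hom_iff)
  then show ?thesis
    unfolding adjunction_def by (auto simp: id_ftor_def bij_betw_def)
qed

lemma is_functor_comp:
  assumes "is_functor C D F" "is_functor D E G"
  shows "is_functor C E (comp_ftor G F)"
proof -
  interpret C: category C using assms is_functor_facts by blast
  interpret D: category D using assms is_functor_facts by blast
  show ?thesis
    using is_functor_facts[OF assms(1)] is_functor_facts[OF assms(2)]
    by (auto simp: is_functor_def[of C E] comp_ftor_def in_hom_iff)
qed

lemma adjunction_comp:
  assumes "adjunction C D F G \<phi>" "adjunction D E F' G' \<psi>"
  shows "adjunction C E (comp_ftor F' F) (comp_ftor G G') (\<lambda>A B g. \<phi> A (fobj G' B) (\<psi> (fobj F A) B g))"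
proof -
  interpret P: adjoint_functors C D F G \<phi> by unfold_locales fact
  interpret Q: adjoint_functors D E F' G' \<psi> by unfold_locales fact
  have bij: "bij_betw (\<lambda>g. \<phi> A (fobj G' B) (\<psi> (fobj F A) B g))
      (hom E (fobj F' (fobj F A)) B) (hom C A (fobj G (fobj G' B)))" if "A \<in> Obj C" "B \<in> Obj E" for A B
    using bij_betw_trans[OF Q.bij[of "fobj F A" B] P.bij[of A "fobj G' B"]] that
    by (simp add: comp_def)
  have nat: "\<phi> (Dom C a) (fobj G' (Cod E b)) (\<psi> (fobj F (Dom C a)) (Cod E b) (b \<cdot>\<^bsub>E\<^esub> g \<cdot>\<^bsub>E\<^esub> farr F' (farr F a))) =
        farr G (farr G' b) \<cdot>\<^bsub>C\<^esub> \<phi> (Cod C a) (fobj G' (Dom E b)) (\<psi> (fobj F (Cod C a)) (Dom E b) g) \<cdot>\<^bsub>C\<^esub> a"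
    if "a \<in> Arr C" "b \<in> Arr E" "g \<in> hom E (fobj F' (fobj F (Cod C a))) (Dom E b)" for a b g
    using Q.adjunct_nat[of "farr F a" b g] P.adjunct_nat[of a "farr G' b" "\<psi> (fobj F (Cod C a)) (Dom E b) g"] that
    by (simp add: in_hom_iff)
  show ?thesis
    unfolding adjunction_def
    using is_functor_comp[OF P.func(1) Q.func(1)] is_functor_comp[OF Q.func(2) P.func(2)] bij nat
    by (auto simp: comp_ftor_def)
qed

text \<open>The comparison maps \<open>F A \<rightarrow> F' A\<close> are the arrows adjunct to the units \<open>A \<rightarrow> G F' A\<close>.\<close>

lemma left_adjoint_unique:
  assumes "adjunction C D F G \<phi>" "adjunction C D F' G' \<phi>'" and eq: "ftor_eq_on D G G'"
  shows "naturally_isomorphic C D F F'"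
proof -
  interpret P: adjoint_functors C D F G \<phi> by unfold_locales fact
  interpret Q: adjoint_functors C D F' G' \<phi>' by unfold_locales fact
  have G: "\<And>B. B \<in> Obj D \<Longrightarrow> fobj G' B = fobj G B" "\<And>b. b \<in> Arr D \<Longrightarrow> farr G' b = farr G b"
    using eq unfolding ftor_eq_on_def by auto
  define \<eta> where "\<eta> A = (SOME h. h \<in> hom D (fobj F A) (fobj F' A) \<and>
      \<phi> A (fobj F' A) h = \<phi>' A (fobj F' A) (Id D (fobj F' A)))" for A
  define \<theta> where "\<theta> A = (SOME h. h \<in> hom D (fobj F' A) (fobj F A) \<and>
      \<phi>' A (fobj F A) h = \<phi> A (fobj F A) (Id D (fobj F A)))" for A
  have \<eta>: "\<eta> A \<in> hom D (fobj F A) (fobj F' A) \<and>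
      \<phi> A (fobj F' A) (\<eta> A) = \<phi>' A (fobj F' A) (Id D (fobj F' A))" if "A \<in> Obj C" for A
    unfolding \<eta>_def
    by (rule someI_ex) (rule P.adjunct_surj[of A "fobj F' A" "\<phi>' A (fobj F' A) (Id D (fobj F' A))"],
      use that in \<open>auto simp: in_hom_iff G\<close>)
  have \<theta>: "\<theta> A \<in> hom D (fobj F' A) (fobj F A) \<and>
      \<phi>' A (fobj F A) (\<theta> A) = \<phi> A (fobj F A) (Id D (fobj F A))" if "A \<in> Obj C" for A
    unfolding \<theta>_def
    by (rule someI_ex) (rule Q.adjunct_surj[of A "fobj F A" "\<phi> A (fobj F A) (Id D (fobj F A))"],
      use that in \<open>auto simp: in_hom_iff G\<close>)
  \<comment> \<open>The Yoneda description of the comparison map: the adjunct of \<open>g\<close>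
    under \<open>\<phi>'\<close> is the adjunct of \<open>g\<close> after \<open>\<eta> A\<close>
    under \<open>\<phi>\<close>. With its mirror image for \<open>\<theta>\<close>, the inverse laws
    and naturality follow by injectivity of the bijections.\<close>
  have \<phi>\<eta>: "\<phi> A (Cod D g) (g \<cdot>\<^bsub>D\<^esub> \<eta> A) = \<phi>' A (Cod D g) g"
    if "A \<in> Obj C" "g \<in> Arr D" "Dom D g = fobj F' A" for A g
    using P.adjunct_nat_right[of A g "\<eta> A"] Q.adjunct_nat_right[of A g "Id D (fobj F' A)"] \<eta>[of A] that
    by (auto simp: in_hom_iff G)
  have \<phi>\<theta>: "\<phi>' A (Cod D g) (g \<cdot>\<^bsub>D\<^esub> \<theta> A) = \<phi> A (Cod D g) g"
    if "A \<in> Obj C" "g \<in> Arr D" "Dom D g = fobj F A" for A g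
    using Q.adjunct_nat_right[of A g "\<theta> A"] P.adjunct_nat_right[of A g "Id D (fobj F A)"] \<theta>[of A] that
    by (auto simp: in_hom_iff G)
  have "is_iso D (\<eta> A)" if A: "A \<in> Obj C" for A
  proof (rule P.D.is_isoI[of _ "\<theta> A"])
    show "\<theta> A \<cdot>\<^bsub>D\<^esub> \<eta> A = Id D (Dom D (\<eta> A))"
      by (rule P.adjunct_inj[of A "fobj F A"])
        (use \<phi>\<eta>[of A "\<theta> A"] \<phi>\<theta>[of A "Id D (fobj F A)"] \<eta>[OF A] \<theta>[OF A] A in \<open>auto simp: in_hom_iff\<close>)
    show "\<eta> A \<cdot>\<^bsub>D\<^esub> \<theta> A = Id D (Cod D (\<eta> A))"
      by (rule Q.adjunct_inj[of A "fobj F' A"])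
        (use \<phi>\<theta>[of A "\<eta> A"] \<phi>\<eta>[of A "Id D (fobj F' A)"] \<eta>[OF A] \<theta>[OF A] A in \<open>auto simp: in_hom_iff\<close>)
  qed (use \<eta>[OF A] \<theta>[OF A] in \<open>auto simp: in_hom_iff\<close>)
  moreover have "\<eta> (Cod C f) \<cdot>\<^bsub>D\<^esub> farr F f = farr F' f \<cdot>\<^bsub>D\<^esub> \<eta> (Dom C f)" if f: "f \<in> Arr C" for f
  proof (rule P.adjunct_inj[of "Dom C f" "fobj F' (Cod C f)"])
    have "\<phi> (Dom C f) (fobj F' (Cod C f)) (\<eta> (Cod C f) \<cdot>\<^bsub>D\<^esub> farr F f)
        = \<phi>' (Cod C f) (fobj F' (Cod C f)) (Id D (fobj F' (Cod C f))) \<cdot>\<^bsub>C\<^esub> f"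
      using P.adjunct_nat_left[of f "\<eta> (Cod C f)"] \<eta>[of "Cod C f"] f by (auto simp: in_hom_iff)
    also have "\<dots> = \<phi>' (Dom C f) (fobj F' (Cod C f)) (farr F' f)"
      using Q.adjunct_nat_left[of f "Id D (fobj F' (Cod C f))"] f by auto
    also have "\<dots> = \<phi> (Dom C f) (fobj F' (Cod C f)) (farr F' f \<cdot>\<^bsub>D\<^esub> \<eta> (Dom C f))"
      using \<phi>\<eta>[of "Dom C f" "farr F' f"] f by auto
    finally show "\<phi> (Dom C f) (fobj F' (Cod C f)) (\<eta> (Cod C f) \<cdot>\<^bsub>D\<^esub> farr F f)
        = \<phi> (Dom C f) (fobj F' (Cod C f)) (farr F' f \<cdot>\<^bsub>D\<^esub> \<eta> (Dom C f))" .
  qed (use \<eta>[of "Cod C f"] \<eta>[of "Dom C f"] f in \<open>auto simp: in_hom_iff\<close>)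
  ultimately show ?thesis
    unfolding naturally_isomorphic_def using \<eta> by blast
qed


section \<open>Model categories\<close>

context model_category
begin

lemma weq_comp: "f \<in> weq W \<Longrightarrow> g \<in> weq W \<Longrightarrow> Dom C g = Cod C f \<Longrightarrow> g \<cdot> f \<in> weq W"
  using two_of_three[of f "Dom C f" "Cod C f" g "Cod C g"] weq_arr by (auto simp: in_hom_iff)

lemma weq_comp_right_iff:
  assumes "f \<in> weq W" "g \<in> Arr C" "Dom C g = Cod C f"
  shows "g \<cdot> f \<in> weq W \<longleftrightarrow> g \<in> weq W"
  using two_of_three[of f "Dom C f" "Cod C f" g "Cod C g"] assms weq_arr by (auto simp: in_hom_iff)

text \<open>Factor the identity as \<open>p \<cdot> i\<close> with \<open>i\<close> a weak
  equivalence; then two out of three cancels \<open>i\<close> from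
  \<open>i \<cdot> Id C A = i\<close>.\<close>

lemma id_weq:
  assumes "A \<in> Obj C"
  shows "Id C A \<in> weq W"
proof -
  obtain i p where i: "i \<in> weq W" "p \<in> fib W" "Cod C i = Dom C p" "Id C A = p \<cdot> i"
    using factor_triv_cof[of "Id C A"] assms by auto
  then have "Dom C i = A"
    using weq_arr fib_arr assms dom_comp[of i p] by (metis dom_id subsetD)
  with i(1) weq_arr assms have "i \<in> hom C A (Cod C i)" "i \<cdot> Id C A = i"
    by (auto simp: in_hom_iff)
  then show ?thesis
    using two_of_three[of "Id C A" A A i "Cod C i"] i(1) id_hom[OF assms] by auto
qed

text \<open>In the arrow category an isomorphism is a retract of the identity of its source.\<close>

lemma iso_weq:
  assumes "is_iso C f"
  shows "f \<in> weq W"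
proof (rule retract_weq)
  note * = iso_arr[OF assms] inv_arr_arr[OF assms] dom_inv_arr[OF assms] cod_inv_arr[OF assms]
    inv_arr_left[OF assms] inv_arr_right[OF assms]
  show "retract_of C f (Id C (Dom C f))"
    unfolding retract_of_def in_hom_iff
    using * by (intro conjI bexI[of _ "Id C (Dom C f)"] bexI[of _ "inv_arr C f"] bexI[of _ f])
      (auto simp: in_hom_iff)
  show "Id C (Dom C f) \<in> weq W" using * id_weq by simp
qed

text \<open>The retract argument: lift the square whose top side is \<open>i\<close> and whose
  bottom side is an identity; the diagonal is the section that exhibits the retract.\<close>

lemma retract_of_factor:
  assumes "i \<in> Arr C" "p \<in> Arr C" "Cod C i = Dom C p" and lift: "has_lift C (p \<cdot> i) p"
  shows "retract_of C (p \<cdot> i) i"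
proof -
  have "\<exists>d\<in>hom C (Cod C (p \<cdot> i)) (Dom C p). d \<cdot> (p \<cdot> i) = i \<and> p \<cdot> d = Id C (Cod C p)"
    using lift assms unfolding has_lift_def by (auto simp: in_hom_iff)
  then obtain d where "d \<in> Arr C" "Dom C d = Cod C p" "Cod C d = Dom C p" "d \<cdot> (p \<cdot> i) = i"
    "p \<cdot> d = Id C (Cod C p)"
    using assms by (auto simp: in_hom_iff)
  then show ?thesis
    unfolding retract_of_def using assms
    by (intro conjI bexI[of _ "Id C (Dom C i)"] bexI[of _ d] bexI[of _ p]) (auto simp: in_hom_iff)
qed

text \<open>A map with the lifting property, factored as a trivial fibration after a cofibration,
  lifts against the former and so is a retract of the latter. Cofibrations are thereby accessible
  through the right-hand classes alone.\<close>

lemma cof_eq_llp: "cof W = llp C (triv_fib W)"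
proof
  show "llp C (triv_fib W) \<subseteq> cof W"
  proof
    fix f assume f: "f \<in> llp C (triv_fib W)"
    then have "f \<in> Arr C" by (auto simp: llp_def)
    then obtain i p where "i \<in> cof W" "p \<in> triv_fib W" "Cod C i = Dom C p" "f = p \<cdot> i"
      using factor_triv_fib by blast
    then show "f \<in> cof W"
      using retract_of_factor[of i p] retract_cof f cof_arr fib_arr by (auto simp: llp_def)
  qed
qed (use cof_arr lift_triv_fib in \<open>auto simp: llp_def\<close>)

lemma triv_cof_eq_llp: "triv_cof W = llp C (fib W)"
proof
  show "llp C (fib W) \<subseteq> triv_cof W"
  proof
    fix f assume f: "f \<in> llp C (fib W)"
    then have "f \<in> Arr C" by (auto simp: llp_def)
    then obtain i p where "i \<in> triv_cof W" "p \<in> fib W" "Cod C i = Dom C p" "f = p \<cdot> i"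
      using factor_triv_cof by blast
    then show "f \<in> triv_cof W"
      using retract_of_factor[of i p] retract_cof retract_weq f subsetD[OF cof_arr] subsetD[OF fib_arr]
      by (auto simp: llp_def)
  qed
qed (use cof_arr lift_triv_cof in \<open>auto simp: llp_def\<close>)

end

section \<open>Quillen adjunctions recognised on the right adjoint\<close>

context adjoint_functors
begin

text \<open>Transpose the square across the adjunction, lift there, and transpose the diagonal back;
  the two triangles follow by injectivity of the bijections.\<close>

lemma has_lift_adjunct:
  assumes i: "i \<in> Arr C" and p: "p \<in> Arr D" and lift: "has_lift C i (farr G p)"
  shows "has_lift D (farr F i) p"
  unfolding has_lift_def
proof (intro ballI impI)
  fix u v
  assume u: "u \<in> hom D (Dom D (farr F i)) (Dom D p)" and v: "v \<in> hom D (Cod D (farr F i)) (Cod D p)"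
    and eq: "p \<cdot>\<^bsub>D\<^esub> u = v \<cdot>\<^bsub>D\<^esub> farr F i"
  let ?A = "Dom C i" and ?B = "Cod C i" and ?X = "Dom D p" and ?Y = "Cod D p"
  have "farr G p \<cdot>\<^bsub>C\<^esub> \<phi> ?A ?X u = \<phi> ?B ?Y v \<cdot>\<^bsub>C\<^esub> i"
    using adjunct_nat_right[of ?A p u] adjunct_nat_left[of i v] eq u v i p by (auto simp: in_hom_iff)
  then obtain d where d: "d \<in> hom C ?B (fobj G ?X)" "d \<cdot>\<^bsub>C\<^esub> i = \<phi> ?A ?X u" "farr G p \<cdot>\<^bsub>C\<^esub> d = \<phi> ?B ?Y v"
    using lift[unfolded has_lift_def, rule_format, of "\<phi> ?A ?X u" "\<phi> ?B ?Y v"] u v i p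
    by (auto simp: in_hom_iff)
  obtain e where e: "e \<in> hom D (fobj F ?B) ?X" "\<phi> ?B ?X e = d"
    using adjunct_surj[OF _ _ d(1)] i p by auto
  have "e \<cdot>\<^bsub>D\<^esub> farr F i = u"
    by (rule adjunct_inj[of ?A ?X])
      (use adjunct_nat_left[of i e] d e i p u in \<open>auto simp: in_hom_iff\<close>)
  moreover have "p \<cdot>\<^bsub>D\<^esub> e = v"
    by (rule adjunct_inj[of ?B ?Y])
      (use adjunct_nat_right[of ?B p e] d e i p v in \<open>auto simp: in_hom_iff\<close>)
  ultimately show "\<exists>d\<in>hom D (Cod D (farr F i)) (Dom D p). d \<cdot>\<^bsub>D\<^esub> farr F i = u \<and> p \<cdot>\<^bsub>D\<^esub> d = v"
    using e i by auto
qed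

text \<open>Quillen adjunctions are defined by what the left adjoint does to cofibrations. Both
  left-hand classes are lifting classes, so the condition moves to the right adjoint, which for
  algebras is the functor that leaves underlying arrows alone.\<close>

lemma quillen_adjunctionI:
  assumes "model_category C U V" "model_category D U W"
    and "farr G ` fib W \<subseteq> fib V" "farr G ` triv_fib W \<subseteq> triv_fib V"
  shows "quillen_adjunction U C V D W F G \<phi>"
proof -
  interpret V: model_category C U V by fact
  interpret W: model_category D U W by fact
  have "farr F ` llp C S \<subseteq> llp D T" if "farr G ` T \<subseteq> S" "T \<subseteq> Arr D" for S T
    using that has_lift_adjunct unfolding llp_def by (auto 0 3)
  from this[of "fib W" "fib V"] this[of "triv_fib W" "triv_fib V"]
  have "farr F ` llp C (fib V) \<subseteq> llp D (fib W)" "farr F ` llp C (triv_fib V) \<subseteq> llp D (triv_fib W)"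
    using assms(3,4) W.fib_arr by blast+
  then have "farr F ` cof V \<subseteq> cof W" "farr F ` triv_cof V \<subseteq> triv_cof W"
    unfolding V.triv_cof_eq_llp W.triv_cof_eq_llp by (simp_all add: V.cof_eq_llp W.cof_eq_llp)
  then show ?thesis
    using assms(1,2) adj unfolding quillen_adjunction_def by blast
qed

end

text \<open>The index category is the walking parallel pair, whose two parallel arrows are \<open>e 2\<close> and \<open>e 3\<close>.\<close>

lemma cocomplete_coequalizer:
  fixes U :: "'u itself" and C :: "('o, 'm, 'z) cat_scheme" (structure)
  assumes inf: "infinite (UNIV :: 'u set)" and "category C" and cocomp: "cocomplete_cat U C"
    and u: "u \<in> hom C A B" and v: "v \<in> hom C A B"
  shows "\<exists>p. coequalizer C u v p"
proof -
  interpret category C by fact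
  obtain e :: "nat \<Rightarrow> 'u" where "inj e"
    using infinite_countable_subset[OF inf] by blast
  then have e [simp]: "e m = e n \<longleftrightarrow> m = n" for m n by (auto simp: inj_eq)
  \<comment> \<open>The elements \<open>e 0\<close> and \<open>e 1\<close> are objects and at the
    same time their own identity arrows, hence \<open>Id\<close> is the identity function. If
    \<open>g\<close> is not an identity, a composable \<open>f\<close> must be one, so the composite
    is \<open>g\<close>.\<close>
  define J :: "('u, 'u) cat" where "J = \<lparr>Obj = {e 0, e 1}, Arr = {e 0, e 1, e 2, e 3},
    Dom = (\<lambda>x. if x = e 1 then e 1 else e 0), Cod = (\<lambda>x. if x = e 0 then e 0 else e 1),
    Id = (\<lambda>x. x), Comp = (\<lambda>g f. if g = e 0 \<or> g = e 1 then f else g)\<rparr>"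
  define D :: "('u, 'u, 'o, 'm) ftor" where "D = \<lparr>fobj = (\<lambda>x. if x = e 0 then A else B),
    farr = (\<lambda>x. if x = e 0 then Id C A else if x = e 1 then Id C B else if x = e 2 then u else v)\<rparr>"
  have AB: "A \<in> Obj C" "B \<in> Obj C" and uv: "u \<in> Arr C" "Dom C u = A" "Cod C u = B"
    "v \<in> Arr C" "Dom C v = A" "Cod C v = B" using u v by (auto simp: in_hom_iff)
  have "category J"
    by unfold_locales (auto simp: J_def hom_def split: if_splits)
  then have "is_functor J C D"
    using AB uv category_axioms by (auto simp: is_functor_def J_def D_def in_hom_iff)
  \<comment> \<open>Smallness is a strict inequality of cardinals; finite sets satisfy it because
    \<open>'u\<close> is infinite.\<close>
  moreover have "small U (Obj J)" "small U (Arr J)"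
    unfolding small_def J_def using inf by (auto intro!: finite_lesspoll_infinite)
  ultimately obtain X l where colim: "colimit C J D X l"
    using cocomp unfolding cocomplete_cat_def by blast
  \<comment> \<open>The leg at the source object is forced by the leg at the target, so a cocone
    amounts to a map out of \<open>B\<close> that equalises \<open>u\<close> and
    \<open>v\<close>.\<close>
  have cocone_iff: "cocone C J D Y k \<longleftrightarrow>
      k (e 1) \<in> hom C B Y \<and> k (e 0) = k (e 1) \<cdot> u \<and> k (e 1) \<cdot> u = k (e 1) \<cdot> v" for Y k
    using AB uv by (auto simp: cocone_def J_def D_def in_hom_iff)
  have "coequalizer C u v (l (e 1))"
    unfolding coequalizer_def
  proof (intro conjI ballI impI)
    fix q assume "q \<in> Arr C" "Dom C q = Cod C u \<and> q \<cdot> u = q \<cdot> v"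
    then have "cocone C J D (Cod C q) (\<lambda>x. if x = e 0 then q \<cdot> u else q)"
      unfolding cocone_iff using uv by (auto simp: in_hom_iff)
    then have "\<exists>!k. k \<in> hom C X (Cod C q) \<and> (\<forall>i\<in>Obj J. k \<cdot> l i = (if i = e 0 then q \<cdot> u else q))"
      using colim unfolding colimit_def by blast
    moreover have l: "l (e 1) \<in> hom C B X" "l (e 0) = l (e 1) \<cdot> u"
      using colim unfolding colimit_def cocone_iff by auto
    then have "(\<forall>i\<in>Obj J. k \<cdot> l i = (if i = e 0 then q \<cdot> u else q)) \<longleftrightarrow> k \<cdot> l (e 1) = q"
      if "k \<in> hom C X (Cod C q)" for k
      using that uv comp_reassoc[of u "l (e 1)" k] by (auto simp: J_def in_hom_iff)
    moreover have "Cod C (l (e 1)) = X"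
      using l by (auto simp: in_hom_iff)
    ultimately show "\<exists>!k. k \<in> hom C (Cod C (l (e 1))) (Cod C q) \<and> k \<cdot> l (e 1) = q"
      by metis
  qed (use colim uv in \<open>auto simp: colimit_def cocone_iff in_hom_iff\<close>)
  then show ?thesis by blast
qed

section \<open>Coherence in symmetric monoidal categories\<close>

context symmetric_monoidal_category
begin

declare unit_obj [simp] tensor_obj [simp] tensor_id [simp]

lemma tensor_arr [simp]: "f \<in> Arr M \<Longrightarrow> g \<in> Arr M \<Longrightarrow> f \<odot> g \<in> Arr M"
  and dom_tensor [simp]: "f \<in> Arr M \<Longrightarrow> g \<in> Arr M \<Longrightarrow> Dom M (f \<odot> g) = Dom M f \<otimes> Dom M g"
  and cod_tensor [simp]: "f \<in> Arr M \<Longrightarrow> g \<in> Arr M \<Longrightarrow> Cod M (f \<odot> g) = Cod M f \<otimes> Cod M g"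
  using tensor_hom[of f "Dom M f" "Cod M f" g "Dom M g" "Cod M g"] by (auto simp: in_hom_iff)

lemma interchange [simp]:
  "f \<in> Arr M \<Longrightarrow> f' \<in> Arr M \<Longrightarrow> g \<in> Arr M \<Longrightarrow> g' \<in> Arr M \<Longrightarrow> Dom M f' = Cod M f \<Longrightarrow> Dom M g' = Cod M g
    \<Longrightarrow> (f' \<odot> g') \<cdot> (f \<odot> g) = (f' \<cdot> f) \<odot> (g' \<cdot> g)"
  using tensor_comp[of f "Dom M f" "Cod M f" f' "Cod M f'" g "Dom M g" "Cod M g" g' "Cod M g'"]
  by (auto simp: in_hom_iff)

lemma interchange_tail [simp]:
  "f \<in> Arr M \<Longrightarrow> f' \<in> Arr M \<Longrightarrow> g \<in> Arr M \<Longrightarrow> g' \<in> Arr M \<Longrightarrow> Dom M f' = Cod M f \<Longrightarrow> Dom M g' = Cod M g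
    \<Longrightarrow> h \<in> Arr M \<Longrightarrow> Cod M h = Dom M f \<otimes> Dom M g
    \<Longrightarrow> (f' \<odot> g') \<cdot> ((f \<odot> g) \<cdot> h) = ((f' \<cdot> f) \<odot> (g' \<cdot> g)) \<cdot> h"
  by (rule comp_tail) auto

abbreviation ainv :: "'o \<Rightarrow> 'o \<Rightarrow> 'o \<Rightarrow> 'm" where
  "ainv X Y Z \<equiv> inv_arr M (assoc M X Y Z)"

lemma assoc_arr [simp]:
  assumes "X \<in> Obj M" "Y \<in> Obj M" "Z \<in> Obj M"
  shows "assoc M X Y Z \<in> Arr M" "Dom M (assoc M X Y Z) = (X \<otimes> Y) \<otimes> Z"
    "Cod M (assoc M X Y Z) = X \<otimes> Y \<otimes> Z"
    "ainv X Y Z \<in> Arr M" "Dom M (ainv X Y Z) = X \<otimes> Y \<otimes> Z" "Cod M (ainv X Y Z) = (X \<otimes> Y) \<otimes> Z"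
    "assoc M X Y Z \<cdot> ainv X Y Z = Id M (X \<otimes> Y \<otimes> Z)"
    "ainv X Y Z \<cdot> assoc M X Y Z = Id M ((X \<otimes> Y) \<otimes> Z)"
  using assoc_hom[OF assms] assoc_iso[OF assms]
  by (auto simp: in_hom_iff inv_arr_arr dom_inv_arr cod_inv_arr inv_arr_left inv_arr_right)

lemma assoc_cancel [simp]:
  assumes "X \<in> Obj M" "Y \<in> Obj M" "Z \<in> Obj M" "f \<in> Arr M"
  shows "Cod M f = X \<otimes> Y \<otimes> Z \<Longrightarrow> assoc M X Y Z \<cdot> (ainv X Y Z \<cdot> f) = f"
    "Cod M f = (X \<otimes> Y) \<otimes> Z \<Longrightarrow> ainv X Y Z \<cdot> (assoc M X Y Z \<cdot> f) = f"
  using assms by (simp_all add: comp_reassoc[symmetric] del: comp_reassoc)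

lemma assoc_natural:
  assumes "f \<in> Arr M" "g \<in> Arr M" "h \<in> Arr M" "X = Cod M f" "Y = Cod M g" "Z = Cod M h"
  shows "assoc M X Y Z \<cdot> ((f \<odot> g) \<odot> h) = (f \<odot> g \<odot> h) \<cdot> assoc M (Dom M f) (Dom M g) (Dom M h)"
  using assoc_nat[of f "Dom M f" "Cod M f" g "Dom M g" "Cod M g" h "Dom M h" "Cod M h"] assms
  by (auto simp: in_hom_iff)

lemma ainv_natural:
  assumes "f \<in> Arr M" "g \<in> Arr M" "h \<in> Arr M" "X = Cod M f" "Y = Cod M g" "Z = Cod M h"
  shows "ainv X Y Z \<cdot> (f \<odot> g \<odot> h) = ((f \<odot> g) \<odot> h) \<cdot> ainv (Dom M f) (Dom M g) (Dom M h)"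
proof (rule iso_cancel_left)
  show "assoc M X Y Z \<cdot> (ainv X Y Z \<cdot> (f \<odot> g \<odot> h)) =
      assoc M X Y Z \<cdot> (((f \<odot> g) \<odot> h) \<cdot> ainv (Dom M f) (Dom M g) (Dom M h))"
    using assms by (simp add: comp_tail[OF assoc_natural])
qed (use assms in \<open>auto simp: assoc_iso\<close>)

text \<open>Variants needed because the simplifier merges \<open>Id \<odot> Id\<close> into a single identity.\<close>

lemma assoc_natural_id:
  assumes "X \<in> Obj M" "Y \<in> Obj M" "g \<in> Arr M" "Z = Cod M g"
  shows "assoc M X Y Z \<cdot> (Id M (X \<otimes> Y) \<odot> g) = (Id M X \<odot> Id M Y \<odot> g) \<cdot> assoc M X Y (Dom M g)"
    and "assoc M Z X Y \<cdot> ((g \<odot> Id M X) \<odot> Id M Y) = (g \<odot> Id M (X \<otimes> Y)) \<cdot> assoc M (Dom M g) X Y"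
    and "ainv X Y Z \<cdot> (Id M X \<odot> Id M Y \<odot> g) = (Id M (X \<otimes> Y) \<odot> g) \<cdot> ainv X Y (Dom M g)"
    and "ainv Z X Y \<cdot> (g \<odot> Id M (X \<otimes> Y)) = ((g \<odot> Id M X) \<odot> Id M Y) \<cdot> ainv (Dom M g) X Y"
  using assms assoc_natural[of "Id M X" "Id M Y" g X Y Z] assoc_natural[of g "Id M X" "Id M Y" Z X Y]
    ainv_natural[of "Id M X" "Id M Y" g X Y Z] ainv_natural[of g "Id M X" "Id M Y" Z X Y]
  by simp_all

abbreviation linv :: "'o \<Rightarrow> 'm" where
  "linv X \<equiv> inv_arr M (lunit M X)"

abbreviation rinv :: "'o \<Rightarrow> 'm" where
  "rinv X \<equiv> inv_arr M (runit M X)"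

lemma unitors_arr [simp]:
  assumes "X \<in> Obj M"
  shows "lunit M X \<in> Arr M" "Dom M (lunit M X) = unit M \<otimes> X" "Cod M (lunit M X) = X"
    "runit M X \<in> Arr M" "Dom M (runit M X) = X \<otimes> unit M" "Cod M (runit M X) = X"
    "linv X \<in> Arr M" "Dom M (linv X) = X" "Cod M (linv X) = unit M \<otimes> X"
    "rinv X \<in> Arr M" "Dom M (rinv X) = X" "Cod M (rinv X) = X \<otimes> unit M"
    "lunit M X \<cdot> linv X = Id M X" "linv X \<cdot> lunit M X = Id M (unit M \<otimes> X)"
    "runit M X \<cdot> rinv X = Id M X" "rinv X \<cdot> runit M X = Id M (X \<otimes> unit M)"
  using lunit_hom[OF assms] lunit_iso[OF assms] runit_hom[OF assms] runit_iso[OF assms]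
  by (auto simp: in_hom_iff inv_arr_arr dom_inv_arr cod_inv_arr inv_arr_left inv_arr_right)

lemma unitors_cancel [simp]:
  assumes "X \<in> Obj M" "f \<in> Arr M"
  shows "Cod M f = X \<Longrightarrow> lunit M X \<cdot> (linv X \<cdot> f) = f" "Cod M f = unit M \<otimes> X \<Longrightarrow> linv X \<cdot> (lunit M X \<cdot> f) = f"
    "Cod M f = X \<Longrightarrow> runit M X \<cdot> (rinv X \<cdot> f) = f" "Cod M f = X \<otimes> unit M \<Longrightarrow> rinv X \<cdot> (runit M X \<cdot> f) = f"
  using assms by (simp_all add: comp_reassoc[symmetric] del: comp_reassoc)

lemma lunit_natural: "f \<in> Arr M \<Longrightarrow> X = Cod M f \<Longrightarrow> lunit M X \<cdot> (Id M (unit M) \<odot> f) = f \<cdot> lunit M (Dom M f)"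
  and runit_natural: "f \<in> Arr M \<Longrightarrow> X = Cod M f \<Longrightarrow> runit M X \<cdot> (f \<odot> Id M (unit M)) = f \<cdot> runit M (Dom M f)"
  using lunit_nat[of f "Dom M f" "Cod M f"] runit_nat[of f "Dom M f" "Cod M f"] by (auto simp: in_hom_iff)

lemma linv_natural:
  assumes "f \<in> Arr M" "X = Cod M f"
  shows "linv X \<cdot> f = (Id M (unit M) \<odot> f) \<cdot> linv (Dom M f)"
  by (rule iso_cancel_left[of "lunit M X"])
    (use assms in \<open>auto simp: lunit_iso comp_tail[OF lunit_natural]\<close>)

lemma rinv_natural:
  assumes "f \<in> Arr M" "X = Cod M f"
  shows "rinv X \<cdot> f = (f \<odot> Id M (unit M)) \<cdot> rinv (Dom M f)"
  by (rule iso_cancel_left[of "runit M X"])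
    (use assms in \<open>auto simp: runit_iso comp_tail[OF runit_natural]\<close>)

lemma braid_arr [simp]:
  assumes "X \<in> Obj M" "Y \<in> Obj M"
  shows "braid M X Y \<in> Arr M" "Dom M (braid M X Y) = X \<otimes> Y" "Cod M (braid M X Y) = Y \<otimes> X"
    "braid M Y X \<cdot> braid M X Y = Id M (X \<otimes> Y)"
  using braid_hom[OF assms] braid_sym[OF assms] by (auto simp: in_hom_iff)

lemma braid_cancel [simp]:
  assumes "X \<in> Obj M" "Y \<in> Obj M" "f \<in> Arr M" "Cod M f = X \<otimes> Y"
  shows "braid M Y X \<cdot> (braid M X Y \<cdot> f) = f"
  using assms by (simp add: comp_reassoc[symmetric] del: comp_reassoc)

lemma braid_iso: "X \<in> Obj M \<Longrightarrow> Y \<in> Obj M \<Longrightarrow> is_iso M (braid M X Y)"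
  by (rule is_isoI[of _ "braid M Y X"]) auto

lemma braid_natural:
  assumes "f \<in> Arr M" "g \<in> Arr M" "X = Cod M f" "Y = Cod M g"
  shows "braid M X Y \<cdot> (f \<odot> g) = (g \<odot> f) \<cdot> braid M (Dom M f) (Dom M g)"
  using braid_nat[of f "Dom M f" "Cod M f" g "Dom M g" "Cod M g"] assms by (auto simp: in_hom_iff)

lemma tensor_iso:
  assumes "is_iso M f" "is_iso M g"
  shows "is_iso M (f \<odot> g)"
  by (rule is_isoI[of _ "inv_arr M f \<odot> inv_arr M g"])
    (use assms in \<open>simp_all add: iso_arr inv_arr_arr dom_inv_arr cod_inv_arr inv_arr_left inv_arr_right\<close>)

section \<open>Unit laws derived from pentagon, triangle and hexagon\<close>

lemma unit_tensor_faithful: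
  assumes "Id M (unit M) \<odot> f = Id M (unit M) \<odot> g" "f \<in> Arr M" "g \<in> Arr M" "Dom M f = Dom M g" "Cod M f = Cod M g"
  shows "f = g"
proof (rule iso_cancel_right)
  show "f \<cdot> lunit M (Dom M f) = g \<cdot> lunit M (Dom M f)"
    using lunit_natural[of f "Cod M f"] lunit_natural[of g "Cod M f"] assms by simp
qed (use assms in \<open>simp_all add: lunit_iso\<close>)

lemma tensor_unit_faithful:
  assumes "f \<odot> Id M (unit M) = g \<odot> Id M (unit M)" "f \<in> Arr M" "g \<in> Arr M" "Dom M f = Dom M g" "Cod M f = Cod M g"
  shows "f = g"
proof (rule iso_cancel_right)
  show "f \<cdot> runit M (Dom M f) = g \<cdot> runit M (Dom M f)"
    using runit_natural[of f "Cod M f"] runit_natural[of g "Cod M f"] assms by simp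
qed (use assms in \<open>simp_all add: runit_iso\<close>)

lemma triangle_tail:
  assumes "X \<in> Obj M" "Y \<in> Obj M" "f \<in> Arr M" "Cod M f = (X \<otimes> unit M) \<otimes> Y"
  shows "(Id M X \<odot> lunit M Y) \<cdot> (assoc M X (unit M) Y \<cdot> f) = (runit M X \<odot> Id M Y) \<cdot> f"
  using assms by (simp add: comp_tail[OF triangle])

text \<open>Kelly's derivation: tensoring with the unit is faithful, so the law may be proved with
  an additional unit in front, where the pentagon on \<open>?I\<close>, \<open>?I\<close>, X, Y
  reduces it to the triangle.\<close>

lemma lunit_tensor:
  assumes "X \<in> Obj M" "Y \<in> Obj M"
  shows "lunit M (X \<otimes> Y) \<cdot> assoc M (unit M) X Y = lunit M X \<odot> Id M Y"
proof (rule unit_tensor_faithful)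
  let ?I = "unit M"
  \<comment> \<open>Two of the three arrows on the long side of the pentagon; composing with them on
    the right makes the pentagon applicable.\<close>
  let ?a = "assoc M ?I (?I \<otimes> X) Y \<cdot> (assoc M ?I ?I X \<odot> Id M Y)"
  show "Id M ?I \<odot> (lunit M (X \<otimes> Y) \<cdot> assoc M ?I X Y) = Id M ?I \<odot> (lunit M X \<odot> Id M Y)"
  proof (rule iso_cancel_right[of _ ?a])
    have "Id M ?I \<odot> (lunit M (X \<otimes> Y) \<cdot> assoc M ?I X Y) \<cdot> ?a =
        (Id M ?I \<odot> lunit M (X \<otimes> Y)) \<cdot> ((Id M ?I \<odot> assoc M ?I X Y) \<cdot> assoc M ?I (?I \<otimes> X) Y \<cdot> (assoc M ?I ?I X \<odot> Id M Y))"
      using assms by simp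
    also have "\<dots> = (Id M ?I \<odot> lunit M (X \<otimes> Y)) \<cdot> (assoc M ?I ?I (X \<otimes> Y) \<cdot> assoc M (?I \<otimes> ?I) X Y)"
      using assms by (simp only: pentagon unit_obj)
    also have "\<dots> = (runit M ?I \<odot> Id M (X \<otimes> Y)) \<cdot> assoc M (?I \<otimes> ?I) X Y"
      using assms by (simp add: triangle_tail)
    also have "\<dots> = assoc M ?I X Y \<cdot> ((runit M ?I \<odot> Id M X) \<odot> Id M Y)"
      using assms by (simp add: assoc_natural_id)
    also have "\<dots> = assoc M ?I X Y \<cdot> (((Id M ?I \<odot> lunit M X) \<odot> Id M Y) \<cdot> (assoc M ?I ?I X \<odot> Id M Y))"
      using assms by (simp add: triangle)
    also have "\<dots> = (Id M ?I \<odot> (lunit M X \<odot> Id M Y)) \<cdot> ?a"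
      using assms by (simp add: comp_tail[OF assoc_natural] del: interchange interchange_tail)
    finally show "Id M ?I \<odot> (lunit M (X \<otimes> Y) \<cdot> assoc M ?I X Y) \<cdot> ?a =
        (Id M ?I \<odot> (lunit M X \<odot> Id M Y)) \<cdot> ?a" .
  qed (use assms in \<open>simp_all add: is_iso_comp tensor_iso assoc_iso is_iso_id\<close>)
qed (use assms in simp_all)

text \<open>Mirror image of \<open>lunit_tensor\<close>: the additional unit stands on the right,
  and the pentagon is taken on X, Y and two units.\<close>

lemma runit_tensor:
  assumes "X \<in> Obj M" "Y \<in> Obj M"
  shows "(Id M X \<odot> runit M Y) \<cdot> assoc M X Y (unit M) = runit M (X \<otimes> Y)"
proof (rule tensor_unit_faithful, rule iso_cancel_left[of "assoc M X Y (unit M)"])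
  let ?I = "unit M"
  have "assoc M X Y ?I \<cdot> (((Id M X \<odot> runit M Y) \<cdot> assoc M X Y ?I) \<odot> Id M ?I) =
      assoc M X Y ?I \<cdot> (((Id M X \<odot> runit M Y) \<odot> Id M ?I) \<cdot> (assoc M X Y ?I \<odot> Id M ?I))"
    using assms by simp
  also have "\<dots> = (Id M X \<odot> (runit M Y \<odot> Id M ?I)) \<cdot> assoc M X (Y \<otimes> ?I) ?I \<cdot> (assoc M X Y ?I \<odot> Id M ?I)"
    using assms by (simp add: comp_tail[OF assoc_natural] del: interchange interchange_tail)
  also have "\<dots> = (Id M X \<odot> (Id M Y \<odot> lunit M ?I)) \<cdot>
      ((Id M X \<odot> assoc M Y ?I ?I) \<cdot> assoc M X (Y \<otimes> ?I) ?I \<cdot> (assoc M X Y ?I \<odot> Id M ?I))"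
    using assms by (simp add: triangle)
  also have "\<dots> = (Id M X \<odot> (Id M Y \<odot> lunit M ?I)) \<cdot> (assoc M X Y (?I \<otimes> ?I) \<cdot> assoc M (X \<otimes> Y) ?I ?I)"
    using assms by (simp only: pentagon unit_obj)
  also have "\<dots> = assoc M X Y ?I \<cdot> ((Id M (X \<otimes> Y) \<odot> lunit M ?I) \<cdot> assoc M (X \<otimes> Y) ?I ?I)"
    using assms by (simp add: comp_tail[OF assoc_natural_id(1)])
  also have "\<dots> = assoc M X Y ?I \<cdot> (runit M (X \<otimes> Y) \<odot> Id M ?I)"
    using assms by (simp add: triangle)
  finally show "assoc M X Y ?I \<cdot> (((Id M X \<odot> runit M Y) \<cdot> assoc M X Y ?I) \<odot> Id M ?I) =
      assoc M X Y ?I \<cdot> (runit M (X \<otimes> Y) \<odot> Id M ?I)" .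
qed (use assms in \<open>simp_all add: assoc_iso\<close>)

text \<open>Naturality of \<open>lunit\<close> at its own component identifies
  \<open>Id M ?I \<odot> lunit M ?I\<close> with the unitor of the doubled unit; then
  \<open>lunit_tensor\<close> and the triangle describe the same arrow. Needed because
  \<open>eps\<close> is formed with \<open>linv\<close> and \<open>inl\<close> with
  \<open>rinv\<close>.\<close>

lemma lunit_unit: "lunit M (unit M) = runit M (unit M)"
proof (rule tensor_unit_faithful)
  let ?I = "unit M"
  have "lunit M ?I \<cdot> (Id M ?I \<odot> lunit M ?I) = lunit M ?I \<cdot> lunit M (?I \<otimes> ?I)"
    using lunit_natural[of "lunit M ?I" ?I] by simp
  then have "Id M ?I \<odot> lunit M ?I = lunit M (?I \<otimes> ?I)"
    by (rule iso_cancel_left) (simp_all add: lunit_iso)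
  then show "lunit M ?I \<odot> Id M ?I = runit M ?I \<odot> Id M ?I"
    using lunit_tensor[of ?I ?I] triangle[of ?I ?I] by simp
qed simp_all

text \<open>The hexagon with two of its objects equal to the unit; one braiding then occurs on both
  sides and is cancelled together with the added unit factor.\<close>

lemma lunit_braid:
  assumes "X \<in> Obj M"
  shows "lunit M X \<cdot> braid M X (unit M) = runit M X"
proof (rule tensor_unit_faithful, rule iso_cancel_left[of "braid M X (unit M)"])
  let ?I = "unit M"
  have "braid M X ?I \<cdot> ((lunit M X \<cdot> braid M X ?I) \<odot> Id M ?I) =
      braid M X ?I \<cdot> ((lunit M X \<odot> Id M ?I) \<cdot> (braid M X ?I \<odot> Id M ?I))"
    using assms by simp
  also have "\<dots> = braid M X ?I \<cdot> (lunit M (X \<otimes> ?I) \<cdot> assoc M ?I X ?I \<cdot> (braid M X ?I \<odot> Id M ?I))"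
    using assms by (simp add: lunit_tensor)
  also have "\<dots> = lunit M (?I \<otimes> X) \<cdot> ((Id M ?I \<odot> braid M X ?I) \<cdot> assoc M ?I X ?I \<cdot> (braid M X ?I \<odot> Id M ?I))"
    using assms by (simp add: comp_tail[OF lunit_natural])
  also have "\<dots> = lunit M (?I \<otimes> X) \<cdot> (assoc M ?I ?I X \<cdot> braid M X (?I \<otimes> ?I) \<cdot> assoc M X ?I ?I)"
    using assms by (simp only: hexagon unit_obj)
  also have "\<dots> = (lunit M ?I \<odot> Id M X) \<cdot> (braid M X (?I \<otimes> ?I) \<cdot> assoc M X ?I ?I)"
    using assms by (simp add: comp_tail[OF lunit_tensor])
  also have "\<dots> = braid M X ?I \<cdot> ((Id M X \<odot> lunit M ?I) \<cdot> assoc M X ?I ?I)"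
    using assms by (simp add: comp_tail[OF braid_natural])
  also have "\<dots> = braid M X ?I \<cdot> (runit M X \<odot> Id M ?I)"
    using assms by (simp add: triangle)
  finally show "braid M X ?I \<cdot> ((lunit M X \<cdot> braid M X ?I) \<odot> Id M ?I) =
      braid M X ?I \<cdot> (runit M X \<odot> Id M ?I)" .
qed (use assms in \<open>simp_all add: braid_iso\<close>)

lemma runit_braid:
  assumes "X \<in> Obj M"
  shows "runit M X \<cdot> braid M (unit M) X = lunit M X"
  using assms lunit_braid[OF assms, symmetric] by simp

lemma linv_tensor:
  assumes "X \<in> Obj M" "Y \<in> Obj M"
  shows "assoc M (unit M) X Y \<cdot> (linv X \<odot> Id M Y) = linv (X \<otimes> Y)"
proof (rule iso_cancel_left[of "lunit M (X \<otimes> Y)"])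
  show "lunit M (X \<otimes> Y) \<cdot> (assoc M (unit M) X Y \<cdot> (linv X \<odot> Id M Y)) = lunit M (X \<otimes> Y) \<cdot> linv (X \<otimes> Y)"
    using assms by (simp add: comp_tail[OF lunit_tensor])
qed (use assms in \<open>simp_all add: lunit_iso\<close>)

lemma rinv_tensor:
  assumes "X \<in> Obj M" "Y \<in> Obj M"
  shows "ainv X Y (unit M) \<cdot> (Id M X \<odot> rinv Y) = rinv (X \<otimes> Y)"
proof (rule iso_cancel_left[of "runit M (X \<otimes> Y)"])
  have "runit M (X \<otimes> Y) \<cdot> ainv X Y (unit M) = Id M X \<odot> runit M Y"
    using assms by (simp add: runit_tensor[symmetric])
  then show "runit M (X \<otimes> Y) \<cdot> (ainv X Y (unit M) \<cdot> (Id M X \<odot> rinv Y)) = runit M (X \<otimes> Y) \<cdot> rinv (X \<otimes> Y)"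
    using assms by (simp add: comp_tail)
qed (use assms in \<open>simp_all add: runit_iso\<close>)

lemma triangle_inv:
  assumes "X \<in> Obj M" "Y \<in> Obj M"
  shows "assoc M X (unit M) Y \<cdot> (rinv X \<odot> Id M Y) = Id M X \<odot> linv Y"
proof (rule iso_cancel_left[of "Id M X \<odot> lunit M Y"])
  show "(Id M X \<odot> lunit M Y) \<cdot> (assoc M X (unit M) Y \<cdot> (rinv X \<odot> Id M Y)) = (Id M X \<odot> lunit M Y) \<cdot> (Id M X \<odot> linv Y)"
    using assms by (simp add: triangle_tail)
qed (use assms in \<open>simp_all add: lunit_iso tensor_iso is_iso_id\<close>)

lemma ainv_linv:
  assumes "X \<in> Obj M" "Y \<in> Obj M"
  shows "ainv X (unit M) Y \<cdot> (Id M X \<odot> linv Y) = rinv X \<odot> Id M Y"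
  using assms triangle_inv[OF assms, symmetric] by simp

text \<open>Bracketing everything to the right and permuting factors by \<open>exch\<close> keeps associators out of most
  computations.\<close>

definition exch :: "'o \<Rightarrow> 'o \<Rightarrow> 'o \<Rightarrow> 'm" where
  "exch X Y Z = assoc M Y X Z \<cdot> (braid M X Y \<odot> Id M Z) \<cdot> ainv X Y Z"

lemma exch_arr [simp]:
  assumes "X \<in> Obj M" "Y \<in> Obj M" "Z \<in> Obj M"
  shows "exch X Y Z \<in> Arr M" "Dom M (exch X Y Z) = X \<otimes> Y \<otimes> Z" "Cod M (exch X Y Z) = Y \<otimes> X \<otimes> Z"
    "exch Y X Z \<cdot> exch X Y Z = Id M (X \<otimes> Y \<otimes> Z)"
  using assms by (simp_all add: exch_def)

lemma exch_cancel [simp]: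
  assumes "X \<in> Obj M" "Y \<in> Obj M" "Z \<in> Obj M" "f \<in> Arr M" "Cod M f = X \<otimes> Y \<otimes> Z"
  shows "exch Y X Z \<cdot> (exch X Y Z \<cdot> f) = f"
  using assms by (simp add: comp_reassoc[symmetric] del: comp_reassoc)

lemma exch_natural:
  assumes "f \<in> Arr M" "g \<in> Arr M" "h \<in> Arr M" "X = Cod M f" "Y = Cod M g" "Z = Cod M h"
  shows "exch X Y Z \<cdot> (f \<odot> g \<odot> h) = (g \<odot> f \<odot> h) \<cdot> exch (Dom M f) (Dom M g) (Dom M h)"
proof -
  have "exch X Y Z \<cdot> (f \<odot> g \<odot> h) = assoc M Y X Z \<cdot> ((braid M X Y \<cdot> (f \<odot> g)) \<odot> h) \<cdot> ainv (Dom M f) (Dom M g) (Dom M h)"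
    using assms by (simp add: exch_def ainv_natural)
  also have "\<dots> = assoc M Y X Z \<cdot> (((g \<odot> f) \<odot> h) \<cdot> (braid M (Dom M f) (Dom M g) \<odot> Id M (Dom M h)))
      \<cdot> ainv (Dom M f) (Dom M g) (Dom M h)"
    using assms by (simp add: braid_natural)
  also have "\<dots> = (g \<odot> f \<odot> h) \<cdot> exch (Dom M f) (Dom M g) (Dom M h)"
    using assms by (simp add: exch_def comp_tail[OF assoc_natural] del: interchange interchange_tail)
  finally show ?thesis .
qed

lemma exch_natural_id:
  assumes "f \<in> Arr M" "Y \<in> Obj M" "Z \<in> Obj M" "X = Cod M f"
  shows "exch X Y Z \<cdot> (f \<odot> Id M (Y \<otimes> Z)) = (Id M Y \<odot> f \<odot> Id M Z) \<cdot> exch (Dom M f) Y Z"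
  using exch_natural[of f "Id M Y" "Id M Z" X Y Z] assms by simp

text \<open>Passing a product means passing its factors in turn. For X, Y, Y' alone this is the
  hexagon; pentagons carry it past the spectator Z. The isomorphism composed on the right completes
  the first pentagon.\<close>

lemma exch_assoc:
  assumes "X \<in> Obj M" "Y \<in> Obj M" "Y' \<in> Obj M" "Z \<in> Obj M"
  shows "assoc M Y Y' (X \<otimes> Z) \<cdot> exch X (Y \<otimes> Y') Z =
    (Id M Y \<odot> exch X Y' Z) \<cdot> exch X Y (Y' \<otimes> Z) \<cdot> (Id M X \<odot> assoc M Y Y' Z)"
proof (rule iso_cancel_right[of _ "assoc M X (Y \<otimes> Y') Z \<cdot> (assoc M X Y Y' \<odot> Id M Z)"])
  have "(Id M Y \<odot> exch X Y' Z) \<cdot> exch X Y (Y' \<otimes> Z) \<cdot> (Id M X \<odot> assoc M Y Y' Z) \<cdot>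
      (assoc M X (Y \<otimes> Y') Z \<cdot> (assoc M X Y Y' \<odot> Id M Z)) =
    (Id M Y \<odot> exch X Y' Z) \<cdot> exch X Y (Y' \<otimes> Z) \<cdot>
      ((Id M X \<odot> assoc M Y Y' Z) \<cdot> assoc M X (Y \<otimes> Y') Z \<cdot> (assoc M X Y Y' \<odot> Id M Z))"
    using assms by simp
  also have "\<dots> = (Id M Y \<odot> exch X Y' Z) \<cdot> exch X Y (Y' \<otimes> Z) \<cdot> (assoc M X Y (Y' \<otimes> Z) \<cdot> assoc M (X \<otimes> Y) Y' Z)"
    using assms by (simp only: pentagon)
  also have "\<dots> = (Id M Y \<odot> exch X Y' Z) \<cdot> (assoc M Y X (Y' \<otimes> Z) \<cdot> ((braid M X Y \<odot> Id M (Y' \<otimes> Z)) \<cdot> assoc M (X \<otimes> Y) Y' Z))"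
    using assms by (simp add: exch_def)
  also have "\<dots> = (Id M Y \<odot> exch X Y' Z) \<cdot> (assoc M Y X (Y' \<otimes> Z) \<cdot> assoc M (Y \<otimes> X) Y' Z \<cdot> ((braid M X Y \<odot> Id M Y') \<odot> Id M Z))"
    using assms by (simp add: assoc_natural_id(2))
  also have "\<dots> = (Id M Y \<odot> exch X Y' Z) \<cdot> ((Id M Y \<odot> assoc M X Y' Z) \<cdot> assoc M Y (X \<otimes> Y') Z \<cdot> (assoc M Y X Y' \<odot> Id M Z)
      \<cdot> ((braid M X Y \<odot> Id M Y') \<odot> Id M Z))"
    using assms by (simp only: pentagon)
  also have "\<dots> = (Id M Y \<odot> assoc M Y' X Z) \<cdot> ((Id M Y \<odot> (braid M X Y' \<odot> Id M Z)) \<cdot> assoc M Y (X \<otimes> Y') Z) \<cdot>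
      ((assoc M Y X Y' \<cdot> (braid M X Y \<odot> Id M Y')) \<odot> Id M Z)"
    using assms by (simp add: exch_def)
  also have "\<dots> = (Id M Y \<odot> assoc M Y' X Z) \<cdot> (assoc M Y (Y' \<otimes> X) Z \<cdot> ((Id M Y \<odot> braid M X Y') \<odot> Id M Z)) \<cdot>
      ((assoc M Y X Y' \<cdot> (braid M X Y \<odot> Id M Y')) \<odot> Id M Z)"
    using assms by (simp add: comp_tail[OF assoc_natural] del: interchange interchange_tail)
  also have "\<dots> = (Id M Y \<odot> assoc M Y' X Z) \<cdot> assoc M Y (Y' \<otimes> X) Z \<cdot>
      (((Id M Y \<odot> braid M X Y') \<cdot> assoc M Y X Y' \<cdot> (braid M X Y \<odot> Id M Y')) \<odot> Id M Z)"
    using assms by simp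
  also have "\<dots> = (Id M Y \<odot> assoc M Y' X Z) \<cdot> assoc M Y (Y' \<otimes> X) Z \<cdot>
      ((assoc M Y Y' X \<cdot> braid M X (Y \<otimes> Y') \<cdot> assoc M X Y Y') \<odot> Id M Z)"
    using assms by (simp only: hexagon)
  also have "\<dots> = (Id M Y \<odot> assoc M Y' X Z) \<cdot> assoc M Y (Y' \<otimes> X) Z \<cdot> (assoc M Y Y' X \<odot> Id M Z) \<cdot>
      ((braid M X (Y \<otimes> Y') \<cdot> assoc M X Y Y') \<odot> Id M Z)"
    using assms by simp
  also have "\<dots> = assoc M Y Y' (X \<otimes> Z) \<cdot> assoc M (Y \<otimes> Y') X Z \<cdot>
      ((braid M X (Y \<otimes> Y') \<cdot> assoc M X Y Y') \<odot> Id M Z)"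
    using assms by (simp only: pentagon)
  also have "\<dots> = assoc M Y Y' (X \<otimes> Z) \<cdot> exch X (Y \<otimes> Y') Z \<cdot> (assoc M X (Y \<otimes> Y') Z \<cdot> (assoc M X Y Y' \<odot> Id M Z))"
    using assms by (simp add: exch_def)
  finally show "assoc M Y Y' (X \<otimes> Z) \<cdot> exch X (Y \<otimes> Y') Z \<cdot> (assoc M X (Y \<otimes> Y') Z \<cdot> (assoc M X Y Y' \<odot> Id M Z)) =
      (Id M Y \<odot> exch X Y' Z) \<cdot> exch X Y (Y' \<otimes> Z) \<cdot> (Id M X \<odot> assoc M Y Y' Z) \<cdot>
      (assoc M X (Y \<otimes> Y') Z \<cdot> (assoc M X Y Y' \<odot> Id M Z))" by simp
qed (use assms in \<open>simp_all add: is_iso_comp tensor_iso assoc_iso is_iso_id\<close>)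

lemma exch_iso: "X \<in> Obj M \<Longrightarrow> Y \<in> Obj M \<Longrightarrow> Z \<in> Obj M \<Longrightarrow> is_iso M (exch X Y Z)"
  by (rule is_isoI[of _ "exch Y X Z"]) auto

text \<open>The companion of \<open>exch_assoc\<close> with the product as the moving factor.
  Composing with the inverse exchange \<open>exch Y (X \<otimes> X') Z\<close> turns it into that
  lemma.\<close>

lemma exch_assoc':
  assumes "X \<in> Obj M" "X' \<in> Obj M" "Y \<in> Obj M" "Z \<in> Obj M"
  shows "(Id M Y \<odot> assoc M X X' Z) \<cdot> exch (X \<otimes> X') Y Z =
    exch X Y (X' \<otimes> Z) \<cdot> (Id M X \<odot> exch X' Y Z) \<cdot> assoc M X X' (Y \<otimes> Z)"
  by (rule iso_cancel_right[of _ "exch Y (X \<otimes> X') Z"])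
    (use assms in \<open>simp_all add: exch_assoc exch_iso\<close>)

text \<open>Passing a freshly inserted unit is the same as inserting the unit in front; this is
  \<open>lunit_braid\<close> with a spectator.\<close>

lemma exch_unit:
  assumes "X \<in> Obj M" "Z \<in> Obj M"
  shows "exch X (unit M) Z \<cdot> (Id M X \<odot> linv Z) = linv (X \<otimes> Z)"
proof -
  have "braid M X (unit M) \<cdot> rinv X = linv X"
  proof (rule iso_cancel_left[of "lunit M X"])
    show "lunit M X \<cdot> (braid M X (unit M) \<cdot> rinv X) = lunit M X \<cdot> linv X"
      using assms by (simp add: comp_tail[OF lunit_braid])
  qed (use assms in \<open>simp_all add: lunit_iso\<close>)
  then show ?thesis
    using assms by (simp add: exch_def ainv_linv linv_tensor)
qed

text \<open>Carrying Z to the front of X \<otimes> Y and then back past X amounts to carrying it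
  past Y only. This is the hexagon after inserting a braiding and its inverse, and it enters the
  commutativity of the product on P.\<close>

lemma exch_braid:
  assumes "X \<in> Obj M" "Y \<in> Obj M" "Z \<in> Obj M"
  shows "exch Z X Y \<cdot> braid M (X \<otimes> Y) Z = (Id M X \<odot> braid M Y Z) \<cdot> assoc M X Y Z"
proof -
  have "exch Z X Y = (Id M X \<odot> braid M Y Z) \<cdot>
      ((Id M X \<odot> braid M Z Y) \<cdot> assoc M X Z Y \<cdot> (braid M Z X \<odot> Id M Y)) \<cdot> ainv Z X Y"
    using assms by (simp add: exch_def)
  also have "\<dots> = (Id M X \<odot> braid M Y Z) \<cdot>
      (assoc M X Y Z \<cdot> braid M Z (X \<otimes> Y) \<cdot> assoc M Z X Y) \<cdot> ainv Z X Y"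
    using assms by (simp only: hexagon)
  also have "\<dots> = (Id M X \<odot> braid M Y Z) \<cdot> (assoc M X Y Z \<cdot> braid M Z (X \<otimes> Y))"
    using assms by simp
  finally show ?thesis using assms by simp
qed


text \<open>The pentagon solved for a shape containing inverse associators. Such shapes arise
  because the action of A on P involves \<open>ainv\<close>; \<open>pentagon_inv'\<close> is the
  second one that occurs.\<close>

lemma pentagon_inv:
  assumes "X \<in> Obj M" "Y \<in> Obj M" "Z \<in> Obj M" "V \<in> Obj M"
  shows "ainv X Y (Z \<otimes> V) \<cdot> (Id M X \<odot> assoc M Y Z V) =
      assoc M (X \<otimes> Y) Z V \<cdot> (ainv X Y Z \<odot> Id M V) \<cdot> ainv X (Y \<otimes> Z) V"
proof (rule iso_cancel_right[of _ "assoc M X (Y \<otimes> Z) V \<cdot> (assoc M X Y Z \<odot> Id M V)"])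
  have "ainv X Y (Z \<otimes> V) \<cdot> (Id M X \<odot> assoc M Y Z V) \<cdot> (assoc M X (Y \<otimes> Z) V \<cdot> (assoc M X Y Z \<odot> Id M V)) =
      ainv X Y (Z \<otimes> V) \<cdot> ((Id M X \<odot> assoc M Y Z V) \<cdot> assoc M X (Y \<otimes> Z) V \<cdot> (assoc M X Y Z \<odot> Id M V))"
    using assms by simp
  also have "\<dots> = ainv X Y (Z \<otimes> V) \<cdot> (assoc M X Y (Z \<otimes> V) \<cdot> assoc M (X \<otimes> Y) Z V)"
    using assms by (simp only: pentagon)
  finally show "ainv X Y (Z \<otimes> V) \<cdot> (Id M X \<odot> assoc M Y Z V) \<cdot> (assoc M X (Y \<otimes> Z) V \<cdot> (assoc M X Y Z \<odot> Id M V)) =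
      assoc M (X \<otimes> Y) Z V \<cdot> (ainv X Y Z \<odot> Id M V) \<cdot> ainv X (Y \<otimes> Z) V \<cdot>
      (assoc M X (Y \<otimes> Z) V \<cdot> (assoc M X Y Z \<odot> Id M V))"
    using assms by simp
qed (use assms in \<open>simp_all add: is_iso_comp tensor_iso assoc_iso is_iso_id\<close>)

lemma pentagon_inv':
  assumes "X \<in> Obj M" "Y \<in> Obj M" "Z \<in> Obj M" "V \<in> Obj M"
  shows "(assoc M X Y Z \<odot> Id M V) \<cdot> ainv (X \<otimes> Y) Z V =
      ainv X (Y \<otimes> Z) V \<cdot> (Id M X \<odot> ainv Y Z V) \<cdot> assoc M X Y (Z \<otimes> V)"
proof -
  have "(Id M X \<odot> ainv Y Z V) \<cdot> (assoc M X Y (Z \<otimes> V) \<cdot> assoc M (X \<otimes> Y) Z V) =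
      (Id M X \<odot> ainv Y Z V) \<cdot> ((Id M X \<odot> assoc M Y Z V) \<cdot> assoc M X (Y \<otimes> Z) V \<cdot> (assoc M X Y Z \<odot> Id M V))"
    using assms by (simp only: pentagon)
  then have "(assoc M X Y Z \<odot> Id M V) = ainv X (Y \<otimes> Z) V \<cdot>
      ((Id M X \<odot> ainv Y Z V) \<cdot> (assoc M X Y (Z \<otimes> V) \<cdot> assoc M (X \<otimes> Y) Z V))"
    using assms by simp
  then show ?thesis using assms by simp
qed

text \<open>Rebracketing with a spectator V on the right, needed where the action of B on P, which
  involves an exchange, is tensored with a further factor.\<close>

lemma exch_tensor:
  assumes "X \<in> Obj M" "Y \<in> Obj M" "Z \<in> Obj M" "V \<in> Obj M"
  shows "(Id M Y \<odot> assoc M X Z V) \<cdot> assoc M Y (X \<otimes> Z) V \<cdot> (exch X Y Z \<odot> Id M V) =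
      exch X Y (Z \<otimes> V) \<cdot> (Id M X \<odot> assoc M Y Z V) \<cdot> assoc M X (Y \<otimes> Z) V"
proof -
  have "(Id M Y \<odot> assoc M X Z V) \<cdot> assoc M Y (X \<otimes> Z) V \<cdot> (exch X Y Z \<odot> Id M V) =
      (Id M Y \<odot> assoc M X Z V) \<cdot> assoc M Y (X \<otimes> Z) V \<cdot> (assoc M Y X Z \<odot> Id M V) \<cdot>
      (((braid M X Y \<odot> Id M Z) \<odot> Id M V) \<cdot> (ainv X Y Z \<odot> Id M V))"
    using assms by (simp add: exch_def)
  also have "\<dots> = assoc M Y X (Z \<otimes> V) \<cdot> assoc M (Y \<otimes> X) Z V \<cdot>
      (((braid M X Y \<odot> Id M Z) \<odot> Id M V) \<cdot> (ainv X Y Z \<odot> Id M V))"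
    using assms by (simp only: pentagon)
  also have "\<dots> = assoc M Y X (Z \<otimes> V) \<cdot> ((braid M X Y \<odot> Id M (Z \<otimes> V)) \<cdot>
      assoc M (X \<otimes> Y) Z V) \<cdot> (ainv X Y Z \<odot> Id M V)"
    using assms by (simp add: comp_tail[OF assoc_natural_id(2)] del: interchange interchange_tail)
  also have "\<dots> = exch X Y (Z \<otimes> V) \<cdot> (Id M X \<odot> assoc M Y Z V) \<cdot> assoc M X (Y \<otimes> Z) V"
    using assms by (simp add: exch_def comp_tail[OF pentagon_inv])
  finally show ?thesis .
qed

text \<open>This is \<open>exch_assoc\<close> with the associators moved across; it is the coherence
  behind the commutation of \<open>lam\<close> with \<open>rho\<close>.\<close>

lemma exch_ainv:
  assumes "X \<in> Obj M" "Y \<in> Obj M" "Z \<in> Obj M" "V \<in> Obj M"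
  shows "exch Z (X \<otimes> Y) V \<cdot> (Id M Z \<odot> ainv X Y V) \<cdot> exch X Z (Y \<otimes> V) =
    ainv X Y (Z \<otimes> V) \<cdot> (Id M X \<odot> exch Z Y V)"
proof (rule iso_cancel_left[of "assoc M X Y (Z \<otimes> V)"])
  show "assoc M X Y (Z \<otimes> V) \<cdot> (exch Z (X \<otimes> Y) V \<cdot> (Id M Z \<odot> ainv X Y V) \<cdot> exch X Z (Y \<otimes> V)) =
      assoc M X Y (Z \<otimes> V) \<cdot> (ainv X Y (Z \<otimes> V) \<cdot> (Id M X \<odot> exch Z Y V))"
    using assms by (simp add: comp_tail[OF exch_assoc])
qed (use assms in \<open>simp_all add: assoc_iso\<close>)

lemma exch_lunit:
  assumes "X \<in> Obj M" "Z \<in> Obj M"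
  shows "(Id M X \<odot> lunit M Z) \<cdot> exch (unit M) X Z = lunit M (X \<otimes> Z)"
proof -
  have "(Id M X \<odot> lunit M Z) \<cdot> exch (unit M) X Z \<cdot> (exch X (unit M) Z \<cdot> (Id M X \<odot> linv Z)) \<cdot> lunit M (X \<otimes> Z) =
      (Id M X \<odot> lunit M Z) \<cdot> (Id M X \<odot> linv Z) \<cdot> lunit M (X \<otimes> Z)"
    using assms by simp
  then show ?thesis
    using assms by (simp add: exch_unit)
qed

section \<open>Commutative monoids and their actions\<close>

lemma comm_monoid_arr:
  assumes "comm_monoid_in M A"
  shows "Car A \<in> Obj M" "mul A \<in> Arr M" "Dom M (mul A) = Car A \<otimes> Car A" "Cod M (mul A) = Car A"
    "one A \<in> Arr M" "Dom M (one A) = unit M" "Cod M (one A) = Car A"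
  using assms by (auto simp: comm_monoid_in_def in_hom_iff)

text \<open>Equations between actions are stated on generalised elements \<open>f\<close>, \<open>g\<close>, \<open>z\<close> of the factors, so that
  they apply without separate naturality steps.\<close>

definition action :: "('o, 'm, 'x) mon_scheme \<Rightarrow> 'o \<Rightarrow> 'm \<Rightarrow> bool" where
  "action A N \<kappa> \<longleftrightarrow> \<kappa> \<in> hom M (Car A \<otimes> N) N \<and> \<kappa> \<cdot> (one A \<odot> Id M N) = lunit M N \<and>
     \<kappa> \<cdot> (mul A \<odot> Id M N) = \<kappa> \<cdot> (Id M (Car A) \<odot> \<kappa>) \<cdot> assoc M (Car A) (Car A) N"

lemma actionD:
  assumes "action A N \<kappa>"
  shows "\<kappa> \<in> Arr M" "Dom M \<kappa> = Car A \<otimes> N" "Cod M \<kappa> = N" "N \<in> Obj M"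
  using assms cod_obj[of \<kappa>] by (auto simp: action_def in_hom_iff)

lemma action_one:
  assumes "action A N \<kappa>" "comm_monoid_in M A" "z \<in> Arr M" "Cod M z = N"
  shows "\<kappa> \<cdot> (one A \<odot> z) = z \<cdot> lunit M (Dom M z)"
proof -
  note [simp] = actionD[OF assms(1)] comm_monoid_arr[OF assms(2)]
  have "\<kappa> \<cdot> (one A \<odot> z) = \<kappa> \<cdot> (one A \<odot> Id M N) \<cdot> (Id M (unit M) \<odot> z)"
    using assms by simp
  also have "\<dots> = z \<cdot> lunit M (Dom M z)"
    using assms(1) lunit_natural[of z N] assms(3,4) by (simp add: action_def)
  finally show ?thesis .
qed

lemma action_mul:
  assumes "action A N \<kappa>" "comm_monoid_in M A"
    and "f \<in> Arr M" "Cod M f = Car A" "g \<in> Arr M" "Cod M g = Car A" "z \<in> Arr M" "Cod M z = N"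
  shows "\<kappa> \<cdot> ((mul A \<cdot> (f \<odot> g)) \<odot> z) = \<kappa> \<cdot> (f \<odot> (\<kappa> \<cdot> (g \<odot> z))) \<cdot> assoc M (Dom M f) (Dom M g) (Dom M z)"
proof -
  note [simp] = actionD[OF assms(1)] comm_monoid_arr[OF assms(2)]
  have "\<kappa> \<cdot> ((mul A \<cdot> (f \<odot> g)) \<odot> z) = \<kappa> \<cdot> (mul A \<odot> Id M N) \<cdot> ((f \<odot> g) \<odot> z)"
    using assms by simp
  also have "\<dots> = \<kappa> \<cdot> (Id M (Car A) \<odot> \<kappa>) \<cdot> assoc M (Car A) (Car A) N \<cdot> ((f \<odot> g) \<odot> z)"
    using assms(1) by (simp add: action_def)
  also have "\<dots> = \<kappa> \<cdot> (f \<odot> (\<kappa> \<cdot> (g \<odot> z))) \<cdot> assoc M (Dom M f) (Dom M g) (Dom M z)"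
    using assms by (simp add: assoc_natural)
  finally show ?thesis .
qed

lemma action_mul':
  assumes "action A N \<kappa>" "comm_monoid_in M A"
    and "f \<in> Arr M" "Cod M f = Car A" "g \<in> Arr M" "Cod M g = Car A" "z \<in> Arr M" "Cod M z = N"
  shows "\<kappa> \<cdot> (f \<odot> (\<kappa> \<cdot> (g \<odot> z))) = \<kappa> \<cdot> ((mul A \<cdot> (f \<odot> g)) \<odot> z) \<cdot> ainv (Dom M f) (Dom M g) (Dom M z)"
proof -
  note [simp] = actionD[OF assms(1)] comm_monoid_arr[OF assms(2)]
  show ?thesis using assms action_mul[OF assms] by simp
qed

lemma action_self: "comm_monoid_in M A \<Longrightarrow> action A (Car A) (mul A)"
  by (auto simp: comm_monoid_in_def action_def)

lemma mul_one:
  assumes "comm_monoid_in M A" "f \<in> Arr M" "Cod M f = Car A"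
  shows "mul A \<cdot> (f \<odot> one A) = f \<cdot> runit M (Dom M f)"
proof -
  note [simp] = comm_monoid_arr[OF assms(1)]
  have "mul A \<cdot> (f \<odot> one A) = mul A \<cdot> (Id M (Car A) \<odot> one A) \<cdot> (f \<odot> Id M (unit M))"
    using assms by simp
  also have "\<dots> = f \<cdot> runit M (Dom M f)"
    using assms runit_natural[of f "Car A"] by (simp add: comm_monoid_in_def)
  finally show ?thesis .
qed

lemma mul_commute:
  assumes "comm_monoid_in M A" "f \<in> Arr M" "Cod M f = Car A" "g \<in> Arr M" "Cod M g = Car A"
  shows "mul A \<cdot> (f \<odot> g) = mul A \<cdot> (g \<odot> f) \<cdot> braid M (Dom M f) (Dom M g)"
proof -
  note [simp] = comm_monoid_arr[OF assms(1)]
  have "mul A \<cdot> (f \<odot> g) = mul A \<cdot> braid M (Car A) (Car A) \<cdot> (f \<odot> g)"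
    using assms by (simp add: comm_monoid_in_def)
  also have "\<dots> = mul A \<cdot> (g \<odot> f) \<cdot> braid M (Dom M f) (Dom M g)"
    using assms by (simp add: braid_natural)
  finally show ?thesis .
qed

text \<open>Stated for bare maps into N, so that one notion covers two different actions, an action
  paired with itself, and the map \<open>\<kappa>\<close> of \<open>ten_commuting\<close>.\<close>

definition commuting :: "'o \<Rightarrow> 'o \<Rightarrow> 'o \<Rightarrow> 'm \<Rightarrow> 'm \<Rightarrow> bool" where
  "commuting X Y N \<kappa> \<kappa>' \<longleftrightarrow> X \<in> Obj M \<and> Y \<in> Obj M \<and> \<kappa> \<in> hom M (X \<otimes> N) N \<and> \<kappa>' \<in> hom M (Y \<otimes> N) N \<and>
     \<kappa> \<cdot> (Id M X \<odot> \<kappa>') = \<kappa>' \<cdot> (Id M Y \<odot> \<kappa>) \<cdot> exch X Y N"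

lemma commutingD:
  assumes "commuting X Y N \<kappa> \<kappa>'"
    and "f \<in> Arr M" "Cod M f = X" "g \<in> Arr M" "Cod M g = Y" "z \<in> Arr M" "Cod M z = N"
  shows "\<kappa> \<cdot> (f \<odot> (\<kappa>' \<cdot> (g \<odot> z))) = \<kappa>' \<cdot> (g \<odot> (\<kappa> \<cdot> (f \<odot> z))) \<cdot> exch (Dom M f) (Dom M g) (Dom M z)"
proof -
  have [simp]: "\<kappa> \<in> Arr M" "Dom M \<kappa> = X \<otimes> N" "Cod M \<kappa> = N" "\<kappa>' \<in> Arr M" "Dom M \<kappa>' = Y \<otimes> N" "Cod M \<kappa>' = N"
    "N \<in> Obj M" "X \<in> Obj M" "Y \<in> Obj M"
    using assms(1) cod_obj[of \<kappa>] by (auto simp: commuting_def in_hom_iff)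
  have "\<kappa> \<cdot> (f \<odot> (\<kappa>' \<cdot> (g \<odot> z))) = \<kappa> \<cdot> (Id M X \<odot> \<kappa>') \<cdot> (f \<odot> (g \<odot> z))"
    using assms(2-) by simp
  also have "\<dots> = \<kappa>' \<cdot> (Id M Y \<odot> \<kappa>) \<cdot> exch X Y N \<cdot> (f \<odot> (g \<odot> z))"
    using assms(1) by (simp add: commuting_def)
  also have "\<dots> = \<kappa>' \<cdot> (g \<odot> (\<kappa> \<cdot> (f \<odot> z))) \<cdot> exch (Dom M f) (Dom M g) (Dom M z)"
    using assms(2-) by (simp add: exch_natural)
  finally show ?thesis .
qed

lemma commuting_sym:
  assumes "commuting X Y N \<kappa> \<kappa>'"
  shows "commuting Y X N \<kappa>' \<kappa>"
proof -
  have [simp]: "\<kappa> \<in> Arr M" "Dom M \<kappa> = X \<otimes> N" "Cod M \<kappa> = N" "\<kappa>' \<in> Arr M" "Dom M \<kappa>' = Y \<otimes> N" "Cod M \<kappa>' = N"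
    "N \<in> Obj M" "X \<in> Obj M" "Y \<in> Obj M"
    using assms(1) cod_obj[of \<kappa>] by (auto simp: commuting_def in_hom_iff)
  have "\<kappa> \<cdot> (Id M X \<odot> \<kappa>') \<cdot> exch Y X N = \<kappa>' \<cdot> (Id M Y \<odot> \<kappa>) \<cdot> exch X Y N \<cdot> exch Y X N"
    using assms by (simp add: commuting_def)
  then show ?thesis
    using assms by (simp add: commuting_def)
qed

text \<open>On elements, x (y n) = (x y) n = (y x) n = y (x n).\<close>

lemma commuting_self:
  assumes "action A N \<kappa>" "comm_monoid_in M A"
  shows "commuting (Car A) (Car A) N \<kappa> \<kappa>"
proof -
  note [simp] = actionD[OF assms(1)] comm_monoid_arr[OF assms(2)]
  let ?A = "Car A"
  have "\<kappa> \<cdot> (Id M ?A \<odot> \<kappa>) = \<kappa> \<cdot> ((mul A \<cdot> (Id M ?A \<odot> Id M ?A)) \<odot> Id M N) \<cdot> ainv ?A ?A N"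
    using action_mul'[OF assms, of "Id M ?A" "Id M ?A" "Id M N"] by simp
  also have "\<dots> = \<kappa> \<cdot> ((mul A \<cdot> (Id M ?A \<odot> Id M ?A)) \<odot> Id M N) \<cdot> (braid M ?A ?A \<odot> Id M N) \<cdot> ainv ?A ?A N"
    using mul_commute[OF assms(2), of "Id M ?A" "Id M ?A"] by simp
  also have "\<dots> = \<kappa> \<cdot> (Id M ?A \<odot> \<kappa>) \<cdot> exch ?A ?A N"
    using action_mul[OF assms, of "Id M ?A" "Id M ?A" "Id M N"] by (simp add: exch_def)
  finally show ?thesis
    by (simp add: commuting_def in_hom_iff)
qed

end

section \<open>Tensoring preserves coequalizers\<close>

locale closed_symmetric_monoidal_category = symmetric_monoidal_category +
  assumes closed: "closed_smcat M"
begin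

text \<open>Closedness makes tensoring with X on the right a left adjoint.\<close>

lemma tensor_right_coequalizer:
  assumes "coequalizer M u v p" "X \<in> Obj M"
  shows "coequalizer M (u \<odot> Id M X) (v \<odot> Id M X) (p \<odot> Id M X)"
proof -
  obtain G \<phi> where "adjunction M M (tensor_right M X) G \<phi>"
    using closed assms(2) unfolding closed_smcat_def by blast
  then interpret adjoint_functors M M "tensor_right M X" G \<phi>
    by unfold_locales
  show ?thesis
    using left_adjoint_preserves_coequalizer[OF assms(1)] by (simp add: tensor_right_def)
qed

text \<open>Obtained from \<open>tensor_right_coequalizer\<close> by conjugating with the
  braiding.\<close>

lemma tensor_left_coequalizer:
  assumes coeq: "coequalizer M u v p" and X: "X \<in> Obj M"
  shows "coequalizer M (Id M X \<odot> u) (Id M X \<odot> v) (Id M X \<odot> p)"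
proof -
  have [simp]: "u \<in> Arr M" "v \<in> Arr M" "Dom M v = Dom M u" "Cod M v = Cod M u" "p \<in> Arr M" "Dom M p = Cod M u"
    and fork: "p \<cdot> u = p \<cdot> v"
    using coeq by (auto simp: coequalizer_def in_hom_iff)
  note coeq' = tensor_right_coequalizer[OF assms]
  note [simp] = X
  have "\<exists>!k. k \<in> hom M (X \<otimes> Cod M p) (Cod M q) \<and> k \<cdot> (Id M X \<odot> p) = q"
    if q [simp]: "q \<in> Arr M" "Dom M q = X \<otimes> Cod M u" and eq: "q \<cdot> (Id M X \<odot> u) = q \<cdot> (Id M X \<odot> v)" for q
  proof -
    have "q \<cdot> braid M (Cod M u) X \<cdot> (u \<odot> Id M X) = q \<cdot> (Id M X \<odot> u) \<cdot> braid M (Dom M u) X"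
      by (simp add: braid_natural)
    also have "\<dots> = q \<cdot> (Id M X \<odot> v) \<cdot> braid M (Dom M u) X"
      by (simp only: eq)
    also have "\<dots> = q \<cdot> braid M (Cod M u) X \<cdot> (v \<odot> Id M X)"
      by (simp add: braid_natural)
    finally obtain k where [simp]: "k \<in> Arr M" "Dom M k = Cod M p \<otimes> X" "Cod M k = Cod M q"
      and k: "k \<cdot> (p \<odot> Id M X) = q \<cdot> braid M (Cod M u) X"
      using coequalizer_factor[OF coeq', of "q \<cdot> braid M (Cod M u) X"] by auto
    have *: "k \<cdot> braid M X (Cod M p) \<cdot> (Id M X \<odot> p) = q"
      by (simp add: braid_natural comp_tail[OF k])
    show ?thesis
    proof (rule ex1I[of _ "k \<cdot> braid M X (Cod M p)"])
      fix k' assume k': "k' \<in> hom M (X \<otimes> Cod M p) (Cod M q) \<and> k' \<cdot> (Id M X \<odot> p) = q"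
      then have [simp]: "k' \<in> Arr M" "Dom M k' = X \<otimes> Cod M p" "Cod M k' = Cod M q"
        by (auto simp: in_hom_iff)
      have "k' \<cdot> braid M (Cod M p) X = k"
      proof (rule coequalizer_epi[OF coeq' category_axioms])
        have "k' \<cdot> braid M (Cod M p) X \<cdot> (p \<odot> Id M X) = k' \<cdot> (Id M X \<odot> p) \<cdot> braid M (Cod M u) X"
          by (simp add: braid_natural)
        also have "\<dots> = k \<cdot> (p \<odot> Id M X)"
          using k' k by simp
        finally show "k' \<cdot> braid M (Cod M p) X \<cdot> (p \<odot> Id M X) = k \<cdot> (p \<odot> Id M X)" .
      qed simp_all
      then show "k' = k \<cdot> braid M X (Cod M p)" by auto
    qed (use * in \<open>simp add: in_hom_iff\<close>)
  qed
  then show ?thesis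
    unfolding coequalizer_def by (simp add: in_hom_iff fork)
qed

end

section \<open>Relative tensor products of commutative monoids\<close>

text \<open>Only the coequalizer \<open>p : A \<otimes> B \<rightarrow> P\<close> is used here, so \<open>R\<close> enters as a mere object with two
  arrows \<open>a\<close> and \<open>b\<close>.\<close>

locale relative_tensor = closed_symmetric_monoidal_category M
  for M :: "('o, 'm, 'z) smcat_scheme" (structure) +
  fixes R :: 'o and A :: "('o, 'm, 'x) mon_scheme" and B :: "('o, 'm, 'y) mon_scheme"
    and a b p :: 'm
  assumes A: "comm_monoid_in M A" and B: "comm_monoid_in M B"
    and a: "a \<in> hom M R (Car A)" and b: "b \<in> hom M R (Car B)"
    and coeq: "coequalizer M ((mul A \<cdot> (Id M (Car A) \<odot> a)) \<odot> Id M (Car B))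
      ((Id M (Car A) \<odot> (mul B \<cdot> (b \<odot> Id M (Car B)))) \<cdot> assoc M (Car A) R (Car B)) p"
begin

abbreviation "A' \<equiv> Car A"
abbreviation "B' \<equiv> Car B"
abbreviation "P \<equiv> Cod M p"
abbreviation "I \<equiv> unit M"

lemmas A_arr [simp] = comm_monoid_arr[OF A]
lemmas B_arr [simp] = comm_monoid_arr[OF B]

lemma ab_arr [simp]: "a \<in> Arr M" "Dom M a = R" "Cod M a = A'" "b \<in> Arr M" "Dom M b = R" "Cod M b = B'"
  using a b by (auto simp: in_hom_iff)

lemma R_obj [simp]: "R \<in> Obj M"
  using dom_obj[of a] by simp

lemma p_arr [simp]: "p \<in> Arr M" "Dom M p = A' \<otimes> B'"
  using coeq by (auto simp: coequalizer_def)

lemma P_obj [simp]: "P \<in> Obj M"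
  by simp

text \<open>The relation x r \<otimes> y = x \<otimes> r y imposed by the coequalizer, with x, r, y
  generalised elements so that naturality is already built in.\<close>

lemma fork:
  assumes [simp]: "f \<in> Arr M" "Cod M f = A'" "r \<in> Arr M" "Cod M r = R" "z \<in> Arr M" "Cod M z = B'"
  shows "p \<cdot> ((mul A \<cdot> (f \<odot> (a \<cdot> r))) \<odot> z) =
    p \<cdot> (f \<odot> (mul B \<cdot> ((b \<cdot> r) \<odot> z))) \<cdot> assoc M (Dom M f) (Dom M r) (Dom M z)"
proof -
  have "p \<cdot> ((mul A \<cdot> (f \<odot> (a \<cdot> r))) \<odot> z) =
      p \<cdot> ((mul A \<cdot> (Id M A' \<odot> a)) \<odot> Id M B') \<cdot> ((f \<odot> r) \<odot> z)"
    by simp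
  also have "\<dots> = p \<cdot> ((Id M A' \<odot> (mul B \<cdot> (b \<odot> Id M B'))) \<cdot> assoc M A' R B') \<cdot> ((f \<odot> r) \<odot> z)"
    using coeq by (simp add: coequalizer_def)
  also have "\<dots> = p \<cdot> (f \<odot> (mul B \<cdot> ((b \<cdot> r) \<odot> z))) \<cdot> assoc M (Dom M f) (Dom M r) (Dom M z)"
    by (simp add: assoc_natural)
  finally show ?thesis .
qed

lemma fork_id:
  assumes "f \<in> Arr M" "Cod M f = A'" "z \<in> Arr M" "Cod M z = B'"
  shows "p \<cdot> ((mul A \<cdot> (f \<odot> a)) \<odot> z) = p \<cdot> (f \<odot> (mul B \<cdot> (b \<odot> z))) \<cdot> assoc M (Dom M f) R (Dom M z)"
  using fork[of f "Id M R" z] assms by simp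

lemmas p_epi = coequalizer_epi[OF _ category_axioms]

text \<open>Tensored coequalizers are coequalizers, hence epimorphisms. There is one version for
  each position in which \<open>p\<close> occurs below.\<close>

lemma p_epi_left:
  assumes "k \<cdot> (Id M X \<odot> p) = k' \<cdot> (Id M X \<odot> p)" "X \<in> Obj M"
    and "k \<in> Arr M" "k' \<in> Arr M" "Dom M k = X \<otimes> P" "Dom M k' = X \<otimes> P"
  shows "k = k'"
  by (rule p_epi[OF tensor_left_coequalizer[OF coeq] assms(1)]) (use assms in simp_all)

lemma p_epi_left2:
  assumes "k \<cdot> (Id M X \<odot> Id M Y \<odot> p) = k' \<cdot> (Id M X \<odot> Id M Y \<odot> p)" "X \<in> Obj M" "Y \<in> Obj M"
    and "k \<in> Arr M" "k' \<in> Arr M" "Dom M k = X \<otimes> Y \<otimes> P" "Dom M k' = X \<otimes> Y \<otimes> P"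
  shows "k = k'"
  by (rule p_epi[OF tensor_left_coequalizer[OF tensor_left_coequalizer[OF coeq]] assms(1)]) (use assms in simp_all)

lemma p_epi_right:
  assumes "k \<cdot> (p \<odot> Id M X) = k' \<cdot> (p \<odot> Id M X)" "X \<in> Obj M"
    and "k \<in> Arr M" "k' \<in> Arr M" "Dom M k = P \<otimes> X" "Dom M k' = P \<otimes> X"
  shows "k = k'"
  by (rule p_epi[OF tensor_right_coequalizer[OF coeq] assms(1)]) (use assms in simp_all)

lemma p_epi_mid:
  assumes "k \<cdot> ((Id M X \<odot> p) \<odot> Id M Y) = k' \<cdot> ((Id M X \<odot> p) \<odot> Id M Y)" "X \<in> Obj M" "Y \<in> Obj M"
    and "k \<in> Arr M" "k' \<in> Arr M" "Dom M k = (X \<otimes> P) \<otimes> Y" "Dom M k' = (X \<otimes> P) \<otimes> Y"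
  shows "k = k'"
  by (rule p_epi[OF tensor_right_coequalizer[OF tensor_left_coequalizer[OF coeq]] assms(1)]) (use assms in simp_all)

subsection \<open>The actions of \<open>A\<close> and \<open>B\<close>\<close>

text \<open>On elements, x' (x \<otimes> y) = x' x \<otimes> y. The description is proper since
  \<open>A' \<otimes> p\<close> is a coequalizer: \<open>lam_ex\<close> gives existence and
  \<open>p_epi_left\<close> uniqueness.\<close>

definition lam :: 'm where
  "lam = (THE l. l \<in> hom M (A' \<otimes> P) P \<and> l \<cdot> (Id M A' \<odot> p) = p \<cdot> (mul A \<odot> Id M B') \<cdot> ainv A' A' B')"

text \<open>On elements, y' (x \<otimes> y) = x \<otimes> y' y; the exchange carries y' past x.
  Taking B to act from the left puts both actions on the same side.\<close>

definition rho :: 'm where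
  "rho = (THE l. l \<in> hom M (B' \<otimes> P) P \<and> l \<cdot> (Id M B' \<odot> p) = p \<cdot> (Id M A' \<odot> mul B) \<cdot> exch B' A' B')"

text \<open>x' (x r) \<otimes> y = (x' x) r \<otimes> y = x' x \<otimes> r y, by associativity in A
  and then the coequalizer relation.\<close>

lemma lam_ex: "\<exists>l. l \<in> hom M (A' \<otimes> P) P \<and> l \<cdot> (Id M A' \<odot> p) = p \<cdot> (mul A \<odot> Id M B') \<cdot> ainv A' A' B'"
proof -
  let ?q = "p \<cdot> (mul A \<odot> Id M B') \<cdot> ainv A' A' B'"
  have "?q \<cdot> (Id M A' \<odot> ((mul A \<cdot> (Id M A' \<odot> a)) \<odot> Id M B')) =
      p \<cdot> ((mul A \<cdot> (Id M A' \<odot> (mul A \<cdot> (Id M A' \<odot> a)))) \<odot> Id M B') \<cdot> ainv A' (A' \<otimes> R) B'"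
    by (simp add: ainv_natural)
  also have "\<dots> = p \<cdot> ((mul A \<cdot> (mul A \<odot> a)) \<odot> Id M B') \<cdot> ((ainv A' A' R \<odot> Id M B') \<cdot> ainv A' (A' \<otimes> R) B')"
    using action_mul'[OF action_self[OF A] A, of "Id M A'" "Id M A'" a] by simp
  also have "\<dots> = p \<cdot> (mul A \<odot> (mul B \<cdot> (b \<odot> Id M B'))) \<cdot> (assoc M (A' \<otimes> A') R B' \<cdot> (ainv A' A' R \<odot> Id M B') \<cdot> ainv A' (A' \<otimes> R) B')"
    by (simp add: comp_tail[OF fork_id] del: interchange interchange_tail)
  also have "\<dots> = p \<cdot> (mul A \<odot> (mul B \<cdot> (b \<odot> Id M B'))) \<cdot> (ainv A' A' (R \<otimes> B') \<cdot> (Id M A' \<odot> assoc M A' R B'))"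
    by (simp only: pentagon_inv A_arr B_arr R_obj)
  also have "\<dots> = p \<cdot> (mul A \<odot> Id M B') \<cdot> ((Id M (A' \<otimes> A') \<odot> (mul B \<cdot> (b \<odot> Id M B'))) \<cdot> ainv A' A' (R \<otimes> B')) \<cdot>
      (Id M A' \<odot> assoc M A' R B')"
    by simp
  also have "\<dots> = p \<cdot> (mul A \<odot> Id M B') \<cdot> (ainv A' A' B' \<cdot> (Id M A' \<odot> Id M A' \<odot> (mul B \<cdot> (b \<odot> Id M B')))) \<cdot>
      (Id M A' \<odot> assoc M A' R B')"
    by (simp add: assoc_natural_id)
  also have "\<dots> = ?q \<cdot> (Id M A' \<odot> ((Id M A' \<odot> (mul B \<cdot> (b \<odot> Id M B'))) \<cdot> assoc M A' R B'))"
    by simp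
  finally have "?q \<cdot> (Id M A' \<odot> ((mul A \<cdot> (Id M A' \<odot> a)) \<odot> Id M B')) =
      ?q \<cdot> (Id M A' \<odot> ((Id M A' \<odot> (mul B \<cdot> (b \<odot> Id M B'))) \<cdot> assoc M A' R B'))" .
  note eq = this
  obtain k where "k \<in> Arr M" "Dom M k = Cod M (Id M A' \<odot> p)" "Cod M k = Cod M ?q" "k \<cdot> (Id M A' \<odot> p) = ?q"
    by (rule coequalizer_factor[OF tensor_left_coequalizer[OF coeq A_arr(1)] _ _ eq]) simp_all
  then show ?thesis
    by (auto simp: in_hom_iff)
qed

text \<open>x r \<otimes> y' y = x \<otimes> r (y' y) = x \<otimes> y' (r y). The last equality uses
  commutativity of B, through \<open>commuting_self\<close>.\<close>

lemma rho_ex: "\<exists>l. l \<in> hom M (B' \<otimes> P) P \<and> l \<cdot> (Id M B' \<odot> p) = p \<cdot> (Id M A' \<odot> mul B) \<cdot> exch B' A' B'"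
proof -
  let ?q = "p \<cdot> (Id M A' \<odot> mul B) \<cdot> exch B' A' B'"
  have "?q \<cdot> (Id M B' \<odot> ((mul A \<cdot> (Id M A' \<odot> a)) \<odot> Id M B')) =
      p \<cdot> ((mul A \<cdot> (Id M A' \<odot> a)) \<odot> mul B) \<cdot> exch B' (A' \<otimes> R) B'"
    by (simp add: exch_natural)
  also have "\<dots> = p \<cdot> (Id M A' \<odot> (mul B \<cdot> (b \<odot> mul B))) \<cdot> assoc M A' R (B' \<otimes> B') \<cdot> exch B' (A' \<otimes> R) B'"
    by (simp add: comp_tail[OF fork_id] del: interchange interchange_tail)
  also have "\<dots> = p \<cdot> (Id M A' \<odot> (mul B \<cdot> (b \<odot> mul B))) \<cdot>
      ((Id M A' \<odot> exch B' R B') \<cdot> exch B' A' (R \<otimes> B') \<cdot> (Id M B' \<odot> assoc M A' R B'))"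
    by (simp add: exch_assoc)
  also have "\<dots> = p \<cdot> (Id M A' \<odot> (mul B \<cdot> (Id M B' \<odot> (mul B \<cdot> (b \<odot> Id M B'))))) \<cdot>
      exch B' A' (R \<otimes> B') \<cdot> (Id M B' \<odot> assoc M A' R B')"
    using commutingD[OF commuting_self[OF action_self[OF B] B], of "Id M B'" b "Id M B'"] by simp
  also have "\<dots> = p \<cdot> (Id M A' \<odot> mul B) \<cdot> ((Id M A' \<odot> Id M B' \<odot> (mul B \<cdot> (b \<odot> Id M B'))) \<cdot> exch B' A' (R \<otimes> B')) \<cdot>
      (Id M B' \<odot> assoc M A' R B')"
    by simp
  also have "\<dots> = p \<cdot> (Id M A' \<odot> mul B) \<cdot> (exch B' A' B' \<cdot> (Id M B' \<odot> Id M A' \<odot> (mul B \<cdot> (b \<odot> Id M B')))) \<cdot>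
      (Id M B' \<odot> assoc M A' R B')"
    by (simp add: exch_natural del: tensor_id)
  also have "\<dots> = ?q \<cdot> (Id M B' \<odot> ((Id M A' \<odot> (mul B \<cdot> (b \<odot> Id M B'))) \<cdot> assoc M A' R B'))"
    by simp
  finally have "?q \<cdot> (Id M B' \<odot> ((mul A \<cdot> (Id M A' \<odot> a)) \<odot> Id M B')) =
      ?q \<cdot> (Id M B' \<odot> ((Id M A' \<odot> (mul B \<cdot> (b \<odot> Id M B'))) \<cdot> assoc M A' R B'))" .
  note eq = this
  obtain k where "k \<in> Arr M" "Dom M k = Cod M (Id M B' \<odot> p)" "Cod M k = Cod M ?q" "k \<cdot> (Id M B' \<odot> p) = ?q"
    by (rule coequalizer_factor[OF tensor_left_coequalizer[OF coeq B_arr(1)] _ _ eq]) simp_all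
  then show ?thesis
    by (auto simp: in_hom_iff)
qed

lemma lam_props: "lam \<in> hom M (A' \<otimes> P) P \<and> lam \<cdot> (Id M A' \<odot> p) = p \<cdot> (mul A \<odot> Id M B') \<cdot> ainv A' A' B'"
  unfolding lam_def
proof (rule theI')
  show "\<exists>!l. l \<in> hom M (A' \<otimes> P) P \<and> l \<cdot> (Id M A' \<odot> p) = p \<cdot> (mul A \<odot> Id M B') \<cdot> ainv A' A' B'" (is "\<exists>!l. _ \<and> _ = ?q")
  proof (rule ex_ex1I[OF lam_ex])
    fix l l'
    assume "l \<in> hom M (A' \<otimes> P) P \<and> l \<cdot> (Id M A' \<odot> p) = ?q" "l' \<in> hom M (A' \<otimes> P) P \<and> l' \<cdot> (Id M A' \<odot> p) = ?q"
    then show "l = l'"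
      by (intro p_epi_left[of l A' l']) (simp_all add: in_hom_iff)
  qed
qed

lemma rho_props: "rho \<in> hom M (B' \<otimes> P) P \<and> rho \<cdot> (Id M B' \<odot> p) = p \<cdot> (Id M A' \<odot> mul B) \<cdot> exch B' A' B'"
  unfolding rho_def
proof (rule theI')
  show "\<exists>!l. l \<in> hom M (B' \<otimes> P) P \<and> l \<cdot> (Id M B' \<odot> p) = p \<cdot> (Id M A' \<odot> mul B) \<cdot> exch B' A' B'" (is "\<exists>!l. _ \<and> _ = ?q")
  proof (rule ex_ex1I[OF rho_ex])
    fix l l'
    assume "l \<in> hom M (B' \<otimes> P) P \<and> l \<cdot> (Id M B' \<odot> p) = ?q" "l' \<in> hom M (B' \<otimes> P) P \<and> l' \<cdot> (Id M B' \<odot> p) = ?q"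
    then show "l = l'"
      by (intro p_epi_left[of l B' l']) (simp_all add: in_hom_iff)
  qed
qed

lemma lam_rho_arr [simp]: "lam \<in> Arr M" "Dom M lam = A' \<otimes> P" "Cod M lam = P"
  "rho \<in> Arr M" "Dom M rho = B' \<otimes> P" "Cod M rho = P"
  using lam_props rho_props by (auto simp: in_hom_iff)

lemma lam_p:
  assumes [simp]: "f \<in> Arr M" "Cod M f = A'" "g \<in> Arr M" "Cod M g = A'" "z \<in> Arr M" "Cod M z = B'"
  shows "lam \<cdot> (f \<odot> (p \<cdot> (g \<odot> z))) = p \<cdot> ((mul A \<cdot> (f \<odot> g)) \<odot> z) \<cdot> ainv (Dom M f) (Dom M g) (Dom M z)"
proof -
  have "lam \<cdot> (f \<odot> (p \<cdot> (g \<odot> z))) = lam \<cdot> (Id M A' \<odot> p) \<cdot> (f \<odot> g \<odot> z)"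
    by simp
  also have "\<dots> = p \<cdot> ((mul A \<cdot> (f \<odot> g)) \<odot> z) \<cdot> ainv (Dom M f) (Dom M g) (Dom M z)"
    using lam_props by (simp add: ainv_natural)
  finally show ?thesis .
qed

lemma rho_p:
  assumes [simp]: "h \<in> Arr M" "Cod M h = B'" "g \<in> Arr M" "Cod M g = A'" "z \<in> Arr M" "Cod M z = B'"
  shows "rho \<cdot> (h \<odot> (p \<cdot> (g \<odot> z))) = p \<cdot> (g \<odot> (mul B \<cdot> (h \<odot> z))) \<cdot> exch (Dom M h) (Dom M g) (Dom M z)"
proof -
  have "rho \<cdot> (h \<odot> (p \<cdot> (g \<odot> z))) = rho \<cdot> (Id M B' \<odot> p) \<cdot> (h \<odot> g \<odot> z)"
    by simp
  also have "\<dots> = p \<cdot> (g \<odot> (mul B \<cdot> (h \<odot> z))) \<cdot> exch (Dom M h) (Dom M g) (Dom M z)"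
    using rho_props by (simp add: exch_natural)
  finally show ?thesis .
qed

lemma lam_p_id: "f \<in> Arr M \<Longrightarrow> Cod M f = A' \<Longrightarrow>
    lam \<cdot> (f \<odot> p) = p \<cdot> ((mul A \<cdot> (f \<odot> Id M A')) \<odot> Id M B') \<cdot> ainv (Dom M f) A' B'"
  and rho_p_id: "h \<in> Arr M \<Longrightarrow> Cod M h = B' \<Longrightarrow>
    rho \<cdot> (h \<odot> p) = p \<cdot> (Id M A' \<odot> (mul B \<cdot> (h \<odot> Id M B'))) \<cdot> exch (Dom M h) A' B'"
  using lam_p[of f "Id M A'" "Id M B'"] rho_p[of h "Id M A'" "Id M B'"] by simp_all

text \<open>The laws are inherited from the multiplication of A, because \<open>lam\<close>
  multiplies the first factor only; composing with \<open>p\<close> reduces them to A.\<close>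

lemma lam_action: "action A P lam"
proof -
  have "lam \<cdot> (one A \<odot> Id M P) = lunit M P"
  proof (rule p_epi_left)
    have "lam \<cdot> (one A \<odot> Id M P) \<cdot> (Id M I \<odot> p) = p \<cdot> (lunit M A' \<odot> Id M B') \<cdot> ainv I A' B'"
      using action_one[OF action_self[OF A] A, of "Id M A'"] by (simp add: lam_p_id)
    also have "\<dots> = lunit M P \<cdot> (Id M I \<odot> p)"
      using lunit_tensor[of A' B', symmetric] lunit_natural[of p P] by simp
    finally show "lam \<cdot> (one A \<odot> Id M P) \<cdot> (Id M I \<odot> p) = lunit M P \<cdot> (Id M I \<odot> p)" .
  qed simp_all
  moreover have "lam \<cdot> (mul A \<odot> Id M P) = lam \<cdot> (Id M A' \<odot> lam) \<cdot> assoc M A' A' P"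
  proof (rule p_epi_left)
    have "lam \<cdot> (mul A \<odot> Id M P) \<cdot> (Id M (A' \<otimes> A') \<odot> p) =
        p \<cdot> ((mul A \<cdot> (Id M A' \<odot> mul A)) \<odot> Id M B') \<cdot> ((assoc M A' A' A' \<odot> Id M B') \<cdot> ainv (A' \<otimes> A') A' B')"
      using action_mul[OF action_self[OF A] A, of "Id M A'" "Id M A'" "Id M A'"] by (simp add: lam_p_id)
    also have "\<dots> = p \<cdot> ((mul A \<cdot> (Id M A' \<odot> mul A)) \<odot> Id M B') \<cdot>
        (ainv A' (A' \<otimes> A') B' \<cdot> (Id M A' \<odot> ainv A' A' B') \<cdot> assoc M A' A' (A' \<otimes> B'))"
      by (simp only: pentagon_inv' A_arr B_arr)
    also have "\<dots> = lam \<cdot> (Id M A' \<odot> (p \<cdot> (mul A \<odot> Id M B'))) \<cdot> ((Id M A' \<odot> ainv A' A' B') \<cdot> assoc M A' A' (A' \<otimes> B'))"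
      by (simp add: lam_p)
    also have "\<dots> = lam \<cdot> (Id M A' \<odot> lam) \<cdot> assoc M A' A' P \<cdot> (Id M (A' \<otimes> A') \<odot> p)"
      by (simp add: lam_p_id assoc_natural_id)
    finally show "lam \<cdot> (mul A \<odot> Id M P) \<cdot> (Id M (A' \<otimes> A') \<odot> p) =
        lam \<cdot> (Id M A' \<odot> lam) \<cdot> assoc M A' A' P \<cdot> (Id M (A' \<otimes> A') \<odot> p)" .
  qed simp_all
  ultimately show ?thesis
    by (simp add: action_def in_hom_iff)
qed

lemma rho_action: "action B P rho"
proof -
  have "rho \<cdot> (one B \<odot> Id M P) = lunit M P"
  proof (rule p_epi_left)
    have "rho \<cdot> (one B \<odot> Id M P) \<cdot> (Id M I \<odot> p) = p \<cdot> (Id M A' \<odot> lunit M B') \<cdot> exch I A' B'"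
      using action_one[OF action_self[OF B] B, of "Id M B'"] by (simp add: rho_p_id)
    also have "\<dots> = lunit M P \<cdot> (Id M I \<odot> p)"
      using lunit_natural[of p P] by (simp add: exch_lunit)
    finally show "rho \<cdot> (one B \<odot> Id M P) \<cdot> (Id M I \<odot> p) = lunit M P \<cdot> (Id M I \<odot> p)" .
  qed simp_all
  moreover have "rho \<cdot> (mul B \<odot> Id M P) = rho \<cdot> (Id M B' \<odot> rho) \<cdot> assoc M B' B' P"
  proof (rule p_epi_left)
    have "rho \<cdot> (mul B \<odot> Id M P) \<cdot> (Id M (B' \<otimes> B') \<odot> p) =
        p \<cdot> (Id M A' \<odot> (mul B \<cdot> (Id M B' \<odot> mul B))) \<cdot> ((Id M A' \<odot> assoc M B' B' B') \<cdot> exch (B' \<otimes> B') A' B')"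
      using action_mul[OF action_self[OF B] B, of "Id M B'" "Id M B'" "Id M B'"] by (simp add: rho_p_id)
    also have "\<dots> = p \<cdot> (Id M A' \<odot> (mul B \<cdot> (Id M B' \<odot> mul B))) \<cdot>
        (exch B' A' (B' \<otimes> B') \<cdot> (Id M B' \<odot> exch B' A' B') \<cdot> assoc M B' B' (A' \<otimes> B'))"
      by (simp only: exch_assoc' A_arr B_arr)
    also have "\<dots> = rho \<cdot> (Id M B' \<odot> (p \<cdot> (Id M A' \<odot> mul B))) \<cdot> ((Id M B' \<odot> exch B' A' B') \<cdot> assoc M B' B' (A' \<otimes> B'))"
      by (simp add: rho_p)
    also have "\<dots> = rho \<cdot> (Id M B' \<odot> rho) \<cdot> assoc M B' B' P \<cdot> (Id M (B' \<otimes> B') \<odot> p)"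
      by (simp add: rho_p_id assoc_natural_id)
    finally show "rho \<cdot> (mul B \<odot> Id M P) \<cdot> (Id M (B' \<otimes> B') \<odot> p) =
        rho \<cdot> (Id M B' \<odot> rho) \<cdot> assoc M B' B' P \<cdot> (Id M (B' \<otimes> B') \<odot> p)" .
  qed simp_all
  ultimately show ?thesis
    by (simp add: action_def in_hom_iff)
qed

text \<open>The actions touch different factors of x \<otimes> y, so only coherence is left to
  check, and that is \<open>exch_ainv\<close>.\<close>

lemma lam_rho_commuting: "commuting A' B' P lam rho"
proof -
  have "lam \<cdot> (Id M A' \<odot> rho) = rho \<cdot> (Id M B' \<odot> lam) \<cdot> exch A' B' P"
  proof (rule p_epi_left2)
    have "lam \<cdot> (Id M A' \<odot> rho) \<cdot> (Id M A' \<odot> Id M B' \<odot> p) =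
        lam \<cdot> (Id M A' \<odot> (p \<cdot> (Id M A' \<odot> mul B))) \<cdot> (Id M A' \<odot> exch B' A' B')"
      by (simp add: rho_p_id)
    also have "\<dots> = p \<cdot> (mul A \<odot> mul B) \<cdot> (ainv A' A' (B' \<otimes> B') \<cdot> (Id M A' \<odot> exch B' A' B'))"
      by (simp add: lam_p)
    also have "\<dots> = p \<cdot> (mul A \<odot> mul B) \<cdot> (exch B' (A' \<otimes> A') B' \<cdot> (Id M B' \<odot> ainv A' A' B') \<cdot> exch A' B' (A' \<otimes> B'))"
      by (simp only: exch_ainv A_arr B_arr)
    also have "\<dots> = rho \<cdot> (Id M B' \<odot> (p \<cdot> (mul A \<odot> Id M B'))) \<cdot> ((Id M B' \<odot> ainv A' A' B') \<cdot> exch A' B' (A' \<otimes> B'))"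
      by (simp add: rho_p)
    also have "\<dots> = rho \<cdot> (Id M B' \<odot> lam) \<cdot> exch A' B' P \<cdot> (Id M A' \<odot> Id M B' \<odot> p)"
      by (simp add: lam_p_id exch_natural)
    finally show "lam \<cdot> (Id M A' \<odot> rho) \<cdot> (Id M A' \<odot> Id M B' \<odot> p) =
        rho \<cdot> (Id M B' \<odot> lam) \<cdot> exch A' B' P \<cdot> (Id M A' \<odot> Id M B' \<odot> p)" .
  qed simp_all
  then show ?thesis by (simp add: commuting_def in_hom_iff)
qed

text \<open>r x \<otimes> y = x r \<otimes> y = x \<otimes> r y, by commutativity of A and then the
  coequalizer relation.\<close>

lemma lam_a_eq_rho_b: "lam \<cdot> (a \<odot> Id M P) = rho \<cdot> (b \<odot> Id M P)"
proof (rule p_epi_left)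
  have "lam \<cdot> (a \<odot> Id M P) \<cdot> (Id M R \<odot> p) = p \<cdot> ((mul A \<cdot> (a \<odot> Id M A')) \<odot> Id M B') \<cdot> ainv R A' B'"
    by (simp add: lam_p_id)
  also have "\<dots> = p \<cdot> ((mul A \<cdot> (Id M A' \<odot> a)) \<odot> Id M B') \<cdot> ((braid M R A' \<odot> Id M B') \<cdot> ainv R A' B')"
    using mul_commute[OF A, of a "Id M A'"] by simp
  also have "\<dots> = p \<cdot> (Id M A' \<odot> (mul B \<cdot> (b \<odot> Id M B'))) \<cdot> exch R A' B'"
    by (simp add: comp_tail[OF fork_id] exch_def del: interchange interchange_tail)
  also have "\<dots> = rho \<cdot> (b \<odot> Id M P) \<cdot> (Id M R \<odot> p)"
    by (simp add: rho_p_id)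
  finally show "lam \<cdot> (a \<odot> Id M P) \<cdot> (Id M R \<odot> p) = rho \<cdot> (b \<odot> Id M P) \<cdot> (Id M R \<odot> p)" .
qed simp_all

lemma lam_a:
  assumes "r \<in> Arr M" "Cod M r = R" "z \<in> Arr M" "Cod M z = P"
  shows "lam \<cdot> ((a \<cdot> r) \<odot> z) = rho \<cdot> ((b \<cdot> r) \<odot> z)"
proof -
  have "lam \<cdot> ((a \<cdot> r) \<odot> z) = lam \<cdot> (a \<odot> Id M P) \<cdot> (r \<odot> z)"
    using assms by simp
  also have "\<dots> = rho \<cdot> (b \<odot> Id M P) \<cdot> (r \<odot> z)"
    by (simp only: lam_a_eq_rho_b)
  finally show ?thesis using assms by simp
qed


subsection \<open>The multiplication\<close>

text \<open>On elements, (x \<otimes> y) w = x (y w): only the first argument is resolved through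
  \<open>p\<close>, while the second stays an element of P acted on by A and B.\<close>

definition ten :: 'm where
  "ten = (THE m. m \<in> hom M (P \<otimes> P) P \<and>
     m \<cdot> (p \<odot> Id M P) = lam \<cdot> (Id M A' \<odot> rho) \<cdot> assoc M A' B' P)"

text \<open>(x r) (y w) = x (r (y w)) = x ((r y) w), where r passes from A to B in the middle by
  \<open>lam_a\<close>.\<close>

lemma ten_ex: "\<exists>m. m \<in> hom M (P \<otimes> P) P \<and> m \<cdot> (p \<odot> Id M P) = lam \<cdot> (Id M A' \<odot> rho) \<cdot> assoc M A' B' P"
proof -
  let ?q = "lam \<cdot> (Id M A' \<odot> rho) \<cdot> assoc M A' B' P"
  have "?q \<cdot> (((mul A \<cdot> (Id M A' \<odot> a)) \<odot> Id M B') \<odot> Id M P) =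
      lam \<cdot> ((mul A \<cdot> (Id M A' \<odot> a)) \<odot> rho) \<cdot> assoc M (A' \<otimes> R) B' P"
    by (simp add: assoc_natural)
  also have "\<dots> = lam \<cdot> (Id M A' \<odot> (lam \<cdot> (a \<odot> rho))) \<cdot> (assoc M A' R (B' \<otimes> P) \<cdot> assoc M (A' \<otimes> R) B' P)"
    using action_mul[OF lam_action A, of "Id M A'" a rho] by simp
  also have "\<dots> = lam \<cdot> (Id M A' \<odot> (lam \<cdot> (a \<odot> rho))) \<cdot>
      ((Id M A' \<odot> assoc M R B' P) \<cdot> assoc M A' (R \<otimes> B') P \<cdot> (assoc M A' R B' \<odot> Id M P))"
    by (simp only: pentagon A_arr B_arr R_obj P_obj)
  also have "\<dots> = lam \<cdot> (Id M A' \<odot> (rho \<cdot> (b \<odot> rho) \<cdot> assoc M R B' P)) \<cdot>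
      assoc M A' (R \<otimes> B') P \<cdot> (assoc M A' R B' \<odot> Id M P)"
    using lam_a[of "Id M R" rho] by simp
  also have "\<dots> = lam \<cdot> (Id M A' \<odot> (rho \<cdot> ((mul B \<cdot> (b \<odot> Id M B')) \<odot> Id M P))) \<cdot>
      assoc M A' (R \<otimes> B') P \<cdot> (assoc M A' R B' \<odot> Id M P)"
    using action_mul[OF rho_action B, of b "Id M B'" "Id M P"] by simp
  also have "\<dots> = lam \<cdot> (Id M A' \<odot> rho) \<cdot> ((Id M A' \<odot> (mul B \<cdot> (b \<odot> Id M B')) \<odot> Id M P) \<cdot>
      assoc M A' (R \<otimes> B') P) \<cdot> (assoc M A' R B' \<odot> Id M P)"
    by simp
  also have "\<dots> = lam \<cdot> (Id M A' \<odot> rho) \<cdot> (assoc M A' B' P \<cdot> ((Id M A' \<odot> (mul B \<cdot> (b \<odot> Id M B'))) \<odot> Id M P)) \<cdot>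
      (assoc M A' R B' \<odot> Id M P)"
    by (simp add: assoc_natural)
  also have "\<dots> = ?q \<cdot> (((Id M A' \<odot> (mul B \<cdot> (b \<odot> Id M B'))) \<cdot> assoc M A' R B') \<odot> Id M P)"
    by simp
  finally have eq: "?q \<cdot> (((mul A \<cdot> (Id M A' \<odot> a)) \<odot> Id M B') \<odot> Id M P) =
      ?q \<cdot> (((Id M A' \<odot> (mul B \<cdot> (b \<odot> Id M B'))) \<cdot> assoc M A' R B') \<odot> Id M P)" .
  obtain k where "k \<in> Arr M" "Dom M k = Cod M (p \<odot> Id M P)" "Cod M k = Cod M ?q" "k \<cdot> (p \<odot> Id M P) = ?q"
    by (rule coequalizer_factor[OF tensor_right_coequalizer[OF coeq P_obj] _ _ eq]) simp_all
  then show ?thesis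
    by (auto simp: in_hom_iff)
qed

lemma ten_props: "ten \<in> hom M (P \<otimes> P) P \<and> ten \<cdot> (p \<odot> Id M P) = lam \<cdot> (Id M A' \<odot> rho) \<cdot> assoc M A' B' P"
  unfolding ten_def
proof (rule theI', rule ex_ex1I[OF ten_ex])
  fix l l'
  assume "l \<in> hom M (P \<otimes> P) P \<and> l \<cdot> (p \<odot> Id M P) = lam \<cdot> (Id M A' \<odot> rho) \<cdot> assoc M A' B' P"
    "l' \<in> hom M (P \<otimes> P) P \<and> l' \<cdot> (p \<odot> Id M P) = lam \<cdot> (Id M A' \<odot> rho) \<cdot> assoc M A' B' P"
  then show "l = l'"
    by (intro p_epi_right[of l P l']) (simp_all add: in_hom_iff)
qed

lemma ten_arr [simp]: "ten \<in> Arr M" "Dom M ten = P \<otimes> P" "Cod M ten = P"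
  using ten_props by (auto simp: in_hom_iff)

lemma ten_p:
  assumes [simp]: "f \<in> Arr M" "Cod M f = A'" "g \<in> Arr M" "Cod M g = B'" "z \<in> Arr M" "Cod M z = P"
  shows "ten \<cdot> ((p \<cdot> (f \<odot> g)) \<odot> z) = lam \<cdot> (f \<odot> (rho \<cdot> (g \<odot> z))) \<cdot> assoc M (Dom M f) (Dom M g) (Dom M z)"
proof -
  have "ten \<cdot> ((p \<cdot> (f \<odot> g)) \<odot> z) = ten \<cdot> (p \<odot> Id M P) \<cdot> ((f \<odot> g) \<odot> z)"
    by simp
  also have "\<dots> = lam \<cdot> (f \<odot> (rho \<cdot> (g \<odot> z))) \<cdot> assoc M (Dom M f) (Dom M g) (Dom M z)"
    using ten_props by (simp add: assoc_natural)
  finally show ?thesis .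
qed

lemma ten_p_id: "z \<in> Arr M \<Longrightarrow> Cod M z = P \<Longrightarrow> ten \<cdot> (p \<odot> z) = lam \<cdot> (Id M A' \<odot> (rho \<cdot> (Id M B' \<odot> z))) \<cdot> assoc M A' B' (Dom M z)"
  using ten_p[of "Id M A'" "Id M B'" z] by simp

section \<open>The unit, the two inclusions and uniqueness of compatible maps\<close>

definition eps :: 'm where
  "eps = p \<cdot> (one A \<odot> one B) \<cdot> linv I"

definition inl :: 'm where
  "inl = p \<cdot> (Id M A' \<odot> one B) \<cdot> rinv A'"

definition inr :: 'm where
  "inr = p \<cdot> (one A \<odot> Id M B') \<cdot> linv B'"

lemma units_arr [simp]: "eps \<in> Arr M" "Dom M eps = I" "Cod M eps = P"
  "inl \<in> Arr M" "Dom M inl = A'" "Cod M inl = P" "inr \<in> Arr M" "Dom M inr = B'" "Cod M inr = P"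
  by (simp_all add: eps_def inl_def inr_def)

lemma lam_eps: "lam \<cdot> (Id M A' \<odot> eps) = inl \<cdot> runit M A'"
proof -
  have "lam \<cdot> (Id M A' \<odot> eps) = lam \<cdot> (Id M A' \<odot> (p \<cdot> (one A \<odot> one B))) \<cdot> (Id M A' \<odot> linv I)"
    by (simp add: eps_def)
  also have "\<dots> = p \<cdot> (runit M A' \<odot> one B) \<cdot> (ainv A' I I \<cdot> (Id M A' \<odot> linv I))"
    using mul_one[OF A, of "Id M A'"] by (simp add: lam_p)
  also have "\<dots> = inl \<cdot> runit M A'"
    by (simp add: ainv_linv inl_def)
  finally show ?thesis .
qed

lemma rho_eps: "rho \<cdot> (Id M B' \<odot> eps) = inr \<cdot> runit M B'"
proof -
  have "rho \<cdot> (Id M B' \<odot> eps) = rho \<cdot> (Id M B' \<odot> (p \<cdot> (one A \<odot> one B))) \<cdot> (Id M B' \<odot> linv I)"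
    by (simp add: eps_def)
  also have "\<dots> = p \<cdot> (one A \<odot> runit M B') \<cdot> (exch B' I I \<cdot> (Id M B' \<odot> linv I))"
    using mul_one[OF B, of "Id M B'"] by (simp add: rho_p)
  also have "\<dots> = p \<cdot> (one A \<odot> Id M B') \<cdot> ((Id M I \<odot> runit M B') \<cdot> linv (B' \<otimes> I))"
    by (simp add: exch_unit)
  also have "\<dots> = inr \<cdot> runit M B'"
    using linv_natural[of "runit M B'" B'] by (simp add: inr_def)
  finally show ?thesis .
qed

lemma lam_inr: "lam \<cdot> (Id M A' \<odot> inr) = p"
proof -
  have "lam \<cdot> (Id M A' \<odot> inr) = lam \<cdot> (Id M A' \<odot> (p \<cdot> (one A \<odot> Id M B'))) \<cdot> (Id M A' \<odot> linv B')"
    by (simp add: inr_def)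
  also have "\<dots> = p \<cdot> (runit M A' \<odot> Id M B') \<cdot> (ainv A' I B' \<cdot> (Id M A' \<odot> linv B'))"
    using mul_one[OF A, of "Id M A'"] by (simp add: lam_p)
  also have "\<dots> = p"
    by (simp add: ainv_linv)
  finally show ?thesis .
qed

text \<open>A and B act on \<open>P \<otimes> Z\<close> through P, and on N by the bare maps
  \<open>\<kappa>\<close> and \<open>\<kappa>'\<close>. The parameter Z lets a single uniqueness
  statement serve for maps out of \<open>P \<otimes> P\<close>,
  \<open>P \<otimes> P \<otimes> P\<close> and \<open>P \<otimes> X \<otimes> P\<close>.\<close>

definition linear :: "'o \<Rightarrow> 'm \<Rightarrow> 'm \<Rightarrow> 'o \<Rightarrow> 'm \<Rightarrow> bool" where
  "linear N \<kappa> \<kappa>' Z \<phi> \<longleftrightarrow> \<phi> \<in> hom M (P \<otimes> Z) N \<and>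
     \<phi> \<cdot> (lam \<odot> Id M Z) = \<kappa> \<cdot> (Id M A' \<odot> \<phi>) \<cdot> assoc M A' P Z \<and>
     \<phi> \<cdot> (rho \<odot> Id M Z) = \<kappa>' \<cdot> (Id M B' \<odot> \<phi>) \<cdot> assoc M B' P Z"

text \<open>Since \<open>p = \<lambda> (A \<otimes> (\<rho> (B \<otimes> \<epsilon>)))\<close>, the object \<open>P \<otimes> Z\<close> is generated by \<open>Z\<close> under the two actions.\<close>

lemma linear_eqI:
  assumes \<phi>: "linear N \<kappa> \<kappa>' Z \<phi>" and \<psi>: "linear N \<kappa> \<kappa>' Z \<psi>"
    and eq: "\<phi> \<cdot> (eps \<odot> Id M Z) = \<psi> \<cdot> (eps \<odot> Id M Z)"
    and Z [simp]: "Z \<in> Obj M" and \<kappa> [simp]: "\<kappa> \<in> Arr M" "Dom M \<kappa> = A' \<otimes> N" and \<kappa>' [simp]: "\<kappa>' \<in> Arr M" "Dom M \<kappa>' = B' \<otimes> N"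
  shows "\<phi> = \<psi>"
proof -
  \<comment> \<open>The value of \<open>\<chi>\<close> on x \<otimes> y and z is x (y \<chi>(1, z)):
    the right-hand side depends on \<open>\<chi>\<close> only through its restriction along
    \<open>eps\<close>.\<close>
  have key: "\<chi> \<cdot> (p \<odot> Id M Z) = \<kappa> \<cdot> (Id M A' \<odot> (\<kappa>' \<cdot> (Id M B' \<odot> (\<chi> \<cdot> (eps \<odot> Id M Z))) \<cdot>
      assoc M B' I Z \<cdot> (rinv B' \<odot> Id M Z))) \<cdot> assoc M A' B' Z"
    if \<chi>: "linear N \<kappa> \<kappa>' Z \<chi>" for \<chi>
  proof -
    have [simp]: "\<chi> \<in> Arr M" "Dom M \<chi> = P \<otimes> Z" "Cod M \<chi> = N"
      and lam: "\<chi> \<cdot> (lam \<odot> Id M Z) = \<kappa> \<cdot> ((Id M A' \<odot> \<chi>) \<cdot> assoc M A' P Z)"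
      and rho: "\<chi> \<cdot> (rho \<odot> Id M Z) = \<kappa>' \<cdot> ((Id M B' \<odot> \<chi>) \<cdot> assoc M B' P Z)"
      using \<chi> cod_obj[of \<chi>] by (auto simp: linear_def in_hom_iff)
    have "\<chi> \<cdot> (inr \<odot> Id M Z) = \<chi> \<cdot> (rho \<odot> Id M Z) \<cdot> ((Id M B' \<odot> eps) \<odot> Id M Z) \<cdot> (rinv B' \<odot> Id M Z)"
      by (simp add: comp_tail[OF rho_eps])
    also have "\<dots> = \<kappa>' \<cdot> (Id M B' \<odot> \<chi>) \<cdot> (assoc M B' P Z \<cdot> ((Id M B' \<odot> eps) \<odot> Id M Z)) \<cdot> (rinv B' \<odot> Id M Z)"
      by (simp add: comp_tail[OF rho] del: interchange interchange_tail)
    also have "\<dots> = \<kappa>' \<cdot> (Id M B' \<odot> (\<chi> \<cdot> (eps \<odot> Id M Z))) \<cdot> assoc M B' I Z \<cdot> (rinv B' \<odot> Id M Z)"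
      by (simp add: assoc_natural)
    finally have inr: "\<chi> \<cdot> (inr \<odot> Id M Z) = \<kappa>' \<cdot> (Id M B' \<odot> (\<chi> \<cdot> (eps \<odot> Id M Z))) \<cdot> assoc M B' I Z \<cdot> (rinv B' \<odot> Id M Z)" .
    have "\<chi> \<cdot> (p \<odot> Id M Z) = \<chi> \<cdot> (lam \<odot> Id M Z) \<cdot> ((Id M A' \<odot> inr) \<odot> Id M Z)"
      by (simp add: lam_inr)
    also have "\<dots> = \<kappa> \<cdot> (Id M A' \<odot> \<chi>) \<cdot> (assoc M A' P Z \<cdot> ((Id M A' \<odot> inr) \<odot> Id M Z))"
      by (simp add: comp_tail[OF lam] del: interchange interchange_tail)
    also have "\<dots> = \<kappa> \<cdot> (Id M A' \<odot> (\<chi> \<cdot> (inr \<odot> Id M Z))) \<cdot> assoc M A' B' Z"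
      by (simp add: assoc_natural)
    finally show ?thesis by (simp only: inr)
  qed
  show ?thesis
    by (rule p_epi_right[of \<phi> Z \<psi>]) (use \<phi> \<psi> key[OF \<phi>] key[OF \<psi>] eq in \<open>auto simp: linear_def in_hom_iff\<close>)
qed

lemma linearD:
  assumes "linear N \<kappa> \<kappa>' Z \<phi>" "Z \<in> Obj M" "\<kappa> \<in> Arr M" "Dom M \<kappa> = A' \<otimes> N" "\<kappa>' \<in> Arr M" "Dom M \<kappa>' = B' \<otimes> N"
    and [simp]: "z \<in> Arr M" "Cod M z = P" "h \<in> Arr M" "Cod M h = Z"
  shows "f \<in> Arr M \<Longrightarrow> Cod M f = A' \<Longrightarrow>
      \<phi> \<cdot> ((lam \<cdot> (f \<odot> z)) \<odot> h) = \<kappa> \<cdot> (f \<odot> (\<phi> \<cdot> (z \<odot> h))) \<cdot> assoc M (Dom M f) (Dom M z) (Dom M h)"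
    and "g \<in> Arr M \<Longrightarrow> Cod M g = B' \<Longrightarrow>
      \<phi> \<cdot> ((rho \<cdot> (g \<odot> z)) \<odot> h) = \<kappa>' \<cdot> (g \<odot> (\<phi> \<cdot> (z \<odot> h))) \<cdot> assoc M (Dom M g) (Dom M z) (Dom M h)"
proof -
  have [simp]: "\<phi> \<in> Arr M" "Dom M \<phi> = P \<otimes> Z" "Cod M \<phi> = N"
    and lam: "\<phi> \<cdot> (lam \<odot> Id M Z) = \<kappa> \<cdot> ((Id M A' \<odot> \<phi>) \<cdot> assoc M A' P Z)"
    and rho: "\<phi> \<cdot> (rho \<odot> Id M Z) = \<kappa>' \<cdot> ((Id M B' \<odot> \<phi>) \<cdot> assoc M B' P Z)"
    using assms cod_obj[of \<phi>] by (auto simp: linear_def in_hom_iff)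
  note [simp] = assms(2-6)
  {
    assume [simp]: "f \<in> Arr M" "Cod M f = A'"
    have "\<phi> \<cdot> ((lam \<cdot> (f \<odot> z)) \<odot> h) = \<phi> \<cdot> (lam \<odot> Id M Z) \<cdot> ((f \<odot> z) \<odot> h)"
      by simp
    also have "\<dots> = \<kappa> \<cdot> (f \<odot> (\<phi> \<cdot> (z \<odot> h))) \<cdot> assoc M (Dom M f) (Dom M z) (Dom M h)"
      by (simp add: comp_tail[OF lam] assoc_natural del: interchange interchange_tail) simp
    finally show "\<phi> \<cdot> ((lam \<cdot> (f \<odot> z)) \<odot> h) = \<kappa> \<cdot> (f \<odot> (\<phi> \<cdot> (z \<odot> h))) \<cdot> assoc M (Dom M f) (Dom M z) (Dom M h)" .
  next
    assume [simp]: "g \<in> Arr M" "Cod M g = B'"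
    have "\<phi> \<cdot> ((rho \<cdot> (g \<odot> z)) \<odot> h) = \<phi> \<cdot> (rho \<odot> Id M Z) \<cdot> ((g \<odot> z) \<odot> h)"
      by simp
    also have "\<dots> = \<kappa>' \<cdot> (g \<odot> (\<phi> \<cdot> (z \<odot> h))) \<cdot> assoc M (Dom M g) (Dom M z) (Dom M h)"
      by (simp add: comp_tail[OF rho] assoc_natural del: interchange interchange_tail) simp
    finally show "\<phi> \<cdot> ((rho \<cdot> (g \<odot> z)) \<odot> h) = \<kappa>' \<cdot> (g \<odot> (\<phi> \<cdot> (z \<odot> h))) \<cdot> assoc M (Dom M g) (Dom M z) (Dom M h)" .
  }
qed

text \<open>For A this is the associativity x' (x (y w)) = (x' x) (y w). For B the new factor has to
  pass x before it is multiplied onto y, which is where commutation of the two actions is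
  used.\<close>

lemma linear_ten: "linear P lam rho P ten"
proof -
  have "ten \<cdot> (lam \<odot> Id M P) = lam \<cdot> (Id M A' \<odot> ten) \<cdot> assoc M A' P P"
  proof (rule p_epi_mid[of _ A' P])
    have "ten \<cdot> (lam \<odot> Id M P) \<cdot> ((Id M A' \<odot> p) \<odot> Id M P) =
        ten \<cdot> ((p \<cdot> (mul A \<odot> Id M B')) \<odot> Id M P) \<cdot> (ainv A' A' B' \<odot> Id M P)"
      by (simp add: lam_p_id)
    also have "\<dots> = lam \<cdot> (mul A \<odot> rho) \<cdot> assoc M (A' \<otimes> A') B' P \<cdot> (ainv A' A' B' \<odot> Id M P)"
      by (simp add: ten_p comp_tail[OF ten_p] del: interchange interchange_tail)
    also have "\<dots> = lam \<cdot> (Id M A' \<odot> (lam \<cdot> (Id M A' \<odot> rho))) \<cdot>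
        (assoc M A' A' (B' \<otimes> P) \<cdot> assoc M (A' \<otimes> A') B' P) \<cdot> (ainv A' A' B' \<odot> Id M P)"
    proof -
      have "lam \<cdot> (mul A \<odot> rho) = lam \<cdot> (Id M A' \<odot> (lam \<cdot> (Id M A' \<odot> rho))) \<cdot> assoc M A' A' (B' \<otimes> P)"
        using action_mul[OF lam_action A, of "Id M A'" "Id M A'" rho] by simp
      from comp_tail[OF this] show ?thesis by simp
    qed
    also have "\<dots> = lam \<cdot> (Id M A' \<odot> (lam \<cdot> (Id M A' \<odot> rho))) \<cdot>
        ((Id M A' \<odot> assoc M A' B' P) \<cdot> assoc M A' (A' \<otimes> B') P \<cdot> (assoc M A' A' B' \<odot> Id M P)) \<cdot> (ainv A' A' B' \<odot> Id M P)"
      by (simp only: pentagon A_arr B_arr P_obj)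
    also have "\<dots> = lam \<cdot> (Id M A' \<odot> (ten \<cdot> (p \<odot> Id M P))) \<cdot> assoc M A' (A' \<otimes> B') P"
      by (simp add: ten_p_id)
    also have "\<dots> = lam \<cdot> (Id M A' \<odot> ten) \<cdot> assoc M A' P P \<cdot> ((Id M A' \<odot> p) \<odot> Id M P)"
      by (simp add: assoc_natural)
    finally show "ten \<cdot> (lam \<odot> Id M P) \<cdot> ((Id M A' \<odot> p) \<odot> Id M P) =
        lam \<cdot> (Id M A' \<odot> ten) \<cdot> assoc M A' P P \<cdot> ((Id M A' \<odot> p) \<odot> Id M P)" .
  qed simp_all
  moreover have "ten \<cdot> (rho \<odot> Id M P) = rho \<cdot> (Id M B' \<odot> ten) \<cdot> assoc M B' P P"
  proof (rule p_epi_mid[of _ B' P])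
    have "ten \<cdot> (rho \<odot> Id M P) \<cdot> ((Id M B' \<odot> p) \<odot> Id M P) =
        ten \<cdot> ((p \<cdot> (Id M A' \<odot> mul B)) \<odot> Id M P) \<cdot> (exch B' A' B' \<odot> Id M P)"
      by (simp add: rho_p_id)
    also have "\<dots> = lam \<cdot> (Id M A' \<odot> (rho \<cdot> (mul B \<odot> Id M P))) \<cdot> assoc M A' (B' \<otimes> B') P \<cdot> (exch B' A' B' \<odot> Id M P)"
      by (simp add: ten_p comp_tail[OF ten_p] del: interchange interchange_tail)
    also have "\<dots> = lam \<cdot> (Id M A' \<odot> (rho \<cdot> (Id M B' \<odot> rho))) \<cdot>
        ((Id M A' \<odot> assoc M B' B' P) \<cdot> assoc M A' (B' \<otimes> B') P \<cdot> (exch B' A' B' \<odot> Id M P))"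
      using action_mul[OF rho_action B, of "Id M B'" "Id M B'" "Id M P"] by simp
    also have "\<dots> = lam \<cdot> (Id M A' \<odot> (rho \<cdot> (Id M B' \<odot> rho))) \<cdot>
        (exch B' A' (B' \<otimes> P) \<cdot> (Id M B' \<odot> assoc M A' B' P) \<cdot> assoc M B' (A' \<otimes> B') P)"
      by (simp only: exch_tensor A_arr B_arr P_obj)
    also have "\<dots> = rho \<cdot> (Id M B' \<odot> (lam \<cdot> (Id M A' \<odot> rho))) \<cdot> (Id M B' \<odot> assoc M A' B' P) \<cdot> assoc M B' (A' \<otimes> B') P"
      using commutingD[OF commuting_sym[OF lam_rho_commuting], of "Id M B'" "Id M A'" rho]
      by (simp del: interchange interchange_tail)
    also have "\<dots> = rho \<cdot> (Id M B' \<odot> (ten \<cdot> (p \<odot> Id M P))) \<cdot> assoc M B' (A' \<otimes> B') P"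
      by (simp add: ten_p_id)
    also have "\<dots> = rho \<cdot> (Id M B' \<odot> ten) \<cdot> assoc M B' P P \<cdot> ((Id M B' \<odot> p) \<odot> Id M P)"
      by (simp add: assoc_natural)
    finally show "ten \<cdot> (rho \<odot> Id M P) \<cdot> ((Id M B' \<odot> p) \<odot> Id M P) =
        rho \<cdot> (Id M B' \<odot> ten) \<cdot> assoc M B' P P \<cdot> ((Id M B' \<odot> p) \<odot> Id M P)" .
  qed simp_all
  ultimately show ?thesis by (simp add: linear_def in_hom_iff)
qed

lemma ten_lam:
  assumes "z \<in> Arr M" "Cod M z = P" "h \<in> Arr M" "Cod M h = P" "f \<in> Arr M" "Cod M f = A'"
  shows "ten \<cdot> ((lam \<cdot> (f \<odot> z)) \<odot> h) = lam \<cdot> (f \<odot> (ten \<cdot> (z \<odot> h))) \<cdot> assoc M (Dom M f) (Dom M z) (Dom M h)"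
  by (rule linearD[OF linear_ten]) (use assms in simp_all)

lemma ten_rho:
  assumes "z \<in> Arr M" "Cod M z = P" "h \<in> Arr M" "Cod M h = P" "g \<in> Arr M" "Cod M g = B'"
  shows "ten \<cdot> ((rho \<cdot> (g \<odot> z)) \<odot> h) = rho \<cdot> (g \<odot> (ten \<cdot> (z \<odot> h))) \<cdot> assoc M (Dom M g) (Dom M z) (Dom M h)"
  by (rule linearD[OF linear_ten]) (use assms in simp_all)

lemma ten_lam_id: "h \<in> Arr M \<Longrightarrow> Cod M h = P \<Longrightarrow> ten \<cdot> (lam \<odot> h) = lam \<cdot> (Id M A' \<odot> (ten \<cdot> (Id M P \<odot> h))) \<cdot> assoc M A' P (Dom M h)"
  and ten_rho_id: "h \<in> Arr M \<Longrightarrow> Cod M h = P \<Longrightarrow> ten \<cdot> (rho \<odot> h) = rho \<cdot> (Id M B' \<odot> (ten \<cdot> (Id M P \<odot> h))) \<cdot> assoc M B' P (Dom M h)"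
  using ten_lam[of "Id M P" h "Id M A'"] ten_rho[of "Id M P" h "Id M B'"] by simp_all

text \<open>Compatibility concerns the first argument and survives any substitution in the
  second.\<close>

lemma linear_ten_comp:
  assumes "\<kappa> \<in> Arr M" "Cod M \<kappa> = P" "Z = Dom M \<kappa>"
  shows "linear P lam rho Z (ten \<cdot> (Id M P \<odot> \<kappa>))"
  unfolding linear_def using assms by (auto simp: in_hom_iff ten_lam_id ten_rho_id)

lemma ten_eps:
  assumes "z \<in> Arr M" "Cod M z = P"
  shows "ten \<cdot> (eps \<odot> z) = z \<cdot> lunit M (Dom M z)"
proof -
  have "ten \<cdot> (eps \<odot> z) = ten \<cdot> ((p \<cdot> (one A \<odot> one B)) \<odot> z) \<cdot> (linv I \<odot> Id M (Dom M z))"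
    using assms by (simp add: eps_def)
  also have "\<dots> = lam \<cdot> (one A \<odot> (rho \<cdot> (one B \<odot> z))) \<cdot> (assoc M I I (Dom M z) \<cdot> (linv I \<odot> Id M (Dom M z)))"
    using assms by (simp add: ten_p comp_tail[OF ten_p] del: interchange interchange_tail)
  also have "\<dots> = (z \<cdot> lunit M (Dom M z)) \<cdot> lunit M (I \<otimes> Dom M z) \<cdot> linv (I \<otimes> Dom M z)"
    using assms by (simp add: linv_tensor action_one[OF rho_action B] comp_tail[OF action_one[OF lam_action A]])
  finally show ?thesis using assms by simp
qed

text \<open>v (c w) = c (v w) for v, w in P and c in X: both sides are compatible in v and agree at
  v = 1. Used with \<open>\<kappa>\<close> equal to \<open>lam\<close> and to \<open>rho\<close>, it
  moves the actions out of the second argument of the product.\<close>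

lemma ten_commuting:
  assumes lam: "commuting A' X P lam \<kappa>" and rho: "commuting B' X P rho \<kappa>"
  shows "ten \<cdot> (Id M P \<odot> \<kappa>) = \<kappa> \<cdot> (Id M X \<odot> ten) \<cdot> exch P X P"
proof (rule linear_eqI)
  have \<kappa> [simp]: "\<kappa> \<in> Arr M" "Dom M \<kappa> = X \<otimes> P" "Cod M \<kappa> = P" and X [simp]: "X \<in> Obj M"
    using lam by (auto simp: commuting_def in_hom_iff)
  show "linear P lam rho (X \<otimes> P) (ten \<cdot> (Id M P \<odot> \<kappa>))"
    by (rule linear_ten_comp) simp_all
  let ?\<psi> = "\<kappa> \<cdot> (Id M X \<odot> ten) \<cdot> exch P X P"
  have "?\<psi> \<cdot> (lam \<odot> Id M (X \<otimes> P)) = \<kappa> \<cdot> (Id M X \<odot> (ten \<cdot> (lam \<odot> Id M P))) \<cdot> exch (A' \<otimes> P) X P"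
    by (simp add: exch_natural_id)
  also have "\<dots> = \<kappa> \<cdot> (Id M X \<odot> (lam \<cdot> (Id M A' \<odot> ten))) \<cdot> ((Id M X \<odot> assoc M A' P P) \<cdot> exch (A' \<otimes> P) X P)"
    by (simp add: ten_lam_id)
  also have "\<dots> = \<kappa> \<cdot> (Id M X \<odot> (lam \<cdot> (Id M A' \<odot> ten))) \<cdot>
      (exch A' X (P \<otimes> P) \<cdot> (Id M A' \<odot> exch P X P) \<cdot> assoc M A' P (X \<otimes> P))"
    by (simp only: exch_assoc' A_arr X P_obj)
  also have "\<dots> = lam \<cdot> (Id M A' \<odot> (\<kappa> \<cdot> (Id M X \<odot> ten))) \<cdot> (Id M A' \<odot> exch P X P) \<cdot> assoc M A' P (X \<otimes> P)"
    using commutingD[OF lam, of "Id M A'" "Id M X" ten] by (simp del: interchange interchange_tail)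
  finally have 1: "?\<psi> \<cdot> (lam \<odot> Id M (X \<otimes> P)) = lam \<cdot> (Id M A' \<odot> ?\<psi>) \<cdot> assoc M A' P (X \<otimes> P)"
    by simp
  have "?\<psi> \<cdot> (rho \<odot> Id M (X \<otimes> P)) = \<kappa> \<cdot> (Id M X \<odot> (ten \<cdot> (rho \<odot> Id M P))) \<cdot> exch (B' \<otimes> P) X P"
    by (simp add: exch_natural_id)
  also have "\<dots> = \<kappa> \<cdot> (Id M X \<odot> (rho \<cdot> (Id M B' \<odot> ten))) \<cdot> ((Id M X \<odot> assoc M B' P P) \<cdot> exch (B' \<otimes> P) X P)"
    by (simp add: ten_rho_id)
  also have "\<dots> = \<kappa> \<cdot> (Id M X \<odot> (rho \<cdot> (Id M B' \<odot> ten))) \<cdot>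
      (exch B' X (P \<otimes> P) \<cdot> (Id M B' \<odot> exch P X P) \<cdot> assoc M B' P (X \<otimes> P))"
    by (simp only: exch_assoc' B_arr X P_obj)
  also have "\<dots> = rho \<cdot> (Id M B' \<odot> (\<kappa> \<cdot> (Id M X \<odot> ten))) \<cdot> (Id M B' \<odot> exch P X P) \<cdot> assoc M B' P (X \<otimes> P)"
    using commutingD[OF rho, of "Id M B'" "Id M X" ten] by (simp del: interchange interchange_tail)
  finally have 2: "?\<psi> \<cdot> (rho \<odot> Id M (X \<otimes> P)) = rho \<cdot> (Id M B' \<odot> ?\<psi>) \<cdot> assoc M B' P (X \<otimes> P)"
    by simp
  show "linear P lam rho (X \<otimes> P) ?\<psi>"
    using 1 2 by (simp add: linear_def in_hom_iff)
  have "?\<psi> \<cdot> (eps \<odot> Id M (X \<otimes> P)) = \<kappa> \<cdot> (Id M X \<odot> (ten \<cdot> (eps \<odot> Id M P))) \<cdot> exch I X P"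
    by (simp add: exch_natural_id)
  also have "\<dots> = \<kappa> \<cdot> lunit M (X \<otimes> P)"
    by (simp add: ten_eps exch_lunit)
  finally show "ten \<cdot> (Id M P \<odot> \<kappa>) \<cdot> (eps \<odot> Id M (X \<otimes> P)) = ?\<psi> \<cdot> (eps \<odot> Id M (X \<otimes> P))"
    by (simp add: ten_eps)
qed (use lam in \<open>auto simp: commuting_def in_hom_iff\<close>)

lemma ten_lam_right: "ten \<cdot> (Id M P \<odot> lam) = lam \<cdot> (Id M A' \<odot> ten) \<cdot> exch P A' P"
  by (rule ten_commuting[OF commuting_self[OF lam_action A] commuting_sym[OF lam_rho_commuting]])

lemma ten_rho_right: "ten \<cdot> (Id M P \<odot> rho) = rho \<cdot> (Id M B' \<odot> ten) \<cdot> exch P B' P"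
  by (rule ten_commuting[OF lam_rho_commuting commuting_self[OF rho_action B]])

text \<open>Tested on x \<otimes> y, where it reads x (y 1) = x \<otimes> y. It precedes
  commutativity, whose comparison at the unit relies on it.\<close>

lemma ten_eps_right: "ten \<cdot> (Id M P \<odot> eps) = runit M P"
proof (rule p_epi_right[of _ I])
  have "ten \<cdot> (Id M P \<odot> eps) \<cdot> (p \<odot> Id M I) = lam \<cdot> (Id M A' \<odot> inr) \<cdot> ((Id M A' \<odot> runit M B') \<cdot> assoc M A' B' I)"
    by (simp add: ten_p_id rho_eps)
  also have "\<dots> = runit M P \<cdot> (p \<odot> Id M I)"
    using runit_natural[of p P] by (simp add: lam_inr comp_tail[OF lam_inr] runit_tensor del: interchange interchange_tail)
  finally show "ten \<cdot> (Id M P \<odot> eps) \<cdot> (p \<odot> Id M I) = runit M P \<cdot> (p \<odot> Id M I)" .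
qed simp_all

text \<open>v w and w v are both compatible in v, the latter by \<open>ten_lam_right\<close> and
  \<open>ten_rho_right\<close>, and both equal w at v = 1.\<close>

lemma ten_braid: "ten \<cdot> braid M P P = ten"
proof (rule linear_eqI[OF _ linear_ten])
  have "ten \<cdot> braid M P P \<cdot> (lam \<odot> Id M P) = ten \<cdot> (Id M P \<odot> lam) \<cdot> braid M (A' \<otimes> P) P"
    by (simp add: braid_natural)
  also have "\<dots> = lam \<cdot> (Id M A' \<odot> ten) \<cdot> (exch P A' P \<cdot> braid M (A' \<otimes> P) P)"
    by (simp add: ten_lam_right comp_tail[OF ten_lam_right])
  finally have 1: "ten \<cdot> braid M P P \<cdot> (lam \<odot> Id M P) = lam \<cdot> (Id M A' \<odot> (ten \<cdot> braid M P P)) \<cdot> assoc M A' P P"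
    by (simp add: exch_braid)
  have "ten \<cdot> braid M P P \<cdot> (rho \<odot> Id M P) = ten \<cdot> (Id M P \<odot> rho) \<cdot> braid M (B' \<otimes> P) P"
    by (simp add: braid_natural)
  also have "\<dots> = rho \<cdot> (Id M B' \<odot> ten) \<cdot> (exch P B' P \<cdot> braid M (B' \<otimes> P) P)"
    by (simp add: ten_rho_right comp_tail[OF ten_rho_right])
  finally have 2: "ten \<cdot> braid M P P \<cdot> (rho \<odot> Id M P) = rho \<cdot> (Id M B' \<odot> (ten \<cdot> braid M P P)) \<cdot> assoc M B' P P"
    by (simp add: exch_braid)
  show "linear P lam rho P (ten \<cdot> braid M P P)"
    using 1 2 by (simp add: linear_def in_hom_iff)
  have "ten \<cdot> braid M P P \<cdot> (eps \<odot> Id M P) = ten \<cdot> (Id M P \<odot> eps) \<cdot> braid M I P"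
    by (simp add: braid_natural)
  then show "ten \<cdot> braid M P P \<cdot> (eps \<odot> Id M P) = ten \<cdot> (eps \<odot> Id M P)"
    by (simp add: ten_eps_right ten_eps runit_braid)
qed simp_all

text \<open>Both bracketings are compatible in the first argument and agree when it is the
  unit.\<close>

lemma ten_assoc: "ten \<cdot> (ten \<odot> Id M P) = ten \<cdot> (Id M P \<odot> ten) \<cdot> assoc M P P P"
proof -
  \<comment> \<open>The domain has to have the form \<open>P \<otimes> Z\<close>, here with Z equal
    to \<open>P \<otimes> P\<close>, so the left-hand side is rebracketed.\<close>
  let ?\<phi> = "ten \<cdot> (ten \<odot> Id M P) \<cdot> ainv P P P"
  have "?\<phi> = ten \<cdot> (Id M P \<odot> ten)"
  proof (rule linear_eqI)
    show "linear P lam rho (P \<otimes> P) (ten \<cdot> (Id M P \<odot> ten))"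
      by (rule linear_ten_comp) simp_all
    have "?\<phi> \<cdot> (lam \<odot> Id M (P \<otimes> P)) = ten \<cdot> ((ten \<cdot> (lam \<odot> Id M P)) \<odot> Id M P) \<cdot> ainv (A' \<otimes> P) P P"
      by (simp add: assoc_natural_id)
    also have "\<dots> = ten \<cdot> ((lam \<cdot> (Id M A' \<odot> ten)) \<odot> Id M P) \<cdot> ((assoc M A' P P \<odot> Id M P) \<cdot> ainv (A' \<otimes> P) P P)"
      by (simp add: ten_lam_id)
    also have "\<dots> = ten \<cdot> ((lam \<cdot> (Id M A' \<odot> ten)) \<odot> Id M P) \<cdot>
        (ainv A' (P \<otimes> P) P \<cdot> (Id M A' \<odot> ainv P P P) \<cdot> assoc M A' P (P \<otimes> P))"
      by (simp only: pentagon_inv' A_arr P_obj)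
    also have "\<dots> = lam \<cdot> (Id M A' \<odot> ?\<phi>) \<cdot> assoc M A' P (P \<otimes> P)"
      by (simp add: ten_lam comp_tail[OF ten_lam] del: interchange interchange_tail) simp
    finally have 1: "?\<phi> \<cdot> (lam \<odot> Id M (P \<otimes> P)) = lam \<cdot> (Id M A' \<odot> ?\<phi>) \<cdot> assoc M A' P (P \<otimes> P)" .
    have "?\<phi> \<cdot> (rho \<odot> Id M (P \<otimes> P)) = ten \<cdot> ((ten \<cdot> (rho \<odot> Id M P)) \<odot> Id M P) \<cdot> ainv (B' \<otimes> P) P P"
      by (simp add: assoc_natural_id)
    also have "\<dots> = ten \<cdot> ((rho \<cdot> (Id M B' \<odot> ten)) \<odot> Id M P) \<cdot> ((assoc M B' P P \<odot> Id M P) \<cdot> ainv (B' \<otimes> P) P P)"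
      by (simp add: ten_rho_id)
    also have "\<dots> = ten \<cdot> ((rho \<cdot> (Id M B' \<odot> ten)) \<odot> Id M P) \<cdot>
        (ainv B' (P \<otimes> P) P \<cdot> (Id M B' \<odot> ainv P P P) \<cdot> assoc M B' P (P \<otimes> P))"
      by (simp only: pentagon_inv' B_arr P_obj)
    also have "\<dots> = rho \<cdot> (Id M B' \<odot> ?\<phi>) \<cdot> assoc M B' P (P \<otimes> P)"
      by (simp add: ten_rho comp_tail[OF ten_rho] del: interchange interchange_tail) simp
    finally have 2: "?\<phi> \<cdot> (rho \<odot> Id M (P \<otimes> P)) = rho \<cdot> (Id M B' \<odot> ?\<phi>) \<cdot> assoc M B' P (P \<otimes> P)" .
    show "linear P lam rho (P \<otimes> P) ?\<phi>"
      using 1 2 by (simp add: linear_def in_hom_iff)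
    have "?\<phi> \<cdot> (eps \<odot> Id M (P \<otimes> P)) = ten \<cdot> (lunit M P \<odot> Id M P) \<cdot> ainv I P P"
      by (simp add: assoc_natural_id ten_eps)
    also have "\<dots> = ten \<cdot> lunit M (P \<otimes> P)"
      using lunit_tensor[of P P, symmetric] by simp
    finally show "?\<phi> \<cdot> (eps \<odot> Id M (P \<otimes> P)) = ten \<cdot> (Id M P \<odot> ten) \<cdot> (eps \<odot> Id M (P \<otimes> P))"
      by (simp add: ten_eps)
  qed simp_all
  then have "?\<phi> \<cdot> assoc M P P P = ten \<cdot> (Id M P \<odot> ten) \<cdot> assoc M P P P"
    by (simp only:)
  then show ?thesis by simp
qed

text \<open>The usual formula (x \<otimes> y) (x' \<otimes> y') = x x' \<otimes> y y', which
  characterises the product in \<open>rtens\<close> and is here a consequence of the description by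
  actions.\<close>

lemma ten_p_p: "ten \<cdot> (p \<odot> p) = p \<cdot> (mul A \<odot> mul B) \<cdot> middle_swap M A' B' A' B'"
proof -
  have "ten \<cdot> (p \<odot> p) = lam \<cdot> (Id M A' \<odot> (p \<cdot> (Id M A' \<odot> mul B))) \<cdot> (Id M A' \<odot> exch B' A' B') \<cdot> assoc M A' B' (A' \<otimes> B')"
    by (simp add: ten_p_id rho_p_id)
  also have "\<dots> = p \<cdot> (mul A \<odot> mul B) \<cdot> ainv A' A' (B' \<otimes> B') \<cdot> (Id M A' \<odot> exch B' A' B') \<cdot> assoc M A' B' (A' \<otimes> B')"
    by (simp add: lam_p comp_tail[OF lam_p] del: interchange interchange_tail)
  finally show ?thesis
    by (simp add: middle_swap_def exch_def)
qed

text \<open>\<open>p \<odot> p\<close> is an epimorphism, being a composite of two tensored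
  coequalizers; so the definite description in \<open>rtens\<close> has a single solution.\<close>

lemma ten_unique:
  assumes "m \<in> hom M (P \<otimes> P) P" "m \<cdot> (p \<odot> p) = p \<cdot> (mul A \<odot> mul B) \<cdot> middle_swap M A' B' A' B'"
  shows "m = ten"
proof (rule p_epi_right[of _ P], rule p_epi_left[of _ "A' \<otimes> B'"])
  show "m \<cdot> (p \<odot> Id M P) \<cdot> (Id M (A' \<otimes> B') \<odot> p) = ten \<cdot> (p \<odot> Id M P) \<cdot> (Id M (A' \<otimes> B') \<odot> p)"
    using assms by (simp add: in_hom_iff ten_p_p)
qed (use assms in \<open>simp_all add: in_hom_iff\<close>)

subsection \<open>The pushout of commutative monoids\<close>

definition tensor_monoid :: "('o, 'm) mon" where
  "tensor_monoid = \<lparr>Car = P, mul = ten, one = eps\<rparr>"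

lemma tensor_monoid_simps [simp]: "Car tensor_monoid = P" "mul tensor_monoid = ten" "one tensor_monoid = eps"
  by (simp_all add: tensor_monoid_def)

lemma comm_monoid_tensor: "comm_monoid_in M tensor_monoid"
  unfolding comm_monoid_in_def
  by (simp add: in_hom_iff ten_assoc ten_eps ten_eps_right ten_braid)

lemma ten_inl:
  assumes "z \<in> Arr M" "Cod M z = P"
  shows "ten \<cdot> (inl \<odot> z) = lam \<cdot> (Id M A' \<odot> z)"
proof -
  let ?Z = "Dom M z"
  have "ten \<cdot> (inl \<odot> z) = ten \<cdot> ((p \<cdot> (Id M A' \<odot> one B)) \<odot> z) \<cdot> (rinv A' \<odot> Id M ?Z)"
    using assms by (simp add: inl_def)
  also have "\<dots> = lam \<cdot> (Id M A' \<odot> (rho \<cdot> (one B \<odot> z))) \<cdot> (assoc M A' I ?Z \<cdot> (rinv A' \<odot> Id M ?Z))"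
    using assms by (simp add: ten_p comp_tail[OF ten_p] del: interchange interchange_tail)
  also have "\<dots> = lam \<cdot> (Id M A' \<odot> z)"
    using assms by (simp add: triangle_inv action_one[OF rho_action B])
  finally show ?thesis .
qed

lemma ten_inr:
  assumes "z \<in> Arr M" "Cod M z = P"
  shows "ten \<cdot> (inr \<odot> z) = rho \<cdot> (Id M B' \<odot> z)"
proof -
  let ?Z = "Dom M z"
  have "ten \<cdot> (inr \<odot> z) = ten \<cdot> ((p \<cdot> (one A \<odot> Id M B')) \<odot> z) \<cdot> (linv B' \<odot> Id M ?Z)"
    using assms by (simp add: inr_def)
  also have "\<dots> = lam \<cdot> (one A \<odot> (rho \<cdot> (Id M B' \<odot> z))) \<cdot> (assoc M I B' ?Z \<cdot> (linv B' \<odot> Id M ?Z))"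
    using assms by (simp add: ten_p comp_tail[OF ten_p] del: interchange interchange_tail)
  also have "\<dots> = rho \<cdot> (Id M B' \<odot> z)"
    using assms by (simp add: linv_tensor action_one[OF lam_action A] comp_tail[OF action_one[OF lam_action A]])
  finally show ?thesis .
qed

lemma inl_hom: "monoid_hom M A tensor_monoid inl"
proof -
  have "ten \<cdot> (inl \<odot> inl) = lam \<cdot> (Id M A' \<odot> (p \<cdot> (Id M A' \<odot> one B))) \<cdot> (Id M A' \<odot> rinv A')"
    by (simp add: ten_inl) (simp add: inl_def)
  also have "\<dots> = p \<cdot> (mul A \<odot> one B) \<cdot> (ainv A' A' I \<cdot> (Id M A' \<odot> rinv A'))"
    by (simp add: lam_p comp_tail[OF lam_p] del: interchange interchange_tail)
  also have "\<dots> = inl \<cdot> mul A"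
    using rinv_natural[of "mul A" A'] by (simp add: rinv_tensor inl_def)
  finally have "inl \<cdot> mul A = ten \<cdot> (inl \<odot> inl)" ..
  moreover have "inl \<cdot> one A = eps"
    using rinv_natural[of "one A" A'] by (simp add: inl_def eps_def lunit_unit)
  ultimately show ?thesis
    by (simp add: monoid_hom_def in_hom_iff)
qed

lemma inr_hom: "monoid_hom M B tensor_monoid inr"
proof -
  have "ten \<cdot> (inr \<odot> inr) = rho \<cdot> (Id M B' \<odot> (p \<cdot> (one A \<odot> Id M B'))) \<cdot> (Id M B' \<odot> linv B')"
    by (simp add: ten_inr) (simp add: inr_def)
  also have "\<dots> = p \<cdot> (one A \<odot> mul B) \<cdot> (exch B' I B' \<cdot> (Id M B' \<odot> linv B'))"
    by (simp add: rho_p comp_tail[OF rho_p] del: interchange interchange_tail)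
  also have "\<dots> = inr \<cdot> mul B"
    using linv_natural[of "mul B" B'] by (simp add: exch_unit inr_def)
  finally have "inr \<cdot> mul B = ten \<cdot> (inr \<odot> inr)" ..
  moreover have "inr \<cdot> one B = eps"
    using linv_natural[of "one B" B'] by (simp add: inr_def eps_def)
  ultimately show ?thesis
    by (simp add: monoid_hom_def in_hom_iff)
qed

text \<open>Both composites are r acting on the unit of P, once through A and once through B; the
  unitor only inserts that unit.\<close>

lemma inl_a_eq_inr_b: "inl \<cdot> a = inr \<cdot> b"
proof (rule iso_cancel_right[of _ "runit M R"])
  have "inl \<cdot> a \<cdot> runit M R = inl \<cdot> runit M A' \<cdot> (a \<odot> Id M I)"
    using runit_natural[of a A'] by simp
  also have "\<dots> = lam \<cdot> (a \<odot> Id M P) \<cdot> (Id M R \<odot> eps)"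
    by (simp add: comp_tail[OF lam_eps[symmetric]])
  also have "\<dots> = rho \<cdot> (Id M B' \<odot> eps) \<cdot> (b \<odot> Id M I)"
    by (simp add: lam_a_eq_rho_b comp_tail[OF lam_a_eq_rho_b] del: interchange interchange_tail) simp
  also have "\<dots> = inr \<cdot> b \<cdot> runit M R"
    using runit_natural[of b B'] by (simp add: rho_eps comp_tail[OF rho_eps] del: interchange interchange_tail)
  finally show "inl \<cdot> a \<cdot> runit M R = inr \<cdot> b \<cdot> runit M R" .
qed (simp_all add: runit_iso)

lemma ten_inl_inr: "ten \<cdot> (inl \<odot> inr) = p"
  by (simp add: ten_inl lam_inr)


text \<open>The rule w (x \<otimes> y) = u(x) v(y) descends to P because u and v agree on R. For
  multiplicativity let A and B act on C through u and v: then \<open>w \<cdot> ten\<close> and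
  \<open>mul C \<cdot> (w \<odot> w)\<close> are both compatible maps out of
  \<open>P \<otimes> P\<close> and agree at the unit.\<close>

lemma pushout_map_ex:
  assumes C: "comm_monoid_in M C" and u: "monoid_hom M A C u" and v: "monoid_hom M B C v"
    and uv: "u \<cdot> a = v \<cdot> b"
  shows "\<exists>w. monoid_hom M tensor_monoid C w \<and> w \<cdot> p = mul C \<cdot> (u \<odot> v)"
proof -
  let ?C = "Car C"
  note [simp] = comm_monoid_arr[OF C]
  have [simp]: "u \<in> Arr M" "Dom M u = A'" "Cod M u = ?C" "v \<in> Arr M" "Dom M v = B'" "Cod M v = ?C"
    and u_mul: "u \<cdot> mul A = mul C \<cdot> (u \<odot> u)" and u_one: "u \<cdot> one A = one C"
    and v_mul: "v \<cdot> mul B = mul C \<cdot> (v \<odot> v)" and v_one: "v \<cdot> one B = one C"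
    using u v by (auto simp: monoid_hom_def in_hom_iff)
  note C_mul = action_mul[OF action_self[OF C] C] and C_mul' = action_mul'[OF action_self[OF C] C]
  let ?q = "mul C \<cdot> (u \<odot> v)"
  have "?q \<cdot> ((mul A \<cdot> (Id M A' \<odot> a)) \<odot> Id M B') = mul C \<cdot> ((mul C \<cdot> (u \<odot> (v \<cdot> b))) \<odot> v)"
    by (simp add: comp_tail[OF u_mul] uv)
  also have "\<dots> = mul C \<cdot> (u \<odot> (mul C \<cdot> ((v \<cdot> b) \<odot> v))) \<cdot> assoc M A' R B'"
    by (simp add: C_mul)
  also have "\<dots> = ?q \<cdot> ((Id M A' \<odot> (mul B \<cdot> (b \<odot> Id M B'))) \<cdot> assoc M A' R B')"
    by (simp add: comp_tail[OF v_mul])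
  finally have eq: "?q \<cdot> ((mul A \<cdot> (Id M A' \<odot> a)) \<odot> Id M B') =
      ?q \<cdot> ((Id M A' \<odot> (mul B \<cdot> (b \<odot> Id M B'))) \<cdot> assoc M A' R B')" .
  obtain w where w [simp]: "w \<in> Arr M" "Dom M w = P" and "Cod M w = Cod M ?q" and wp: "w \<cdot> p = ?q"
    by (rule coequalizer_factor[OF coeq _ _ eq]) simp_all
  then have [simp]: "Cod M w = ?C" by simp
  \<comment> \<open>With \<open>w_rho\<close>, this says that \<open>w\<close> carries the actions
    on P to those on C; both comparisons below rest on it.\<close>
  have w_lam: "w \<cdot> lam = mul C \<cdot> (u \<odot> w)"
  proof (rule p_epi_left[of _ A'])
    have "w \<cdot> lam \<cdot> (Id M A' \<odot> p) = mul C \<cdot> ((mul C \<cdot> (u \<odot> u)) \<odot> v) \<cdot> ainv A' A' B'"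
      by (simp add: lam_p_id comp_tail[OF wp] u_mul)
    also have "\<dots> = mul C \<cdot> (u \<odot> w) \<cdot> (Id M A' \<odot> p)"
      by (simp add: C_mul' wp)
    finally show "w \<cdot> lam \<cdot> (Id M A' \<odot> p) = mul C \<cdot> (u \<odot> w) \<cdot> (Id M A' \<odot> p)" .
  qed simp_all
  have w_rho: "w \<cdot> rho = mul C \<cdot> (v \<odot> w)"
  proof (rule p_epi_left[of _ B'])
    have "w \<cdot> rho \<cdot> (Id M B' \<odot> p) = mul C \<cdot> (u \<odot> (mul C \<cdot> (v \<odot> v))) \<cdot> exch B' A' B'"
      by (simp add: rho_p_id comp_tail[OF wp] v_mul)
    also have "\<dots> = mul C \<cdot> (v \<odot> w) \<cdot> (Id M B' \<odot> p)"
      using commutingD[OF commuting_self[OF action_self[OF C] C], of v u v] by (simp add: wp)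
    finally show "w \<cdot> rho \<cdot> (Id M B' \<odot> p) = mul C \<cdot> (v \<odot> w) \<cdot> (Id M B' \<odot> p)" .
  qed simp_all
  have w_eps: "w \<cdot> eps = one C"
  proof -
    have "w \<cdot> eps = mul C \<cdot> (one C \<odot> one C) \<cdot> linv I"
      by (simp add: eps_def comp_tail[OF wp] u_one v_one)
    also have "\<dots> = one C"
      by (simp add: action_one[OF action_self[OF C] C] comp_tail[OF action_one[OF action_self[OF C] C]])
    finally show ?thesis .
  qed
  have "w \<cdot> ten = mul C \<cdot> (w \<odot> w)"
  proof (rule linear_eqI)
    let ?\<kappa> = "mul C \<cdot> (u \<odot> Id M ?C)" and ?\<kappa>' = "mul C \<cdot> (v \<odot> Id M ?C)"
    show "linear ?C ?\<kappa> ?\<kappa>' P (w \<cdot> ten)"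
      unfolding linear_def
      by (auto simp: in_hom_iff ten_lam_id ten_rho_id comp_tail[OF w_lam] comp_tail[OF w_rho])
    show "linear ?C ?\<kappa> ?\<kappa>' P (mul C \<cdot> (w \<odot> w))"
      unfolding linear_def by (auto simp: in_hom_iff w_lam w_rho C_mul)
    show "w \<cdot> ten \<cdot> (eps \<odot> Id M P) = mul C \<cdot> (w \<odot> w) \<cdot> (eps \<odot> Id M P)"
      by (simp add: ten_eps w_eps action_one[OF action_self[OF C] C])
  qed simp_all
  then have "monoid_hom M tensor_monoid C w"
    using w_eps by (simp add: monoid_hom_def in_hom_iff)
  with wp show ?thesis by blast
qed

lemma pushout_map_restrict:
  assumes C: "comm_monoid_in M C" and u: "monoid_hom M A C u" and v: "monoid_hom M B C v"
    and w: "w \<in> Arr M" "Dom M w = P" "w \<cdot> p = mul C \<cdot> (u \<odot> v)"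
  shows "w \<cdot> inl = u" "w \<cdot> inr = v"
proof -
  note [simp] = comm_monoid_arr[OF C] w(1,2)
  have [simp]: "u \<in> Arr M" "Dom M u = A'" "Cod M u = Car C" "v \<in> Arr M" "Dom M v = B'" "Cod M v = Car C"
    and u_one: "u \<cdot> one A = one C" and v_one: "v \<cdot> one B = one C"
    using u v by (auto simp: monoid_hom_def in_hom_iff)
  show "w \<cdot> inl = u"
    by (simp add: inl_def comp_tail[OF w(3)] v_one mul_one[OF C] comp_tail[OF mul_one[OF C]])
  show "w \<cdot> inr = v"
    by (simp add: inr_def comp_tail[OF w(3)] u_one action_one[OF action_self[OF C] C]
        comp_tail[OF action_one[OF action_self[OF C] C]])
qed

text \<open>In P the product of x \<otimes> 1 and 1 \<otimes> y is x \<otimes> y, so a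
  multiplicative map is determined by its restrictions to A and B.\<close>

lemma pushout_map_p:
  assumes C: "comm_monoid_in M C" and w: "monoid_hom M tensor_monoid C w"
  shows "w \<cdot> p = mul C \<cdot> ((w \<cdot> inl) \<odot> (w \<cdot> inr))"
proof -
  note [simp] = comm_monoid_arr[OF C]
  have [simp]: "w \<in> Arr M" "Dom M w = P" "Cod M w = Car C" and "w \<cdot> ten = mul C \<cdot> (w \<odot> w)"
    using w by (auto simp: monoid_hom_def in_hom_iff)
  then have "w \<cdot> (ten \<cdot> (inl \<odot> inr)) = mul C \<cdot> ((w \<cdot> inl) \<odot> (w \<cdot> inr))"
    using comp_tail[of w ten "mul C \<cdot> (w \<odot> w)" "inl \<odot> inr"] by simp
  then show ?thesis
    by (simp only: ten_inl_inr)
qed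

lemma pushout_map_unique:
  assumes C: "comm_monoid_in M C" and w: "monoid_hom M tensor_monoid C w" and w': "monoid_hom M tensor_monoid C w'"
    and "w \<cdot> inl = w' \<cdot> inl" "w \<cdot> inr = w' \<cdot> inr"
  shows "w = w'"
  by (rule p_epi[OF coeq])
    (use pushout_map_p[OF C w] pushout_map_p[OF C w'] assms in \<open>auto simp: monoid_hom_def in_hom_iff\<close>)

end

lemma (in symmetric_monoidal_category) monoid_hom_comp:
  assumes "monoid_hom M A B f" "monoid_hom M B C g" "comm_monoid_in M A" "comm_monoid_in M B" "comm_monoid_in M C"
  shows "monoid_hom M A C (g \<cdot> f)"
proof -
  note [simp] = comm_monoid_arr[OF assms(3)] comm_monoid_arr[OF assms(4)] comm_monoid_arr[OF assms(5)]
  have [simp]: "f \<in> Arr M" "Dom M f = Car A" "Cod M f = Car B" "g \<in> Arr M" "Dom M g = Car B" "Cod M g = Car C"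
    and "f \<cdot> mul A = mul B \<cdot> (f \<odot> f)" "f \<cdot> one A = one B"
    and g: "g \<cdot> mul B = mul C \<cdot> (g \<odot> g)" "g \<cdot> one B = one C"
    using assms by (auto simp: monoid_hom_def in_hom_iff)
  then show ?thesis
    unfolding monoid_hom_def by (simp add: in_hom_iff comp_tail[OF g(1)])
qed

lemma (in symmetric_monoidal_category) monoid_hom_id:
  assumes "comm_monoid_in M A"
  shows "monoid_hom M A A (Id M (Car A))"
  using comm_monoid_arr[OF assms] by (simp add: monoid_hom_def in_hom_iff)

section \<open>Commutative algebras\<close>

lemma with_smap_simps [simp]:
  "Car (with_smap A f) = Car A" "mul (with_smap A f) = mul A" "one (with_smap A f) = one A" "smap (with_smap A f) = f"
  by (simp_all add: with_smap_def)

lemma comm_monoid_in_with_smap [simp]: "comm_monoid_in M (with_smap A f) = comm_monoid_in M A"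
  by (simp add: comm_monoid_in_def)

lemma monoid_hom_with_smap [simp]:
  "monoid_hom M (with_smap A f) B g = monoid_hom M A B g" "monoid_hom M A (with_smap B f) g = monoid_hom M A B g"
  by (simp_all add: monoid_hom_def)

lemma monoid_homD:
  assumes "monoid_hom M A B f"
  shows "f \<in> Arr M" "Dom M f = Car A" "Cod M f = Car B"
  using assms by (auto simp: monoid_hom_def in_hom_iff)

lemma CAlg_simps [simp]:
  "A \<in> Obj (CAlg M R) \<longleftrightarrow> is_calg M R A"
  "(A, f, B) \<in> Arr (CAlg M R) \<longleftrightarrow>
     is_calg M R A \<and> is_calg M R B \<and> monoid_hom M A B f \<and> f \<cdot>\<^bsub>M\<^esub> smap A = smap B"
  "Dom (CAlg M R) (A, f, B) = A" "Cod (CAlg M R) (A, f, B) = B"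
  "Id (CAlg M R) A = (A, Id M (Car A), A)"
  "(B', g, D) \<cdot>\<^bsub>CAlg M R\<^esub> (A, f, B) = (A, g \<cdot>\<^bsub>M\<^esub> f, D)"
  by (auto simp: CAlg_def)

lemma CAlg_homE:
  assumes "x \<in> hom (CAlg M R) A B"
  obtains f where "x = (A, f, B)" "is_calg M R A" "is_calg M R B" "monoid_hom M A B f" "f \<cdot>\<^bsub>M\<^esub> smap A = smap B"
  using assms by (cases x) (auto simp: in_hom_iff)

lemma CAlg_hom_iff: "(A', f, B') \<in> hom (CAlg M R) A B \<longleftrightarrow> A' = A \<and> B' = B \<and> (A, f, B) \<in> Arr (CAlg M R)"
  by (auto simp: in_hom_iff)

section \<open>The category of algebras and restriction of scalars\<close>

context symmetric_monoidal_category
begin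

lemma is_calgD:
  assumes "is_calg M R A"
  shows "comm_monoid_in M A" "monoid_hom M R A (smap A)"
  using assms by (simp_all add: is_calg_def)

lemma category_CAlg: "category (CAlg M R)"
proof
  fix f g h :: "('o, 'm) alg_arr" and A B D E :: "('o, 'm) alg"
  show "f \<in> Arr (CAlg M R) \<Longrightarrow> Dom (CAlg M R) f \<in> Obj (CAlg M R)"
    by (cases f) auto
  show "f \<in> Arr (CAlg M R) \<Longrightarrow> Cod (CAlg M R) f \<in> Obj (CAlg M R)"
    by (cases f) auto
  show "A \<in> Obj (CAlg M R) \<Longrightarrow> Id (CAlg M R) A \<in> hom (CAlg M R) A A"
    using monoid_homD(1,3)[of M R A "smap A"] by (auto simp: CAlg_hom_iff is_calg_def monoid_hom_id)
  show "g \<cdot>\<^bsub>CAlg M R\<^esub> f \<in> hom (CAlg M R) A D" if "f \<in> hom (CAlg M R) A B" "g \<in> hom (CAlg M R) B D"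
    using that
  proof (elim CAlg_homE)
    fix u v assume "is_calg M R A" "is_calg M R B" "is_calg M R D" "monoid_hom M A B u" "monoid_hom M B D v"
      and eq: "u \<cdot> smap A = smap B" "v \<cdot> smap B = smap D" and fg: "f = (A, u, B)" "g = (B, v, D)"
    moreover from this have "v \<cdot> u \<cdot> smap A = smap D"
      using monoid_homD[of M R A "smap A"] monoid_homD[of M A B u] monoid_homD[of M B D v]
      by (simp add: is_calg_def)
    ultimately show ?thesis
      using monoid_hom_comp[of A B u D v] by (simp add: CAlg_hom_iff is_calg_def)
  qed
  show "f \<cdot>\<^bsub>CAlg M R\<^esub> Id (CAlg M R) A = f" "Id (CAlg M R) B \<cdot>\<^bsub>CAlg M R\<^esub> f = f" if "f \<in> hom (CAlg M R) A B"
    using that by (elim CAlg_homE; simp add: monoid_hom_def in_hom_iff)+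
  show "h \<cdot>\<^bsub>CAlg M R\<^esub> g \<cdot>\<^bsub>CAlg M R\<^esub> f = h \<cdot>\<^bsub>CAlg M R\<^esub> (g \<cdot>\<^bsub>CAlg M R\<^esub> f)"
    if "f \<in> hom (CAlg M R) A B" "g \<in> hom (CAlg M R) B D" "h \<in> hom (CAlg M R) D E"
    using that by (elim CAlg_homE; simp add: monoid_hom_def in_hom_iff)+
qed

lemma is_calg_restrict:
  assumes "is_calg M T A" "comm_monoid_in M R" "comm_monoid_in M T" "monoid_hom M R T f"
  shows "is_calg M R (with_smap A (smap A \<cdot> f))"
  using assms monoid_hom_comp[of R T f A "smap A"] by (simp add: is_calg_def)

lemma restriction_simps [simp]:
  "fobj (restriction M f) B = with_smap B (smap B \<cdot> f)"
  "farr (restriction M f) (B, g, B') = (with_smap B (smap B \<cdot> f), g, with_smap B' (smap B' \<cdot> f))"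
  by (simp_all add: restriction_def Let_def)

lemma restriction_functor:
  assumes "comm_monoid_in M R" "comm_monoid_in M T" "monoid_hom M R T f"
  shows "is_functor (CAlg M T) (CAlg M R) (restriction M f)"
proof -
  have "g \<cdot> (smap A \<cdot> f) = smap B \<cdot> f" if "is_calg M T A" "monoid_hom M A B g" "g \<cdot> smap A = smap B" for A B :: "('o, 'm) alg" and g
    using that monoid_homD[OF assms(3)] monoid_homD[of M T A "smap A"] monoid_homD[of M A B g]
    by (simp add: is_calg_def comp_reassoc[symmetric] del: comp_reassoc)
  then show ?thesis
    unfolding is_functor_def using assms
    by (auto simp: category_CAlg is_calg_restrict CAlg_hom_iff)
qed

end

section \<open>The chosen relative tensor product of algebras\<close>

locale closed_symmetric_monoidal_category_with_coequalizers = closed_symmetric_monoidal_category M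
  for M :: "('o, 'm, 'z) smcat_scheme" (structure) +
  assumes coequalizer_ex: "u \<in> hom M X Y \<Longrightarrow> v \<in> hom M X Y \<Longrightarrow> \<exists>p. coequalizer M u v p"
begin

text \<open>Justifies the \<open>SOME\<close> in \<open>rtens_proj\<close>: a coequalizer exists, so
  the chosen arrow is one.\<close>

lemma relative_tensor_rtens:
  assumes A: "is_calg M R A" and B: "is_calg M R B"
  shows "relative_tensor M (Car R) A B (smap A) (smap B) (rtens_proj M R A B)"
proof unfold_locales
  note [simp] = comm_monoid_arr[OF is_calgD(1)[OF A]] comm_monoid_arr[OF is_calgD(1)[OF B]]
    monoid_homD[OF is_calgD(2)[OF A]] monoid_homD[OF is_calgD(2)[OF B]]
  have [simp]: "Car R \<in> Obj M"
    using dom_obj[of "smap A"] by simp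
  have "\<exists>p. coequalizer M (ract M A \<odot> Id M (Car B))
     ((Id M (Car A) \<odot> lact M B) \<cdot> assoc M (Car A) (Car R) (Car B)) p"
    by (rule coequalizer_ex[of _ "(Car A \<otimes> Car R) \<otimes> Car B" "Car A \<otimes> Car B"]) (simp_all add: ract_def lact_def in_hom_iff)
  then show "coequalizer M ((mul A \<cdot> (Id M (Car A) \<odot> smap A)) \<odot> Id M (Car B))
     ((Id M (Car A) \<odot> (mul B \<cdot> (smap B \<odot> Id M (Car B)))) \<cdot> assoc M (Car A) (Car R) (Car B)) (rtens_proj M R A B)"
    unfolding rtens_proj_def ract_def lact_def by (rule someI_ex)
qed (use assms in \<open>simp_all add: is_calg_def monoid_hom_def\<close>)

text \<open>Passage from the explicit definitions to the abstract construction. The essential point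
  is that \<open>ten\<close> solves the \<open>THE\<close> in \<open>rtens\<close>, by
  \<open>ten_p_p\<close> and \<open>ten_unique\<close>.\<close>

lemma rtens_eq:
  assumes "is_calg M R A" "is_calg M R B"
  shows "rtens M R A B = relative_tensor.tensor_monoid M A B (rtens_proj M R A B)"
    "rtens_inl M R A B = relative_tensor.inl M A B (rtens_proj M R A B)"
    "rtens_inr M R A B = relative_tensor.inr M A B (rtens_proj M R A B)"
proof -
  interpret relative_tensor M "Car R" A B "smap A" "smap B" "rtens_proj M R A B"
    by (rule relative_tensor_rtens[OF assms])
  have "(THE m. m \<in> hom M (P \<otimes> P) P \<and> m \<cdot> (rtens_proj M R A B \<odot> rtens_proj M R A B) =
        rtens_proj M R A B \<cdot> (mul A \<odot> mul B) \<cdot> middle_swap M A' B' A' B') = ten"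
    by (rule the_equality) (use ten_unique in \<open>auto simp: in_hom_iff ten_p_p\<close>)
  then show "rtens M R A B = tensor_monoid"
    by (simp add: rtens_def tensor_monoid_def Let_def eps_def)
  show "rtens_inl M R A B = inl" "rtens_inr M R A B = inr"
    by (simp_all add: rtens_inl_def rtens_inr_def inl_def inr_def)
qed

lemma rtens_facts:
  assumes "is_calg M R A" "is_calg M R B"
  shows "comm_monoid_in M (rtens M R A B)"
    "monoid_hom M A (rtens M R A B) (rtens_inl M R A B)"
    "monoid_hom M B (rtens M R A B) (rtens_inr M R A B)"
    "rtens_inl M R A B \<cdot> smap A = rtens_inr M R A B \<cdot> smap B"
proof -
  interpret relative_tensor M "Car R" A B "smap A" "smap B" "rtens_proj M R A B"
    by (rule relative_tensor_rtens[OF assms])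
  show "comm_monoid_in M (rtens M R A B)"
    "monoid_hom M A (rtens M R A B) (rtens_inl M R A B)"
    "monoid_hom M B (rtens M R A B) (rtens_inr M R A B)"
    "rtens_inl M R A B \<cdot> smap A = rtens_inr M R A B \<cdot> smap B"
    by (simp_all only: rtens_eq[OF assms] comm_monoid_tensor inl_hom inr_hom inl_a_eq_inr_b)
qed

text \<open>The composite with \<open>rtens_proj\<close> is recorded as well, because
  \<open>rtens_arr\<close> is defined by such a composite and not by restrictions to the
  factors.\<close>

lemma rtens_map_ex:
  assumes "is_calg M R A" "is_calg M R B" "comm_monoid_in M C" "monoid_hom M A C u" "monoid_hom M B C v"
    and "u \<cdot> smap A = v \<cdot> smap B"
  obtains w where "monoid_hom M (rtens M R A B) C w" "w \<cdot> rtens_inl M R A B = u" "w \<cdot> rtens_inr M R A B = v"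
    "w \<cdot> rtens_proj M R A B = mul C \<cdot> (u \<odot> v)"
proof -
  interpret relative_tensor M "Car R" A B "smap A" "smap B" "rtens_proj M R A B"
    by (rule relative_tensor_rtens[OF assms(1,2)])
  obtain w where w: "monoid_hom M tensor_monoid C w" "w \<cdot> rtens_proj M R A B = mul C \<cdot> (u \<odot> v)"
    using pushout_map_ex[OF assms(3-6)] by blast
  moreover have "w \<cdot> inl = u" "w \<cdot> inr = v"
    using pushout_map_restrict[OF assms(3-5) _ _ w(2)] monoid_homD[OF w(1)] by simp_all
  ultimately show thesis
    using that unfolding rtens_eq[OF assms(1,2)] by blast
qed

lemma rtens_map_unique:
  assumes "is_calg M R A" "is_calg M R B" "comm_monoid_in M C"
    and "monoid_hom M (rtens M R A B) C w" "monoid_hom M (rtens M R A B) C w'"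
    and "w \<cdot> rtens_inl M R A B = w' \<cdot> rtens_inl M R A B" "w \<cdot> rtens_inr M R A B = w' \<cdot> rtens_inr M R A B"
  shows "w = w'"
proof -
  interpret relative_tensor M "Car R" A B "smap A" "smap B" "rtens_proj M R A B"
    by (rule relative_tensor_rtens[OF assms(1,2)])
  show ?thesis
    using pushout_map_unique assms(3-) unfolding rtens_eq[OF assms(1,2)] by blast
qed

lemma rtens_arr_facts:
  assumes A: "is_calg M R A" and g: "(B, g, B') \<in> Arr (CAlg M R)"
  shows "monoid_hom M (rtens M R A B) (rtens M R A B') (rtens_arr M R A (B, g, B'))"
    "rtens_arr M R A (B, g, B') \<cdot> rtens_inl M R A B = rtens_inl M R A B'"
    "rtens_arr M R A (B, g, B') \<cdot> rtens_inr M R A B = rtens_inr M R A B' \<cdot> g"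
proof -
  have B: "is_calg M R B" and B': "is_calg M R B'" and gh: "monoid_hom M B B' g" and gs: "g \<cdot> smap B = smap B'"
    using g by auto
  note P = rtens_facts[OF A B] and P' = rtens_facts[OF A B']
  interpret p: relative_tensor M "Car R" A B "smap A" "smap B" "rtens_proj M R A B"
    by (rule relative_tensor_rtens[OF A B])
  interpret p': relative_tensor M "Car R" A B' "smap A" "smap B'" "rtens_proj M R A B'"
    by (rule relative_tensor_rtens[OF A B'])
  note [simp] = monoid_homD[OF gh] monoid_homD[OF P'(3)] monoid_homD[OF P'(2)]
  have "monoid_hom M B (rtens M R A B') (rtens_inr M R A B' \<cdot> g)"
    using monoid_hom_comp[OF gh P'(3) is_calgD(1)[OF B] is_calgD(1)[OF B'] P'(1)] .
  moreover have "rtens_inl M R A B' \<cdot> smap A = rtens_inr M R A B' \<cdot> g \<cdot> smap B"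
    using P'(4) by (simp add: gs)
  ultimately obtain w where w: "monoid_hom M (rtens M R A B) (rtens M R A B') w"
    "w \<cdot> rtens_inl M R A B = rtens_inl M R A B'" "w \<cdot> rtens_inr M R A B = rtens_inr M R A B' \<cdot> g"
    and wp: "w \<cdot> rtens_proj M R A B = mul (rtens M R A B') \<cdot> (rtens_inl M R A B' \<odot> (rtens_inr M R A B' \<cdot> g))"
    using rtens_map_ex[OF A B P'(1) P'(2)] by blast
  \<comment> \<open>Since x \<otimes> 1 times 1 \<otimes> y is x \<otimes> y, the map induced by the
    two inclusions satisfies the equation that defines \<open>rtens_arr\<close>.\<close>
  have "mul (rtens M R A B') \<cdot> (rtens_inl M R A B' \<odot> (rtens_inr M R A B' \<cdot> g)) =
      p'.ten \<cdot> (p'.inl \<odot> p'.inr) \<cdot> (Id M (Car A) \<odot> g)"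
    by (simp add: rtens_eq[OF A B'])
  also have "\<dots> = rtens_proj M R A B' \<cdot> (Id M (Car A) \<odot> g)"
    by (simp only: p'.ten_inl_inr)
  finally have wp': "w \<cdot> rtens_proj M R A B = rtens_proj M R A B' \<cdot> (Id M (Car A) \<odot> g)"
    using wp by simp
  have [simp]: "Car (rtens M R A B) = Cod M (rtens_proj M R A B)" "Car (rtens M R A B') = Cod M (rtens_proj M R A B')"
    by (simp_all add: rtens_eq[OF A B] rtens_eq[OF A B'])
  have "rtens_arr M R A (B, g, B') = w"
    unfolding rtens_arr_def prod.case
  proof (rule the_equality)
    show "w \<in> hom M (Cod M (rtens_proj M R A B)) (Cod M (rtens_proj M R A B')) \<and>
        w \<cdot> rtens_proj M R A B = rtens_proj M R A B' \<cdot> (Id M (Car A) \<odot> g)"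
      using monoid_homD[OF w(1)] wp' by (simp add: in_hom_iff)
    fix k
    assume "k \<in> hom M (Cod M (rtens_proj M R A B)) (Cod M (rtens_proj M R A B')) \<and>
        k \<cdot> rtens_proj M R A B = rtens_proj M R A B' \<cdot> (Id M (Car A) \<odot> g)"
    then show "k = w"
      by - (rule p.p_epi[OF p.coeq], use monoid_homD[OF w(1)] wp' in \<open>auto simp: in_hom_iff\<close>)
  qed
  with w show "monoid_hom M (rtens M R A B) (rtens M R A B') (rtens_arr M R A (B, g, B'))"
    "rtens_arr M R A (B, g, B') \<cdot> rtens_inl M R A B = rtens_inl M R A B'"
    "rtens_arr M R A (B, g, B') \<cdot> rtens_inr M R A B = rtens_inr M R A B' \<cdot> g"
    by simp_all
qed

text \<open>Both sides are pushouts of the same two maps out of R. An isomorphism in M that matches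
  the inclusions is what transports weak equivalences.\<close>

lemma rtens_symmetry:
  assumes A: "is_calg M R A" and B: "is_calg M R B"
  obtains w where "is_iso M w" "Dom M w = Car (rtens M R A B)" "w \<cdot> rtens_inl M R A B = rtens_inr M R B A"
proof -
  note P = rtens_facts[OF A B] and P' = rtens_facts[OF B A]
  obtain w where w: "monoid_hom M (rtens M R A B) (rtens M R B A) w"
    "w \<cdot> rtens_inl M R A B = rtens_inr M R B A" "w \<cdot> rtens_inr M R A B = rtens_inl M R B A"
    using rtens_map_ex[OF A B P'(1) P'(3) P'(2)] P'(4) by metis
  obtain w' where w': "monoid_hom M (rtens M R B A) (rtens M R A B) w'"
    "w' \<cdot> rtens_inl M R B A = rtens_inr M R A B" "w' \<cdot> rtens_inr M R B A = rtens_inl M R A B"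
    using rtens_map_ex[OF B A P(1) P(3) P(2)] P(4) by metis
  note [simp] = monoid_homD[OF w(1)] monoid_homD[OF w'(1)] monoid_homD[OF P(2)] monoid_homD[OF P(3)]
    monoid_homD[OF P'(2)] monoid_homD[OF P'(3)] comm_monoid_arr[OF P(1)] comm_monoid_arr[OF P'(1)]
  have "w' \<cdot> w = Id M (Car (rtens M R A B))"
    by (rule rtens_map_unique[OF A B P(1)])
      (use w w' P P' monoid_hom_comp monoid_hom_id in auto)
  moreover have "w \<cdot> w' = Id M (Car (rtens M R B A))"
    by (rule rtens_map_unique[OF B A P'(1)])
      (use w w' P P' monoid_hom_comp monoid_hom_id in auto)
  ultimately have "is_iso M w"
    by (intro is_isoI[of w w']) simp_all
  then show thesis using that w by simp
qed

text \<open>Pushout along an identity; the inverse is induced by the identity of A and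
  \<open>smap A\<close>. B stands for R as an algebra over itself and is given by its fields, since
  R is a \<open>mon\<close> record and algebras are \<open>alg\<close> records.\<close>

lemma rtens_inl_iso:
  assumes A: "is_calg M R A" and B: "is_calg M R B" and "Car B = Car R" "smap B = Id M (Car R)"
    and R: "comm_monoid_in M R" "mul B = mul R" "one B = one R"
  shows "is_iso M (rtens_inl M R A B)"
proof -
  note P = rtens_facts[OF A B] and A' = is_calgD[OF A] and B' = is_calgD[OF B]
  note [simp] = monoid_homD[OF P(2)] monoid_homD[OF P(3)] monoid_homD[OF A'(2)]
    comm_monoid_arr[OF P(1)] comm_monoid_arr[OF A'(1)] comm_monoid_arr[OF R(1)]
  have "monoid_hom M B A (smap A)"
    using A'(2) assms(3-) by (simp add: monoid_hom_def)
  then obtain w where w: "monoid_hom M (rtens M R A B) A w"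
    "w \<cdot> rtens_inl M R A B = Id M (Car A)" "w \<cdot> rtens_inr M R A B = smap A"
    using rtens_map_ex[OF A B A'(1) monoid_hom_id[OF A'(1)]] assms(4) by (metis comp_id_l comp_id_r monoid_homD A'(2))
  note [simp] = monoid_homD[OF w(1)]
  have "rtens_inl M R A B \<cdot> w = Id M (Car (rtens M R A B))"
  proof (rule rtens_map_unique[OF A B P(1)])
    show "monoid_hom M (rtens M R A B) (rtens M R A B) (rtens_inl M R A B \<cdot> w)"
      by (rule monoid_hom_comp[OF w(1) P(2) P(1) A'(1) P(1)])
    show "rtens_inl M R A B \<cdot> w \<cdot> rtens_inr M R A B = Id M (Car (rtens M R A B)) \<cdot> rtens_inr M R A B"
      using P(4) assms(3,4) by (simp add: w(3))
  qed (simp_all add: monoid_hom_id P(1) w(2))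
  with w(2) show ?thesis
    by (intro is_isoI[of _ w]) simp_all
qed

section \<open>Extension of scalars as left adjoint of restriction\<close>

lemma extension_simps [simp]:
  "fobj (extension M R T f) N =
     with_smap (rtens M R (with_smap T f) N) (rtens_inl M R (with_smap T f) N)"
  "farr (extension M R T f) (N, g, N') =
     (fobj (extension M R T f) N, rtens_arr M R (with_smap T f) (N, g, N'), fobj (extension M R T f) N')"
  by (simp_all add: extension_def Let_def)

lemma scalars_adjunct_simp:
  "scalars_adjunct M R T f N B (X, g, Y) = (N, g \<cdot> rtens_inr M R (with_smap T f) N, with_smap B (smap B \<cdot> f))"
  by (simp add: scalars_adjunct_def)

context
  fixes R T :: "('o, 'm) mon" and f :: 'm
  assumes R: "comm_monoid_in M R" and T: "comm_monoid_in M T" and f: "monoid_hom M R T f"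
begin

lemma is_calg_T: "is_calg M R (with_smap T f)"
  using T f by (simp add: is_calg_def)

lemma is_calg_extension:
  assumes "is_calg M R N"
  shows "is_calg M T (fobj (extension M R T f) N)"
  using rtens_facts[OF is_calg_T assms] by (simp add: is_calg_def)

lemma extension_arr:
  assumes "(N, g, N') \<in> Arr (CAlg M R)"
  shows "farr (extension M R T f) (N, g, N') \<in> Arr (CAlg M T)"
  using assms rtens_arr_facts[OF is_calg_T assms] is_calg_extension by simp

text \<open>The functor laws are equalities of maps out of a pushout, so they are checked on the two
  inclusions, where \<open>rtens_arr_facts\<close> evaluates them.\<close>

lemma extension_functor: "is_functor (CAlg M R) (CAlg M T) (extension M R T f)"
proof -
  let ?T = "with_smap T f"
  have id: "rtens_arr M R ?T (N, Id M (Car N), N) = Id M (Car (rtens M R ?T N))" if N: "is_calg M R N" for N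
  proof -
    note P = rtens_facts[OF is_calg_T N]
    have arr: "(N, Id M (Car N), N) \<in> Arr (CAlg M R)"
      using N category.id_hom[OF category_CAlg, of N R] by (simp add: CAlg_hom_iff)
    note * = rtens_arr_facts[OF is_calg_T arr]
    show ?thesis
      by (rule rtens_map_unique[OF is_calg_T N P(1) *(1) monoid_hom_id[OF P(1)]])
        (use *(2,3) monoid_homD[OF P(2)] monoid_homD[OF P(3)] in simp_all)
  qed
  have comp: "rtens_arr M R ?T (N, h \<cdot> g, L) = rtens_arr M R ?T (K, h, L) \<cdot> rtens_arr M R ?T (N, g, K)"
    if g: "(N, g, K) \<in> Arr (CAlg M R)" and h: "(K, h, L) \<in> Arr (CAlg M R)" for N K L g h
  proof -
    have N: "is_calg M R N" and K: "is_calg M R K" and L: "is_calg M R L"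
      using g h by auto
    note PN = rtens_facts[OF is_calg_T N] and PK = rtens_facts[OF is_calg_T K] and PL = rtens_facts[OF is_calg_T L]
    have gh: "(N, h \<cdot> g, L) \<in> Arr (CAlg M R)"
      using g h category.comp_hom[OF category_CAlg, of "(N, g, K)" R N K "(K, h, L)" L] by (simp add: CAlg_hom_iff)
    note ag = rtens_arr_facts[OF is_calg_T g] and ah = rtens_arr_facts[OF is_calg_T h]
      and agh = rtens_arr_facts[OF is_calg_T gh]
    have [simp]: "g \<in> Arr M" "Dom M g = Car N" "Cod M g = Car K" "h \<in> Arr M" "Dom M h = Car K" "Cod M h = Car L"
      using g h monoid_homD by auto
    note [simp] = monoid_homD[OF ag(1)] monoid_homD[OF ah(1)] monoid_homD[OF PN(2)] monoid_homD[OF PN(3)]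
      monoid_homD[OF PK(2)] monoid_homD[OF PK(3)] monoid_homD[OF PL(3)]
    show ?thesis
      by (rule rtens_map_unique[OF is_calg_T N PL(1) agh(1) monoid_hom_comp[OF ag(1) ah(1) PN(1) PK(1) PL(1)]])
        (simp_all add: agh(2,3) ag(2,3) ah(2) comp_tail[OF ah(3)])
  qed
  show ?thesis
    unfolding is_functor_def
  proof (intro conjI ballI impI category_CAlg)
    fix N assume "N \<in> Obj (CAlg M R)"
    then show "fobj (extension M R T f) N \<in> Obj (CAlg M T)"
      "farr (extension M R T f) (Id (CAlg M R) N) = Id (CAlg M T) (fobj (extension M R T f) N)"
      using is_calg_extension id by auto
  next
    fix x assume x: "x \<in> Arr (CAlg M R)"
    obtain N g K where x_eq: "x = (N, g, K)" by (cases x)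
    show "farr (extension M R T f) x \<in> hom (CAlg M T) (fobj (extension M R T f) (Dom (CAlg M R) x))
        (fobj (extension M R T f) (Cod (CAlg M R) x))"
      using extension_arr[of N g K] x unfolding x_eq in_hom_iff by simp
    fix y assume y: "y \<in> Arr (CAlg M R)" "Dom (CAlg M R) y = Cod (CAlg M R) x"
    then obtain h L where y_eq: "y = (K, h, L)" by (cases y) (auto simp: x_eq)
    show "farr (extension M R T f) (y \<cdot>\<^bsub>CAlg M R\<^esub> x) = farr (extension M R T f) y \<cdot>\<^bsub>CAlg M T\<^esub> farr (extension M R T f) x"
      using comp[of N g K h L] x y unfolding x_eq y_eq by simp
  qed
qed

text \<open>A map of T-algebras out of the extension has its component on T forced to be
  \<open>smap B\<close>. What remains is the component on N, and agreement of the two on R says that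
  it is a map of R-algebras into the restriction of B.\<close>

lemma scalars_adjunct_bij:
  assumes N: "is_calg M R N" and B: "is_calg M T B"
  shows "bij_betw (scalars_adjunct M R T f N B) (hom (CAlg M T) (fobj (extension M R T f) N) B)
    (hom (CAlg M R) N (fobj (restriction M f) B))"
proof -
  let ?T = "with_smap T f" and ?F = "fobj (extension M R T f) N" and ?G = "fobj (restriction M f) B"
  note P = rtens_facts[OF is_calg_T N] and B' = is_calgD[OF B]
  note [simp] = monoid_homD[OF f] monoid_homD[OF P(2)] monoid_homD[OF P(3)] monoid_homD[OF is_calgD(2)[OF N]]
    comm_monoid_arr[OF T] comm_monoid_arr[OF R]
  have G: "is_calg M R ?G"
    using is_calg_restrict[OF B R T f] by simp
  show ?thesis
  proof (rule bij_betw_imageI)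
    show "inj_on (scalars_adjunct M R T f N B) (hom (CAlg M T) ?F B)"
    proof (rule inj_onI)
      fix x y assume x: "x \<in> hom (CAlg M T) ?F B" and y: "y \<in> hom (CAlg M T) ?F B"
        and eq: "scalars_adjunct M R T f N B x = scalars_adjunct M R T f N B y"
      obtain g where g: "x = (?F, g, B)" "monoid_hom M ?F B g" "g \<cdot> smap ?F = smap B"
        using x by (elim CAlg_homE)
      obtain h where h: "y = (?F, h, B)" "monoid_hom M ?F B h" "h \<cdot> smap ?F = smap B"
        using y by (elim CAlg_homE)
      have "g = h"
        by (rule rtens_map_unique[OF is_calg_T N B'(1)]) (use g h eq in \<open>simp_all add: scalars_adjunct_simp\<close>)
      then show "x = y" using g h by simp
    qed
    show "scalars_adjunct M R T f N B ` hom (CAlg M T) ?F B = hom (CAlg M R) N ?G"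
    proof (intro equalityI subsetI)
      fix y assume "y \<in> scalars_adjunct M R T f N B ` hom (CAlg M T) ?F B"
      then obtain g where y: "y = (N, g \<cdot> rtens_inr M R ?T N, ?G)"
        and g: "monoid_hom M (rtens M R ?T N) B g" "g \<cdot> rtens_inl M R ?T N = smap B"
        by (auto elim!: CAlg_homE simp: scalars_adjunct_simp)
      note [simp] = monoid_homD[OF g(1)]
      have "g \<cdot> rtens_inr M R ?T N \<cdot> smap N = g \<cdot> (rtens_inl M R ?T N \<cdot> f)"
        using P(4) by simp
      also have "\<dots> = smap B \<cdot> f"
        by (simp add: g(2) comp_tail[OF g(2)])
      finally show "y \<in> hom (CAlg M R) N ?G"
        using N G monoid_hom_comp[OF P(3) g(1) is_calgD(1)[OF N] P(1) B'(1)] by (simp add: y CAlg_hom_iff)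
    next
      fix y assume y: "y \<in> hom (CAlg M R) N ?G"
      then obtain h where h: "y = (N, h, ?G)" "monoid_hom M N B h" "h \<cdot> smap N = smap B \<cdot> f"
        by (auto elim!: CAlg_homE)
      obtain w where w: "monoid_hom M (rtens M R ?T N) B w" "w \<cdot> rtens_inl M R ?T N = smap B" "w \<cdot> rtens_inr M R ?T N = h"
        using rtens_map_ex[OF is_calg_T N B'(1) _ h(2)] B'(2) h(3) by (metis with_smap_simps(4) monoid_hom_with_smap(1))
      then have "(?F, w, B) \<in> hom (CAlg M T) ?F B" "scalars_adjunct M R T f N B (?F, w, B) = y"
        using B is_calg_extension[OF N] h by (simp_all add: CAlg_hom_iff scalars_adjunct_simp)
      then show "y \<in> scalars_adjunct M R T f N B ` hom (CAlg M T) ?F B" by force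
    qed
  qed
qed

lemma scalars_adjunction:
  "adjunction (CAlg M R) (CAlg M T) (extension M R T f) (restriction M f) (scalars_adjunct M R T f)"
  unfolding adjunction_def
proof (intro conjI ballI extension_functor restriction_functor R T f)
  fix N B assume "N \<in> Obj (CAlg M R)" "B \<in> Obj (CAlg M T)"
  then show "bij_betw (scalars_adjunct M R T f N B) (hom (CAlg M T) (fobj (extension M R T f) N) B)
      (hom (CAlg M R) N (fobj (restriction M f) B))"
    by (intro scalars_adjunct_bij) simp_all
next
  fix x y z assume x: "x \<in> Arr (CAlg M R)" and y: "y \<in> Arr (CAlg M T)"
    and z: "z \<in> hom (CAlg M T) (fobj (extension M R T f) (Cod (CAlg M R) x)) (Dom (CAlg M T) y)"
  let ?T = "with_smap T f"
  obtain N h N' where x_eq: "x = (N, h, N')" by (cases x)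
  obtain B g B' where y_eq: "y = (B, g, B')" by (cases y)
  obtain k where z_eq: "z = (fobj (extension M R T f) N', k, B)" and k: "monoid_hom M (rtens M R ?T N') B k"
    using z unfolding x_eq y_eq by (auto elim!: CAlg_homE)
  have N: "is_calg M R N" "is_calg M R N'" and h: "(N, h, N') \<in> Arr (CAlg M R)" "monoid_hom M N N' h"
    and g: "monoid_hom M B B' g"
    using x y by (auto simp: x_eq y_eq)
  note P = rtens_facts[OF is_calg_T N(1)] and P' = rtens_facts[OF is_calg_T N(2)]
    and a = rtens_arr_facts[OF is_calg_T h(1)]
  note [simp] = monoid_homD[OF k] monoid_homD[OF h(2)] monoid_homD[OF g] monoid_homD[OF P(3)]
    monoid_homD[OF P'(3)] monoid_homD[OF a(1)]
  show "scalars_adjunct M R T f (Dom (CAlg M R) x) (Cod (CAlg M T) y) (y \<cdot>\<^bsub>CAlg M T\<^esub> z \<cdot>\<^bsub>CAlg M T\<^esub> farr (extension M R T f) x) =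
      farr (restriction M f) y \<cdot>\<^bsub>CAlg M R\<^esub> scalars_adjunct M R T f (Cod (CAlg M R) x) (Dom (CAlg M T) y) z \<cdot>\<^bsub>CAlg M R\<^esub> x"
    unfolding x_eq y_eq z_eq by (simp add: scalars_adjunct_simp a(3))
qed

end


section \<open>The Quillen adjunction and the Quillen equivalence\<close>

lemma weq_calg_model_iff:
  "(A, f, B) \<in> weq (calg_model M W R) \<longleftrightarrow> (A, f, B) \<in> Arr (CAlg M R) \<and> f \<in> weq W"
  by (simp add: calg_model_def)

lemma calg_tensor_arr:
  "farr (calg_tensor M R N) (B, g, B') =
     (fobj (calg_tensor M R N) B, rtens_arr M R N (B, g, B'), fobj (calg_tensor M R N) B')"
  by (simp add: calg_tensor_def Let_def)

text \<open>The unit \<open>N \<rightarrow> T \<otimes>\<^sub>R N\<close> factors as \<open>N \<cong> N \<otimes>\<^sub>R R \<rightarrow> N \<otimes>\<^sub>R T \<cong> T \<otimes>\<^sub>R N\<close>.\<close>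

lemma rtens_inr_weq:
  assumes "model_category M U W" and R: "comm_monoid_in M R" and T: "comm_monoid_in M T"
    and f: "monoid_hom M R T f" "f \<in> weq W" and N: "is_calg M R N"
    and flat: "farr (calg_tensor M R N) ` weq (calg_model M W R) \<subseteq> weq (calg_model M W R)"
  shows "rtens_inr M R (with_smap T f) N \<in> weq W"
proof -
  interpret model_category M U W by fact
  \<comment> \<open>R as an algebra over itself, so that \<open>f\<close> becomes an arrow of
    \<open>CAlg M R\<close> to which flatness of N applies.\<close>
  let ?R = "with_smap R (Id M (Car R))" and ?T = "with_smap T f"
  have R': "is_calg M R ?R" and T': "is_calg M R ?T"
    using R T f by (simp_all add: is_calg_def monoid_hom_id)
  have arr: "(?R, f, ?T) \<in> Arr (CAlg M R)"
    using R' T' f monoid_homD[OF f(1)] by simp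
  then have "(?R, f, ?T) \<in> weq (calg_model M W R)"
    using f(2) by (simp only: weq_calg_model_iff)
  then have "farr (calg_tensor M R N) (?R, f, ?T) \<in> weq (calg_model M W R)"
    using flat by blast
  then have k: "rtens_arr M R N (?R, f, ?T) \<in> weq W"
    by (simp add: weq_calg_model_iff calg_tensor_arr)
  note a = rtens_arr_facts[OF N arr] and P = rtens_facts[OF N R'] and P' = rtens_facts[OF N T']
  have "rtens_inl M R N ?R \<in> weq W"
    by (rule iso_weq[OF rtens_inl_iso[OF N R']]) (simp_all add: R)
  from weq_comp[OF this k] have inl: "rtens_inl M R N ?T \<in> weq W"
    using monoid_homD[OF a(1)] monoid_homD[OF P(2)] a(2) by simp
  obtain w where w: "is_iso M w" "Dom M w = Car (rtens M R N ?T)" "w \<cdot> rtens_inl M R N ?T = rtens_inr M R ?T N"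
    by (rule rtens_symmetry[OF N T'])
  show ?thesis
    using weq_comp[OF inl iso_weq[OF w(1)]] w monoid_homD[OF P'(2)] by simp
qed

text \<open>Restriction does not change the underlying arrow, and fibrations and trivial fibrations
  of algebras are decided there.\<close>

lemma scalars_quillen_adjunction:
  assumes "comm_monoid_in M R" "comm_monoid_in M T" "monoid_hom M R T f"
    and "model_category (CAlg M R) U (calg_model M W R)" "model_category (CAlg M T) U (calg_model M W T)"
  shows "quillen_adjunction U (CAlg M R) (calg_model M W R) (CAlg M T) (calg_model M W T)
    (extension M R T f) (restriction M f) (scalars_adjunct M R T f)"
proof -
  interpret adjoint_functors "CAlg M R" "CAlg M T" "extension M R T f" "restriction M f" "scalars_adjunct M R T f"
    using scalars_adjunction[OF assms(1-3)] by unfold_locales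
  have restr: "farr (restriction M f) (A, g, B) \<in> Arr (CAlg M R)" if "(A, g, B) \<in> Arr (CAlg M T)" for A g B
    using that G(1) by blast
  show ?thesis
  proof (rule quillen_adjunctionI[OF assms(4,5)])
    show "farr (restriction M f) ` fib (calg_model M W T) \<subseteq> fib (calg_model M W R)"
      "farr (restriction M f) ` triv_fib (calg_model M W T) \<subseteq> triv_fib (calg_model M W R)"
      using restr by (auto simp: calg_model_def simp del: CAlg_simps(2))
  qed
qed

lemma scalars_quillen_equivalence:
  assumes M: "model_category M U W" and R: "comm_monoid_in M R" and T: "comm_monoid_in M T"
    and f: "monoid_hom M R T f" "f \<in> weq W" and flat: "cofibrant_calgs_flat M W R"
    and "model_category (CAlg M R) U (calg_model M W R)" "model_category (CAlg M T) U (calg_model M W T)"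
  shows "quillen_equivalence U (CAlg M R) (calg_model M W R) (CAlg M T) (calg_model M W T)
    (extension M R T f) (restriction M f) (scalars_adjunct M R T f)"
  unfolding quillen_equivalence_def
proof (intro conjI ballI impI)
  show "quillen_adjunction U (CAlg M R) (calg_model M W R) (CAlg M T) (calg_model M W T)
      (extension M R T f) (restriction M f) (scalars_adjunct M R T f)"
    by (rule scalars_quillen_adjunction) fact+
  interpret model_category M U W by fact
  fix N B x
  assume "N \<in> Obj (CAlg M R)" and B: "B \<in> Obj (CAlg M T)"
    and cof: "cofibrant (CAlg M R) (calg_model M W R) N \<and> fibrant (CAlg M T) (calg_model M W T) B"
    and x: "x \<in> hom (CAlg M T) (fobj (extension M R T f) N) B"
  then have N: "is_calg M R N" by simp
  have inr: "rtens_inr M R (with_smap T f) N \<in> weq W"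
    using rtens_inr_weq[OF M R T f N] flat cof N unfolding cofibrant_calgs_flat_def by simp
  obtain g where x_eq: "x = (fobj (extension M R T f) N, g, B)" and g: "monoid_hom M (rtens M R (with_smap T f) N) B g"
    using x by (auto elim!: CAlg_homE)
  note P = rtens_facts[OF is_calg_T[OF R T f(1)] N]
  have "x \<in> Arr (CAlg M T)" "scalars_adjunct M R T f N B x \<in> Arr (CAlg M R)"
    using x bij_betwE[OF scalars_adjunct_bij[OF R T f(1) N]] B by (auto simp: in_hom_iff)
  \<comment> \<open>Both memberships become statements in M, about \<open>g\<close> and about
    \<open>g\<close> after the inclusion of N.\<close>
  then have "x \<in> weq (calg_model M W T) \<longleftrightarrow> g \<in> weq W"
    "scalars_adjunct M R T f N B x \<in> weq (calg_model M W R) \<longleftrightarrow> g \<cdot> rtens_inr M R (with_smap T f) N \<in> weq W"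
    unfolding x_eq by (simp_all only: weq_calg_model_iff scalars_adjunct_simp simp_thms)
  then show "x \<in> weq (calg_model M W T) \<longleftrightarrow> scalars_adjunct M R T f N B x \<in> weq (calg_model M W R)"
    using weq_comp_right_iff[OF inr] monoid_homD[OF g] monoid_homD[OF P(3)] by simp
qed

section \<open>Functoriality in the base monoid\<close>

lemma restriction_id:
  "ftor_eq_on (CAlg M R) (restriction M (Id M (Car R))) id_ftor"
proof -
  have "with_smap A (smap A \<cdot> Id M (Car R)) = A" if "is_calg M R A" for A
    using monoid_homD[OF is_calgD(2)[OF that]] by (simp add: with_smap_def)
  then show ?thesis
    by (auto simp: ftor_eq_on_def id_ftor_def)
qed

text \<open>\<open>with_smap\<close> overwrites the structure map, so the two restrictions are equal
  as records once composition is reassociated.\<close>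

lemma restriction_comp:
  assumes "monoid_hom M R S f" "monoid_hom M S T g"
  shows "ftor_eq_on (CAlg M T) (restriction M (g \<cdot> f)) (comp_ftor (restriction M f) (restriction M g))"
proof -
  have "with_smap A (smap A \<cdot> (g \<cdot> f)) = with_smap (with_smap A (smap A \<cdot> g)) (smap A \<cdot> g \<cdot> f)" if "is_calg M T A" for A
    using monoid_homD[OF is_calgD(2)[OF that]] monoid_homD[OF assms(1)] monoid_homD[OF assms(2)]
    by (simp add: with_smap_def)
  then show ?thesis
    by (auto simp: ftor_eq_on_def comp_ftor_def simp del: comp_reassoc)
qed

text \<open>The chosen coequalizer only gives an object isomorphic to N; the isomorphism comes from
  the strict equality of the right adjoints.\<close>

lemma extension_id:
  assumes "comm_monoid_in M R"
  shows "naturally_isomorphic (CAlg M R) (CAlg M R) (extension M R R (Id M (Car R))) id_ftor"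
  by (rule left_adjoint_unique[OF scalars_adjunction adjunction_id restriction_id])
    (simp_all add: assms monoid_hom_id category_CAlg)

lemma extension_comp:
  assumes R: "comm_monoid_in M R" and S: "comm_monoid_in M S" and T: "comm_monoid_in M T"
    and f: "monoid_hom M R S f" and g: "monoid_hom M S T g"
  shows "naturally_isomorphic (CAlg M R) (CAlg M T) (extension M R T (g \<cdot> f))
    (comp_ftor (extension M S T g) (extension M R S f))"
  by (rule left_adjoint_unique[OF scalars_adjunction[OF R T monoid_hom_comp[OF f g R S T]]
      adjunction_comp[OF scalars_adjunction[OF R S f] scalars_adjunction[OF S T g]] restriction_comp[OF f g]])

end

theorem theorem4p1:
  fixes U :: "'u itself"
    and M :: "('o, 'm) smcat"
    and W :: "'m model_structure"
    and I J :: "'m set"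
  assumes "infinite (UNIV :: 'u set)"
    and "monoidal_model_category U M W"
    and "cofibrantly_generated U M W I J"
    and "commutative_monoid_axiom M W"
    and "monoid_axiom U M W"
    and "\<forall>i\<in>I. small_relative_to U M (cell U M (tensor_all M I)) (Dom M i)"
    and "\<forall>j\<in>J. small_relative_to U M (cell U M (tensor_all M J)) (Dom M j)"
    and calg_model_category:
      "\<forall>R. comm_monoid_in M R \<longrightarrow> model_category (CAlg M R) U (calg_model M W R)"
  shows
    "(\<forall>R T f. comm_monoid_in M R \<and> comm_monoid_in M T \<and> monoid_hom M R T f \<longrightarrow>
        quillen_adjunction U (CAlg M R) (calg_model M W R) (CAlg M T) (calg_model M W T)
          (extension M R T f) (restriction M f) (scalars_adjunct M R T f)) \<and>
     (\<forall>R. comm_monoid_in M R \<longrightarrow>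
        ftor_eq_on (CAlg M R) (restriction M (Id M (Car R))) id_ftor \<and>
        naturally_isomorphic (CAlg M R) (CAlg M R) (extension M R R (Id M (Car R))) id_ftor) \<and>
     (\<forall>R S T f g. comm_monoid_in M R \<and> comm_monoid_in M S \<and> comm_monoid_in M T \<and>
        monoid_hom M R S f \<and> monoid_hom M S T g \<longrightarrow>
        ftor_eq_on (CAlg M T) (restriction M (g \<cdot>\<^bsub>M\<^esub> f))
          (comp_ftor (restriction M f) (restriction M g)) \<and>
        naturally_isomorphic (CAlg M R) (CAlg M T) (extension M R T (g \<cdot>\<^bsub>M\<^esub> f))
          (comp_ftor (extension M S T g) (extension M R S f))) \<and>
     (\<forall>R T f. comm_monoid_in M R \<and> comm_monoid_in M T \<and> monoid_hom M R T f \<and>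
        cofibrant_calgs_flat M W R \<and> f \<in> weq W \<longrightarrow>
        quillen_equivalence U (CAlg M R) (calg_model M W R) (CAlg M T) (calg_model M W T)
          (extension M R T f) (restriction M f) (scalars_adjunct M R T f))"
proof -
  have M: "model_category M U W" and closed: "closed_smcat M"
    using assms(2) unfolding monoidal_model_category_def by auto
  interpret model_category M U W by fact
  interpret symmetric_monoidal_category M
    using closed unfolding closed_smcat_def by blast
  interpret closed_symmetric_monoidal_category_with_coequalizers M
    \<comment> \<open>Coequalizers come from cocompleteness, whose index diagrams include the
      parallel pair as \<open>'u\<close> is infinite.\<close>
    by unfold_locales (use closed cocomplete_coequalizer[OF assms(1) category_axioms has_colimits] in blast)+
  show ?thesis
    using calg_model_category M
    by (auto intro!: scalars_quillen_adjunction scalars_quillen_equivalence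
        restriction_id restriction_comp extension_id extension_comp simp del: comp_reassoc)
qed

end
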